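(* Let $m\ge4$ be an integer and $\sigma>0$. There exist a neighbourhood $\mathcal{U}$ of $(0,1,0)$ in $X_\sigma^{m-1/2}(\mathbb{T})\times X_\sigma^{m-1/2}(\mathbb{T})\times H^{m-2}[0,1]$ (here $0$ and $1$ denote the constant functions) and a neighbourhood $\mathcal{V}$ of the function $(x,\psi)\mapsto\psi$ in $Y_\sigma^m(\Pi)$ such that for every $(f,g,F)\in\mathcal{U}$ the boundary value problem $$\Phi(a)=F(\psi)\ \text{in }\Pi,\qquad a(x,0)=f(x),\qquad a(x,1)=g(x),$$ has exactly one solution $a\in\mathcal{V}$, and the solution map $(f,g,F)\mapsto a:\mathcal{U}\to Y_\sigma^m(\Pi)$ is complex analytic.
   Context: $\mathbb{T}=\mathbb{R}/2\pi\mathbb{Z}$, $\Pi=\mathbb{T}\times[0,1]$ with coordinates $(x,\psi)$, $\mathbb{T}_\sigma=\{x+it: x\in\mathbb{T},|t|<\sigma\}$. All functions are complex-valued. For real $s\ge0$, $X_\sigma^s(\mathbb{T})$ is the space of $a(x)=\sum_k\hat a_ke^{ikx}$ with $\|a\|_{X_\sigma^s}^2=\sum_k(1+k^2)^se^{2\sigma|k|}|\hat a_k|^2<\infty$ (equivalently, analytic functions on $\mathbb{T}_\sigma$ with $H^s(\mathbb{T})$ boundary restrictions on $\mathrm{Im}\,z=\pm\sigma$). For an integer $m\ge0$, $Y_\sigma^m(\Pi)$ is the space of $a(x,\psi)=\sum_k\hat a_k(\psi)e^{ikx}$ with $\|a\|_{Y_\sigma^m}^2=\sum_{p+q\le m}\sum_k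 k^{2q}e^{2\sigma|k|}\|D^p\hat a_k\|_{L^2[0,1]}^2<\infty$, $D=d/d\psi$. A function $F\in H^{m-2}[0,1]$ is regarded as the function $(x,\psi)\mapsto F(\psi)$ on $\Pi$. The operator $\Phi$ is $$\Phi(a)=-\frac{1}{a_\psi}a_{xx}+\frac{2a_x}{a_\psi^2}a_{x\psi}-\frac{1+a_x^2}{a_\psi^3}a_{\psi\psi}.$$ (Interpretation: $y=a(x,\psi)$ describes the flow lines, parametrized by the stream function value $\psi$, of a stationary Euler flow without stagnation points in the periodic channel $f(x)\le y\le g(x)$ with vorticity $F(\psi)$.) *)

theory Defs
  imports "HOL-Analysis.Analysis"
begin

text \<open>g is a witness family for f in H^n[0,1]: g 0 = f on [0,1], g j (j le n) is in L^2[0,1],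
  and for j < n, g j is continuous on [0,1] and absolutely continuous with derivative g (j+1):
  g j t = g j 0 + integral from 0 to t of g (j+1).  Thus g j is the j-th (weak) derivative of f.\<close>
definition sob_wit :: "nat \<Rightarrow> (real \<Rightarrow> complex) \<Rightarrow> (nat \<Rightarrow> real \<Rightarrow> complex) \<Rightarrow> bool" where
  "sob_wit n f g \<longleftrightarrow>
     (\<forall>t\<in>{0..1}. g 0 t = f t) \<and>
     (\<forall>j\<le>n. g j absolutely_integrable_on {0..1} \<and>
             (\<lambda>t. (cmod (g j t))^2) integrable_on {0..1}) \<and>
     (\<forall>j<n. continuous_on {0..1} (g j) \<and>
             (\<forall>t\<in>{0..1}. g j t = g j 0 + integral {0..t} (g (Suc j))))"

text \<open>Elements of H^n[0,1] are represented by functions on the real line vanishing outside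
  [0,1] (a normalisation fixing the representative off [0,1]).\<close>
definition sob_H :: "nat \<Rightarrow> (real \<Rightarrow> complex) set" where
  "sob_H n = {f. (\<forall>t. t \<notin> {0..1} \<longrightarrow> f t = 0) \<and> (\<exists>g. sob_wit n f g)}"

text \<open>The p-th weak derivative D^p f (well defined up to null sets, which is all the norms see).\<close>
definition sob_D :: "nat \<Rightarrow> (real \<Rightarrow> complex) \<Rightarrow> nat \<Rightarrow> real \<Rightarrow> complex" where
  "sob_D n f = (SOME g. sob_wit n f g)"

definition L2sq :: "(real \<Rightarrow> complex) \<Rightarrow> real" where
  "L2sq h = integral {0..1} (\<lambda>t. (cmod (h t))^2)"

definition H_norm :: "nat \<Rightarrow> (real \<Rightarrow> complex) \<Rightarrow> real" where
  "H_norm n f = sqrt (\<Sum>p\<le>n. L2sq (sob_D n f p))"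

definition X_weight :: "real \<Rightarrow> real \<Rightarrow> int \<Rightarrow> real" where
  "X_weight \<sigma> s k = (1 + (real_of_int k)^2) powr s * exp (2 * \<sigma> * \<bar>real_of_int k\<bar>)"

text \<open>An element a(x) = sum_k c_k e^{ikx} of X_sigma^s is represented by its coefficient sequence c.\<close>
definition X_sp :: "real \<Rightarrow> real \<Rightarrow> (int \<Rightarrow> complex) set" where
  "X_sp \<sigma> s = {c. (\<lambda>k. X_weight \<sigma> s k * (cmod (c k))^2) summable_on UNIV}"

definition X_norm :: "real \<Rightarrow> real \<Rightarrow> (int \<Rightarrow> complex) \<Rightarrow> real" where
  "X_norm \<sigma> s c = sqrt (infsum (\<lambda>k. X_weight \<sigma> s k * (cmod (c k))^2) UNIV)"

definition xfun :: "(int \<Rightarrow> complex) \<Rightarrow> real \<Rightarrow> complex" where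
  "xfun c x = infsum (\<lambda>k. c k * cis (real_of_int k * x)) UNIV"

text \<open>An element a(x,psi) = sum_k b_k(psi) e^{ikx} is represented by b :: int => real => complex,
  each b k in H^m[0,1].\<close>
definition Y_sum :: "real \<Rightarrow> nat \<Rightarrow> (int \<Rightarrow> real \<Rightarrow> complex) \<Rightarrow> int \<Rightarrow> real" where
  "Y_sum \<sigma> m b k = (\<Sum>p\<le>m. \<Sum>q\<le>m - p.
      (real_of_int k)^(2*q) * exp (2 * \<sigma> * \<bar>real_of_int k\<bar>) * L2sq (sob_D m (b k) p))"

definition Y_sp :: "real \<Rightarrow> nat \<Rightarrow> (int \<Rightarrow> real \<Rightarrow> complex) set" where
  "Y_sp \<sigma> m = {b. (\<forall>k. b k \<in> sob_H m) \<and> Y_sum \<sigma> m b summable_on UNIV}"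

definition Y_norm :: "real \<Rightarrow> nat \<Rightarrow> (int \<Rightarrow> real \<Rightarrow> complex) \<Rightarrow> real" where
  "Y_norm \<sigma> m b = sqrt (infsum (Y_sum \<sigma> m b) UNIV)"

definition yfun :: "(int \<Rightarrow> real \<Rightarrow> complex) \<Rightarrow> real \<Rightarrow> real \<Rightarrow> complex" where
  "yfun b x \<psi> = infsum (\<lambda>k. b k \<psi> * cis (real_of_int k * x)) UNIV"

definition dx :: "(real \<Rightarrow> real \<Rightarrow> complex) \<Rightarrow> real \<Rightarrow> real \<Rightarrow> complex" where
  "dx a x \<psi> = vector_derivative (\<lambda>t. a t \<psi>) (at x)"

definition dpsi :: "(real \<Rightarrow> real \<Rightarrow> complex) \<Rightarrow> real \<Rightarrow> real \<Rightarrow> complex" where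
  "dpsi a x \<psi> = vector_derivative (\<lambda>s. a x s) (at \<psi>)"

definition Phi :: "(real \<Rightarrow> real \<Rightarrow> complex) \<Rightarrow> real \<Rightarrow> real \<Rightarrow> complex" where
  "Phi a x \<psi> =
     - (1 / dpsi a x \<psi>) * dx (dx a) x \<psi>
     + (2 * dx a x \<psi> / (dpsi a x \<psi>)^2) * dpsi (dx a) x \<psi>
     - ((1 + (dx a x \<psi>)^2) / (dpsi a x \<psi>)^3) * dpsi (dpsi a) x \<psi>"

definition solves_bvp ::
  "(int \<Rightarrow> real \<Rightarrow> complex) \<Rightarrow> (int \<Rightarrow> complex) \<times> (int \<Rightarrow> complex) \<times> (real \<Rightarrow> complex) \<Rightarrow> bool" where
  "solves_bvp b u \<longleftrightarrow> (case u of (f, g, F) \<Rightarrow>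
     (\<forall>x. \<forall>\<psi>\<in>{0<..<1}. Phi (yfun b) x \<psi> = F \<psi>) \<and>
     (\<forall>x. yfun b x 0 = xfun f x) \<and>
     (\<forall>x. yfun b x 1 = xfun g x))"

type_synonym data = "(int \<Rightarrow> complex) \<times> (int \<Rightarrow> complex) \<times> (real \<Rightarrow> complex)"

definition D_sp :: "real \<Rightarrow> nat \<Rightarrow> data set" where
  "D_sp \<sigma> m = X_sp \<sigma> (real m - 1/2) \<times> X_sp \<sigma> (real m - 1/2) \<times> sob_H (m - 2)"

definition D_norm :: "real \<Rightarrow> nat \<Rightarrow> data \<Rightarrow> real" where
  "D_norm \<sigma> m u = (case u of (f, g, F) \<Rightarrow>
     X_norm \<sigma> (real m - 1/2) f + X_norm \<sigma> (real m - 1/2) g + H_norm (m - 2) F)"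

definition D_add :: "data \<Rightarrow> data \<Rightarrow> data" where
  "D_add u v = (case u of (f, g, F) \<Rightarrow> case v of (f', g', F') \<Rightarrow>
     (\<lambda>k. f k + f' k, \<lambda>k. g k + g' k, \<lambda>t. F t + F' t))"

definition D_diff :: "data \<Rightarrow> data \<Rightarrow> data" where
  "D_diff u v = (case u of (f, g, F) \<Rightarrow> case v of (f', g', F') \<Rightarrow>
     (\<lambda>k. f k - f' k, \<lambda>k. g k - g' k, \<lambda>t. F t - F' t))"

definition D_scale :: "complex \<Rightarrow> data \<Rightarrow> data" where
  "D_scale c u = (case u of (f, g, F) \<Rightarrow> (\<lambda>k. c * f k, \<lambda>k. c * g k, \<lambda>t. c * F t))"

definition Y_add :: "(int \<Rightarrow> real \<Rightarrow> complex) \<Rightarrow> (int \<Rightarrow> real \<Rightarrow> complex) \<Rightarrow> int \<Rightarrow> real \<Rightarrow> complex" where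
  "Y_add a b = (\<lambda>k t. a k t + b k t)"

definition Y_diff :: "(int \<Rightarrow> real \<Rightarrow> complex) \<Rightarrow> (int \<Rightarrow> real \<Rightarrow> complex) \<Rightarrow> int \<Rightarrow> real \<Rightarrow> complex" where
  "Y_diff a b = (\<lambda>k t. a k t - b k t)"

definition Y_scale :: "complex \<Rightarrow> (int \<Rightarrow> real \<Rightarrow> complex) \<Rightarrow> int \<Rightarrow> real \<Rightarrow> complex" where
  "Y_scale c a = (\<lambda>k t. c * a k t)"

definition bounded_clinear_DY :: "real \<Rightarrow> nat \<Rightarrow> (data \<Rightarrow> int \<Rightarrow> real \<Rightarrow> complex) \<Rightarrow> bool" where
  "bounded_clinear_DY \<sigma> m L \<longleftrightarrow>
     (\<forall>h\<in>D_sp \<sigma> m. L h \<in> Y_sp \<sigma> m) \<and>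
     (\<forall>h\<in>D_sp \<sigma> m. \<forall>h'\<in>D_sp \<sigma> m. L (D_add h h') = Y_add (L h) (L h')) \<and>
     (\<forall>c. \<forall>h\<in>D_sp \<sigma> m. L (D_scale c h) = Y_scale c (L h)) \<and>
     (\<exists>C. \<forall>h\<in>D_sp \<sigma> m. Y_norm \<sigma> m (L h) \<le> C * D_norm \<sigma> m h)"

text \<open>Complex analyticity (holomorphy: complex Frechet differentiability) of S : U -> Y
  on a relatively open subset U of the data space.\<close>
definition analytic_DY :: "real \<Rightarrow> nat \<Rightarrow> data set \<Rightarrow> (data \<Rightarrow> int \<Rightarrow> real \<Rightarrow> complex) \<Rightarrow> bool" where
  "analytic_DY \<sigma> m U S \<longleftrightarrow>
     (\<forall>u\<in>U. S u \<in> Y_sp \<sigma> m) \<and>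
     (\<forall>u\<in>U. \<exists>L. bounded_clinear_DY \<sigma> m L \<and>
        (\<forall>\<epsilon>>0. \<exists>\<delta>>0. \<forall>h\<in>D_sp \<sigma> m. D_norm \<sigma> m h < \<delta> \<longrightarrow> D_add u h \<in> U \<longrightarrow>
            Y_norm \<sigma> m (Y_diff (Y_diff (S (D_add u h)) (S u)) (L h)) \<le> \<epsilon> * D_norm \<sigma> m h))"

definition data0 :: data where
  "data0 = (\<lambda>k. 0, \<lambda>k. if k = 0 then 1 else 0, \<lambda>t. 0)"

definition a0 :: "int \<Rightarrow> real \<Rightarrow> complex" where
  "a0 = (\<lambda>k t. if k = 0 \<and> t \<in> {0..1} then complex_of_real t else 0)"

end

theory Submission
  imports Defs "HOL-Library.Function_Algebras"
begin

text \<open>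
  Write \<open>a = \<psi> + w\<close>, \<open>p = w\<^sub>x\<close> and \<open>q = w\<^sub>\<psi>\<close>. As long as \<open>\<bar>q\<bar> < 1\<close>, multiplying \<open>\<Phi>(a) = F\<close> by
  \<open>(1 + q)\<^sup>3\<close> gives the equivalent equation \<open>\<Delta>w = -F + Q(F, w)\<close>, in which \<open>Q\<close> is a polynomial without constant and
  linear terms in \<open>F\<close> and the derivatives of \<open>w\<close> of order at most two. These all lie in \<open>Y\<close> of order \<open>m - 2 \<ge> 2\<close>,
  which is an algebra: for single Fourier modes a product estimate gains a factor
  \<open>1 / (1 + \<bar>j\<bar>) + 1 / (1 + \<bar>l\<bar>)\<close>, and Young's inequality sums the modes. The Dirichlet problem for the Laplacian gains two
  derivatives (energy estimate in each mode), and the boundary data of regularity \<open>m - 1/2\<close> extend harmonically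
  to \<open>Y\<close> of order \<open>m\<close>. So the problem reads \<open>w = L u + M(u, w)\<close> with \<open>L\<close> bounded linear and \<open>M\<close> a polynomial vanishing
  to second order, which is solved by contraction in a small ball, with complex differentiable dependence on \<open>u\<close>.
\<close>

subsection \<open>Square integrable functions on the unit interval\<close>

text \<open>The equation is quasilinear, but no derivative is lost: the Dirichlet inverse gains
  exactly the two orders that the nonlinear terms cost. Clearing the denominators keeps the
  right-hand side polynomial, so bilinear estimates suffice and no series for 1 / (1 + q) has to be
  summed. The price is that equivalence with the original equation requires |q| < 1 for every
  candidate, so the radius of the solution ball is limited before uniqueness is claimed. The index m
  - 1/2 comes from the energy k coth k of the harmonic profiles, which grows only linearly in k.
  Since \<open>Phi\<close> is pointwise while the norms live on coefficients, a bridge is needed: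
  with n = m - 2 at least 2, the Fourier series of all second derivatives converge absolutely and
  uniformly, and Fourier coefficients can be compared. The spaces are sets of functions that depend
  on \<sigma> and on the order, so linear structure and norms are carried by explicit carrier sets.
  Elements are cut off to 0 outside [0,1], hence the equation is read on the open interval and
  extended to the closed one by continuity.\<close>

definition L2f :: "(real \<Rightarrow> complex) \<Rightarrow> bool" where
  "L2f h \<longleftrightarrow> h absolutely_integrable_on {0..1} \<and> (\<lambda>t. (cmod (h t))^2) integrable_on {0..1}"

definition nL :: "(real \<Rightarrow> complex) \<Rightarrow> real" where
  "nL h = sqrt (L2sq h)"

lemma L2f_cong:
  assumes "\<And>t. t \<in> {0..1} \<Longrightarrow> f t = g t"
  shows "L2f f \<longleftrightarrow> L2f g"
proof -
  have "f absolutely_integrable_on {0..1} \<longleftrightarrow> g absolutely_integrable_on {0..1}"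
    by (intro set_integrable_cong) (use assms in auto)
  moreover have "(\<lambda>t. (cmod (f t))^2) integrable_on {0..1} \<longleftrightarrow> (\<lambda>t. (cmod (g t))^2) integrable_on {0..1}"
    by (intro integrable_cong) (use assms in auto)
  ultimately show ?thesis by (simp add: L2f_def)
qed

lemma nL_cong:
  assumes "\<And>t. t \<in> {0..1} \<Longrightarrow> cmod (f t) = cmod (g t)"
  shows "nL f = nL g"
  unfolding nL_def L2sq_def using assms by (metis (mono_tags, lifting) integral_cong)

lemma L2sq_nonneg: "0 \<le> L2sq h"
  unfolding L2sq_def
  by (cases "(\<lambda>t. (cmod (h t))^2) integrable_on {0..1}") (auto intro: integral_nonneg simp: not_integrable_integral)

lemma nL_nonneg [simp]: "0 \<le> nL h"
  by (simp add: nL_def L2sq_nonneg)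

lemma nL_sq: "(nL h)^2 = L2sq h"
  by (simp add: nL_def L2sq_nonneg)

lemma L2f_measurable: "L2f h \<Longrightarrow> h \<in> borel_measurable (lebesgue_on {0..1})"
  unfolding L2f_def by (auto intro: absolutely_integrable_imp_borel_measurable)

text \<open>A measurable function needs only a bound on its square: the interval is bounded and |h|
  <= 1 + |h|^2, so h itself is integrable as well.\<close>

lemma L2f_intro:
  assumes "h \<in> borel_measurable (lebesgue_on {0..1})" "G integrable_on {0..1}"
    and "\<And>t. t \<in> {0..1} \<Longrightarrow> (cmod (h t))^2 \<le> G t"
  shows "L2f h"
proof -
  have "(\<lambda>t. 1 + G t) integrable_on {0..1}"
    using assms(2) by (intro integrable_add) auto
  moreover have "norm (h t) \<le> 1 + G t" if "t \<in> {0..1}" for t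
  proof -
    have "cmod (h t) \<le> 1 + (cmod (h t))^2"
      using sum_power2_ge_zero[of "cmod (h t) - 1" "cmod (h t)"] by (simp add: power2_eq_square algebra_simps)
    then show ?thesis using assms(3)[OF that] by simp
  qed
  ultimately have 1: "h absolutely_integrable_on {0..1}"
    using assms(1) by (intro measurable_bounded_by_integrable_imp_absolutely_integrable[where g = "\<lambda>t. 1 + G t"]) auto
  have "(\<lambda>t. (cmod (h t))^2) absolutely_integrable_on {0..1}"
    using assms by (intro measurable_bounded_by_integrable_imp_absolutely_integrable[where g = G]) auto
  then show ?thesis using 1 by (simp add: L2f_def set_lebesgue_integral_eq_integral(1))
qed

lemma L2f_sq_integrable: "L2f h \<Longrightarrow> (\<lambda>t. (cmod (h t))^2) integrable_on {0..1}"
  by (simp add: L2f_def)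

lemma L2f_integrable: "L2f h \<Longrightarrow> h integrable_on {0..1}"
  by (simp add: L2f_def set_lebesgue_integral_eq_integral(1))

lemma nL_mono:
  assumes "L2f g" "\<And>t. t \<in> {0..1} \<Longrightarrow> cmod (f t) \<le> cmod (g t)"
  shows "nL f \<le> nL g"
proof (cases "(\<lambda>t. (cmod (f t))^2) integrable_on {0..1}")
  case True
  then show ?thesis
    unfolding nL_def L2sq_def using assms
    by (intro real_sqrt_le_mono integral_le) (auto simp: L2f_def intro: power_mono)
next
  case False
  \<comment> \<open>Default value: the integral of a non-integrable function is 0.\<close>
  then have "nL f = 0" by (simp add: nL_def L2sq_def not_integrable_integral)
  then show ?thesis by simp
qed

text \<open>Young's inequality with a free weight e. Integrated and then optimised in e, it yields
  Minkowski's inequality without an inner product.\<close>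

lemma cmod_add_sq_le:
  assumes "(e::real) > 0"
  shows "(cmod (a + b))^2 \<le> (1 + e) * (cmod a)^2 + (1 + 1/e) * (cmod b)^2"
proof -
  have "(cmod (a+b))^2 \<le> (cmod a + cmod b)^2"
    by (intro power_mono norm_triangle_ineq) auto
  also have "\<dots> \<le> (1 + e) * (cmod a)^2 + (1 + 1/e) * (cmod b)^2"
  proof -
    have "0 \<le> (e * cmod a - cmod b)^2 / e" using assms by simp
    also have "\<dots> = e * (cmod a)^2 + (cmod b)^2/e - 2 * cmod a * cmod b"
      using assms by (simp add: power2_eq_square field_simps)
    finally show ?thesis by (simp add: power2_eq_square algebra_simps)
  qed
  finally show ?thesis .
qed

lemma L2f_add:
  assumes "L2f f" "L2f g" shows "L2f (\<lambda>t. f t + g t)"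
proof (rule L2f_intro)
  show "(\<lambda>t. f t + g t) \<in> borel_measurable (lebesgue_on {0..1})"
    using assms by (intro borel_measurable_add L2f_measurable)
  show "(\<lambda>t. (1+1) * (cmod (f t))^2 + (1+1/1) * (cmod (g t))^2) integrable_on {0..1}"
    using assms by (intro integrable_add integrable_on_mult_right L2f_sq_integrable)
qed (use cmod_add_sq_le[of 1] in auto)

lemma L2f_zero [simp]: "L2f (\<lambda>t. 0)"
  by (rule L2f_intro[where G = "\<lambda>t. 0"]) auto

lemma nL_zero [simp]: "nL (\<lambda>t. 0) = 0"
  by (simp add: nL_def L2sq_def)

lemma L2f_sum:
  assumes "\<And>i. i \<in> I \<Longrightarrow> L2f (f i)" shows "L2f (\<lambda>t. \<Sum>i\<in>I. f i t)"
  using assms by (induction I rule: infinite_finite_induct) (auto intro: L2f_add)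

text \<open>The choice e = b / a would make the bound equal to (a + b)^2. Both numbers are shifted
  by d > 0 to avoid a zero denominator, and then d tends to 0.\<close>

lemma le_square_of_sum_le:
  fixes X a b :: real
  assumes "a \<ge> 0" "b \<ge> 0" and "\<And>e. e > 0 \<Longrightarrow> X \<le> (1 + e) * a^2 + (1 + 1/e) * b^2"
  shows "X \<le> (a + b)^2"
proof -
  have *: "X \<le> (a + b + 2*d)^2" if "d > 0" for d
  proof -
    define e where "e = (b + d) / (a + d)"
    have e: "e > 0" using assms that by (simp add: e_def add_nonneg_pos)
    have "X \<le> (1 + e) * a^2 + (1 + 1/e) * b^2" using assms(3)[OF e] .
    also have "\<dots> \<le> (1 + e) * (a+d)^2 + (1 + 1/e) * (b+d)^2"
      using e assms that by (intro add_mono mult_left_mono power_mono) auto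
    also have "\<dots> = (a + d)^2 + (b+d)^2 + 2 * (a+d) * (b+d)"
    proof -
      have nz: "a + d > 0" "b + d > 0" using assms that by auto
      have "e * (a+d)^2 = (a+d)*(b+d)" "1/e * (b+d)^2 = (a+d)*(b+d)"
        using nz by (simp_all add: e_def power2_eq_square)
      then show ?thesis by (simp add: distrib_right)
    qed
    also have "\<dots> = (a + b + 2*d)^2" by (simp add: power2_eq_square algebra_simps)
    finally show ?thesis .
  qed
  have "((\<lambda>d. (a + b + 2*d)^2) \<longlongrightarrow> (a + b + 2*0)^2) (at_right 0)"
    by (intro tendsto_intros)
  then have "X \<le> (a + b + 2*0)^2"
    by (rule tendsto_lowerbound) (auto simp: eventually_at_filter * )
  then show ?thesis by simp
qed

lemma nL_triangle:
  assumes "L2f f" "L2f g" shows "nL (\<lambda>t. f t + g t) \<le> nL f + nL g"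
proof -
  have "(nL (\<lambda>t. f t + g t))^2 \<le> (nL f + nL g)^2"
  proof (rule le_square_of_sum_le)
    fix e :: real assume "e > 0"
    have "L2sq (\<lambda>t. f t + g t) \<le> integral {0..1} (\<lambda>t. (1+e) * (cmod (f t))^2 + (1+1/e) * (cmod (g t))^2)"
      unfolding L2sq_def using assms
      by (intro integral_le integrable_add integrable_on_mult_right L2f_sq_integrable L2f_add cmod_add_sq_le \<open>e > 0\<close>)
    also have "\<dots> = (1+e) * L2sq f + (1+1/e) * L2sq g"
      unfolding L2sq_def using assms
      by (subst integral_add) (auto intro: integrable_on_mult_right L2f_sq_integrable)
    finally show "(nL (\<lambda>t. f t + g t))^2 \<le> (1+e) * (nL f)^2 + (1+1/e) * (nL g)^2"
      by (simp add: nL_sq)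
  qed auto
  then show ?thesis by (rule power2_le_imp_le) simp
qed

lemma nL_sum:
  assumes "\<And>i. i \<in> I \<Longrightarrow> L2f (f i)" shows "nL (\<lambda>t. \<Sum>i\<in>I. f i t) \<le> (\<Sum>i\<in>I. nL (f i))"
  using assms
proof (induction I rule: infinite_finite_induct)
  case (insert x F)
  then have "nL (\<lambda>t. f x t + (\<Sum>i\<in>F. f i t)) \<le> nL (f x) + nL (\<lambda>t. \<Sum>i\<in>F. f i t)"
    by (intro nL_triangle L2f_sum) auto
  with insert show ?case by force
qed auto

lemma L2f_mult:
  assumes "\<phi> \<in> borel_measurable (lebesgue_on {0..1})" "L2f h" "\<And>t. t \<in> {0..1} \<Longrightarrow> cmod (\<phi> t) \<le> M"
  shows "L2f (\<lambda>t. \<phi> t * h t)" "nL (\<lambda>t. \<phi> t * h t) \<le> M * nL h"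
proof -
  have M: "0 \<le> M" using assms(3)[of 0] by (meson atLeastAtMost_iff norm_ge_zero order_trans order_refl zero_le_one)
  have int: "(\<lambda>t. M^2 * (cmod (h t))^2) integrable_on {0..1}"
    using assms(2) by (intro integrable_on_mult_right L2f_sq_integrable)
  have le: "(cmod (\<phi> t * h t))^2 \<le> M^2 * (cmod (h t))^2" if "t \<in> {0..1}" for t
    using assms(3)[OF that] by (auto simp: norm_mult power_mult_distrib intro!: mult_right_mono power_mono)
  show L: "L2f (\<lambda>t. \<phi> t * h t)"
    using le int assms(1) L2f_measurable[OF assms(2)] by (intro L2f_intro) auto
  have "L2sq (\<lambda>t. \<phi> t * h t) \<le> integral {0..1} (\<lambda>t. M^2 * (cmod (h t))^2)"
    unfolding L2sq_def using L le int by (intro integral_le L2f_sq_integrable) auto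
  also have "\<dots> = M^2 * L2sq h" by (simp add: L2sq_def)
  finally have "(nL (\<lambda>t. \<phi> t * h t))^2 \<le> (M * nL h)^2" by (simp add: nL_sq power_mult_distrib)
  then show "nL (\<lambda>t. \<phi> t * h t) \<le> M * nL h" using M by (auto intro: power2_le_imp_le[of _ "M * nL h"])
qed

lemma continuous_measurable_unit:
  "continuous_on {0..1} (\<phi> :: real \<Rightarrow> complex) \<Longrightarrow> \<phi> \<in> borel_measurable (lebesgue_on {0..1})"
  by (intro continuous_imp_measurable_on_sets_lebesgue) auto

lemma continuous_bounded_unit:
  assumes "continuous_on {0..1} (\<phi> :: real \<Rightarrow> complex)"
  obtains M where "M \<ge> 0" "\<And>t. t \<in> {0..1} \<Longrightarrow> cmod (\<phi> t) \<le> M"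
proof -
  have "compact (\<phi> ` {0..1})" using assms by (intro compact_continuous_image) auto
  then obtain M where "\<forall>x\<in>\<phi> ` {0..1}. cmod x \<le> M" by (auto dest!: compact_imp_bounded simp: bounded_iff)
  then show ?thesis using that[of "max M 0"] by (auto simp: le_max_iff_disj)
qed

lemma L2f_mult_continuous:
  assumes "continuous_on {0..1} \<phi>" "L2f h"
  shows "L2f (\<lambda>t. \<phi> t * h t)"
  using assms continuous_bounded_unit[of \<phi>] L2f_mult(1)[OF continuous_measurable_unit] by metis

lemma L2f_const [simp]: "L2f (\<lambda>t. c)"
  by (rule L2f_intro[where G = "\<lambda>t. (cmod c)^2"]) auto

lemma L2f_continuous: "continuous_on {0..1} \<phi> \<Longrightarrow> L2f \<phi>"
  using L2f_mult_continuous[of \<phi> "\<lambda>t. 1"] by simp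

lemma nL_const [simp]: "nL (\<lambda>t. c) = cmod c"
  by (simp add: nL_def L2sq_def)

lemma nL_le_sup:
  assumes "\<And>t. t \<in> {0..1} \<Longrightarrow> cmod (\<phi> t) \<le> M" shows "nL \<phi> \<le> M"
proof -
  have M: "0 \<le> M" using assms[of 0] by (meson atLeastAtMost_iff norm_ge_zero order_trans order_refl zero_le_one)
  then have "nL \<phi> \<le> nL (\<lambda>t. of_real M)" using assms by (intro nL_mono) auto
  then show ?thesis using M by simp
qed

lemma nL_scale: "nL (\<lambda>t. c * h t) = cmod c * nL h"
  unfolding nL_def L2sq_def norm_mult power_mult_distrib integral_mult_right real_sqrt_mult by simp

lemma L2f_scale: "L2f h \<Longrightarrow> L2f (\<lambda>t. c * h t)"
  using L2f_mult(1)[of "\<lambda>t. c" h "cmod c"] by (simp add: borel_measurable_const)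

lemma L2f_minus:
  assumes "L2f h" shows "L2f (\<lambda>t. - h t)"
proof -
  have "(\<lambda>t. - h t) = (\<lambda>t. (-1) * h t)" by simp
  then show ?thesis using L2f_scale[OF assms, of "-1"] by metis
qed

lemma L2f_diff: "L2f f \<Longrightarrow> L2f g \<Longrightarrow> L2f (\<lambda>t. f t - g t)"
  using L2f_add[of f "\<lambda>t. - g t"] L2f_minus[of g] by simp

text \<open>For c > 0 take e = c. For c = 0 a positive I would contradict the hypothesis at e =
  I.\<close>

lemma le_of_AM_GM:
  fixes I c :: real
  assumes "c \<ge> 0" "\<And>e. e > 0 \<Longrightarrow> I \<le> (e + c^2/e)/2" shows "I \<le> c"
proof (cases "c = 0")
  case True
  show ?thesis
  proof (rule ccontr)
    assume "\<not> I \<le> c"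
    then show False using assms(2)[of I] True by auto
  qed
next
  case False
  then show ?thesis using assms(2)[of c] assms(1) by (simp add: power2_eq_square)
qed

lemma L2f_subinterval:
  assumes "L2f h" "0 \<le> a" "b \<le> 1" shows "h integrable_on {a..b}" "(\<lambda>t. cmod (h t)) integrable_on {a..b}"
proof -
  have "h absolutely_integrable_on {a..b}"
    by (rule absolutely_integrable_on_subinterval[where S = "{0..1}" and f = h]) (use assms in \<open>auto simp: L2f_def\<close>)
  then show "h integrable_on {a..b}" "(\<lambda>t. cmod (h t)) integrable_on {a..b}"
    by (auto simp: absolutely_integrable_on_def)
qed

text \<open>Cauchy-Schwarz against the constant 1 on an interval of length one, through 2 |h| <= e +
  |h|^2 / e.\<close>

lemma integral_cmod_le_nL:
  assumes "L2f h"
  shows "integral {0..1} (\<lambda>t. cmod (h t)) \<le> nL h"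
proof (rule le_of_AM_GM)
  fix e :: real assume "e > 0"
  have "integral {0..1} (\<lambda>t. cmod (h t)) \<le> integral {0..1} (\<lambda>t. e/2 + (1/(2*e)) * (cmod (h t))^2)"
  proof (intro integral_le L2f_subinterval assms integrable_add integrable_on_mult_right L2f_sq_integrable)
    fix t
    have "0 \<le> (e - cmod (h t))^2 / (2*e)" using \<open>e > 0\<close> by simp
    also have "\<dots> = e/2 + (1/(2*e)) * (cmod (h t))^2 - cmod (h t)"
      using \<open>e > 0\<close> by (simp add: power2_eq_square field_simps)
    finally show "cmod (h t) \<le> e/2 + (1/(2*e)) * (cmod (h t))^2" by simp
  qed auto
  also have "\<dots> = e/2 + (1/(2*e)) * L2sq h"
    unfolding L2sq_def using assms
    using integrable_on_mult_right[OF L2f_sq_integrable[OF assms], of "1/(2*e)"]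
    by (subst integral_add) auto
  also have "\<dots> = (e + (nL h)^2/e)/2" using \<open>e > 0\<close> by (simp add: nL_sq field_simps)
  finally show "integral {0..1} (\<lambda>t. cmod (h t)) \<le> (e + (nL h)^2/e)/2" .
qed simp

lemma integral_le_nL:
  assumes "L2f h" "0 \<le> a" "b \<le> 1"
  shows "cmod (integral {a..b} h) \<le> nL h"
proof -
  have "cmod (integral {a..b} h) \<le> integral {a..b} (\<lambda>t. cmod (h t))"
    using L2f_subinterval[OF assms] by (intro integral_norm_bound_integral) auto
  also have "\<dots> \<le> integral {0..1} (\<lambda>t. cmod (h t))"
    using assms by (intro integral_subset_le L2f_subinterval) auto
  also have "\<dots> \<le> nL h" by (rule integral_cmod_le_nL[OF assms(1)])
  finally show ?thesis .
qed

lemma L2f_norm_integrable: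
  assumes "L2f h"
  shows "integrable (lebesgue_on {0..1}) (\<lambda>t. cmod (h t))"
proof -
  have "h absolutely_integrable_on {0..1}" using assms by (simp add: L2f_def)
  then have "integrable (lebesgue_on {0..1}) (norm \<circ> h)"
    using absolutely_integrable_measurable[where S = "{0..1}" and f = h] by (metis lmeasurable_interval(1) fmeasurableD interval_cbox)
  then show ?thesis by (simp only: o_def)
qed

text \<open>Uniqueness of weak derivatives rests on this. All integrals over subintervals vanish, so
  the sums controlled by Henstock's lemma are exactly the Riemann sums of |h|; hence |h| has
  integral 0.\<close>

lemma integral_zero_imp_AE_zero:
  assumes L: "L2f h" and z: "\<And>t. t \<in> {0..1} \<Longrightarrow> integral {0..t} h = 0"
  shows "\<exists>N. negligible N \<and> (\<forall>t\<in>{0..1}-N. h t = 0)"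
proof -
  have sub: "integral {a..b} h = 0" if "0 \<le> a" "a \<le> b" "b \<le> 1" for a b
  proof -
    have "integral {0..a} h + integral {a..b} h = integral {0..b} h"
      using that by (intro Henstock_Kurzweil_Integration.integral_combine L2f_subinterval L) auto
    then show ?thesis using z[of a] z[of b] that by auto
  qed
  have int: "h integrable_on cbox 0 1" using L2f_integrable[OF L] by simp
  have "((\<lambda>t. cmod (h t)) has_integral 0) (cbox 0 1)"
    unfolding has_integral
  proof (intro allI impI)
    fix e :: real assume "e > 0"
    obtain \<gamma> where \<gamma>: "gauge \<gamma>"
      and le: "\<And>p. p tagged_partial_division_of (cbox 0 1) \<Longrightarrow> \<gamma> fine p \<Longrightarrow>
             (\<Sum>(x,k)\<in>p. norm (measure lborel k *\<^sub>R h x - integral k h)) < e"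
      by (rule Henstock_lemma[OF int \<open>e > 0\<close>]) (rule that)
    have "norm ((\<Sum>(x,k)\<in>p. measure lborel k *\<^sub>R cmod (h x)) - 0) < e"
      if p: "p tagged_division_of cbox 0 1" "\<gamma> fine p" for p
    proof -
      have "(\<Sum>(x,k)\<in>p. measure lborel k *\<^sub>R cmod (h x)) = (\<Sum>(x,k)\<in>p. norm (measure lborel k *\<^sub>R h x - integral k h))"
      proof (intro sum.cong refl, clarify)
        fix x k assume xk: "(x,k) \<in> p"
        obtain a b where k: "k = cbox a b" using tagged_division_ofD(4)[OF p(1) xk] by blast
        have "x \<in> k" "k \<subseteq> cbox 0 1" using tagged_division_ofD(2,3)[OF p(1) xk] by auto
        then have "integral k h = 0" using k sub[of a b] by auto
        then show "measure lborel k *\<^sub>R cmod (h x) = norm (measure lborel k *\<^sub>R h x - integral k h)" by simp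
      qed
      also have "\<dots> < e" using le p by (simp add: tagged_division_of_def)
      finally show ?thesis
        by (simp add: sum_nonneg split_beta)
    qed
    then show "\<exists>\<gamma>. gauge \<gamma> \<and> (\<forall>\<D>. \<D> tagged_division_of cbox 0 1 \<and> \<gamma> fine \<D> \<longrightarrow>
              norm ((\<Sum>(x,k)\<in>\<D>. measure lborel k *\<^sub>R cmod (h x)) - 0) < e)"
      using \<gamma> by blast
  qed
  then have hi: "((\<lambda>t. cmod (h t)) has_integral 0) {0..1}" by simp
  note int1 = L2f_norm_integrable[OF L]
  have "integral\<^sup>L (lebesgue_on {0..1}) (\<lambda>t. cmod (h t)) = 0"
    using hi lebesgue_integral_eq_integral[OF int1] by (simp add: integral_unique)
  then have "AE t in lebesgue_on {0..1}. cmod (h t) = 0"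
    using integral_nonneg_eq_0_iff_AE[OF int1] by simp
  then have "AE t in lebesgue. t \<in> {0..1} \<longrightarrow> h t = 0"
    by (subst (asm) AE_restrict_space_iff) auto
  then obtain N where "N \<in> null_sets lebesgue" "{t. \<not> (t \<in> {0..1} \<longrightarrow> h t = 0)} \<subseteq> N"
    by (auto simp: eventually_ae_filter)
  then show ?thesis by (intro exI[of _ N]) (auto simp: negligible_iff_null_sets)
qed

section \<open>Null sets and absolutely convergent series in L^2\<close>

lemma L2f_spike:
  assumes "L2f f" "negligible N" "\<And>t. t \<in> {0..1} - N \<Longrightarrow> g t = f t"
  shows "L2f g" "nL g = nL f"
proof -
  have "(\<lambda>t. (cmod (g t))^2) integrable_on {0..1}"
    by (rule integrable_spike[OF L2f_sq_integrable[OF assms(1)] assms(2)]) (use assms(3) in auto)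
  moreover have "g absolutely_integrable_on {0..1}"
    using assms absolutely_integrable_spike[where f = f and g = g and S = N and T = "{0..1}"] by (auto simp: L2f_def)
  ultimately show "L2f g" by (simp add: L2f_def)
  have "L2sq f = L2sq g"
    unfolding L2sq_def by (rule integral_spike[OF assms(2)]) (use assms(3) in auto)
  then show "nL g = nL f" by (simp add: nL_def)
qed

lemma L2f_cmod: "L2f h \<Longrightarrow> L2f (\<lambda>t. of_real (cmod (h t)))"
  by (rule L2f_intro[OF _ L2f_sq_integrable]) (use L2f_measurable in auto)

text \<open>Tonelli: the sum of the |f i| has a finite integral, because each L^1 norm on the unit
  interval is at most \<open>nL\<close>. The sum is therefore finite almost everywhere.\<close>

lemma L2f_AE_summable:
  assumes L: "\<And>i::nat. L2f (f i)" and sm: "summable (\<lambda>i. nL (f i))"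
  shows "\<exists>N. negligible N \<and> (\<forall>t\<in>{0..1}-N. summable (\<lambda>i. cmod (f i t)))"
proof -
  let ?M = "lebesgue_on {0..1::real}"
  have "(\<integral>\<^sup>+t. (\<Sum>i. ennreal (cmod (f i t))) \<partial>?M) = (\<Sum>i. \<integral>\<^sup>+t. ennreal (cmod (f i t)) \<partial>?M)"
    using L L2f_measurable by (intro nn_integral_suminf) auto
  also have "\<dots> \<le> (\<Sum>i. ennreal (nL (f i)))"
  proof (intro suminf_le allI)
    fix i
    have "(\<integral>\<^sup>+t. ennreal (cmod (f i t)) \<partial>?M) = ennreal (integral {0..1} (\<lambda>t. cmod (f i t)))"
      using nn_integral_eq_integral[OF L2f_norm_integrable[OF L[of i]]] lebesgue_integral_eq_integral[OF L2f_norm_integrable[OF L[of i]]]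
      by simp
    also have "\<dots> \<le> ennreal (nL (f i))"
      using integral_cmod_le_nL[OF L[of i]] by (intro ennreal_leI)
    finally show "(\<integral>\<^sup>+t. ennreal (cmod (f i t)) \<partial>?M) \<le> ennreal (nL (f i))" .
  qed auto
  also have "\<dots> < \<infinity>"
    using sm by (simp add: suminf_ennreal2)
  finally have fin: "(\<integral>\<^sup>+t. (\<Sum>i. ennreal (cmod (f i t))) \<partial>?M) \<noteq> \<infinity>" by simp
  have "AE t in ?M. (\<Sum>i. ennreal (cmod (f i t))) \<noteq> \<infinity>"
  proof (rule nn_integral_PInf_AE[OF _ fin])
    show "(\<lambda>t. \<Sum>i. ennreal (cmod (f i t))) \<in> borel_measurable ?M"
      using L L2f_measurable by (intro borel_measurable_suminf_order) auto
  qed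
  then have "AE t in ?M. summable (\<lambda>i. cmod (f i t))"
    by eventually_elim (auto intro: summable_suminf_not_top)
  then have "AE t in lebesgue. t \<in> {0..1} \<longrightarrow> summable (\<lambda>i. cmod (f i t))"
    by (subst (asm) AE_restrict_space_iff) auto
  then obtain N where "N \<in> null_sets lebesgue" "{t. \<not> (t \<in> {0..1} \<longrightarrow> summable (\<lambda>i. cmod (f i t)))} \<subseteq> N"
    by (auto simp: eventually_ae_filter)
  then show ?thesis by (intro exI[of _ N]) (auto simp: negligible_iff_null_sets)
qed

text \<open>Riesz-Fischer for absolutely convergent series. Convergence of the primitives is
  included because it identifies the sum as a weak derivative in
  \<open>sob_H_series\<close>.\<close>

lemma L2_series:
  assumes L: "\<And>i::nat. L2f (f i)" and sm: "summable (\<lambda>i. nL (f i))"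
  obtains s where "L2f s" "nL s \<le> (\<Sum>i. nL (f i))"
    "\<And>t. t \<in> {0..1} \<Longrightarrow> (\<lambda>i. integral {0..t} (f i)) sums integral {0..t} s"
    "\<exists>N. negligible N \<and> (\<forall>t\<in>{0..1}-N. s t = (\<Sum>i. f i t))"
proof -
  define B where "B = (\<Sum>i. nL (f i))"
  have B0: "B \<ge> 0" unfolding B_def using sm by (intro suminf_nonneg) auto
  obtain N where N: "negligible N" and Ns: "\<And>t. t \<in> {0..1} - N \<Longrightarrow> summable (\<lambda>i. cmod (f i t))"
    using L2f_AE_summable[OF L sm] by metis
  \<comment> \<open>Setting the terms to 0 on the exceptional set makes the series converge at every
    point, so its sum is a measurable function without further choices.\<close>
  define g where "g = (\<lambda>i t. if t \<in> N then 0 else f i t)"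
  have g: "L2f (g i)" "nL (g i) = nL (f i)" for i
    using L2f_spike[OF L[of i] N, of "g i"] by (auto simp: g_def)
  have gs: "summable (\<lambda>i. cmod (g i t))" if "t \<in> {0..1}" for t
    using Ns[of t] that by (cases "t \<in> N") (auto simp: g_def)
  define s where "s = (\<lambda>t. \<Sum>i. g i t)"
  \<comment> \<open>The increasing limit of the squared partial sums \<open>K n\<close>. Monotone
    convergence bounds its integral by B^2, and it dominates the square of s.\<close>
  define H where "H = (\<lambda>t. (\<Sum>i. cmod (g i t))^2)"
  define K where "K = (\<lambda>n t. (\<Sum>i<n. cmod (g i t)))"
  have KL: "L2f (\<lambda>t. of_real (K n t))" for n
    unfolding K_def of_real_sum by (intro L2f_sum L2f_cmod g)
  have Knn: "K n t \<ge> 0" for n t unfolding K_def by (intro sum_nonneg) auto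
  have Kint: "(\<lambda>t. (K n t)^2) integrable_on {0..1}" for n
    using L2f_sq_integrable[OF KL[of n]] by simp
  have Kle: "integral {0..1} (\<lambda>t. (K n t)^2) \<le> B^2" for n
  proof -
    have "nL (\<lambda>t. of_real (K n t)) \<le> (\<Sum>i<n. nL (\<lambda>t. of_real (cmod (g i t))))"
      unfolding K_def of_real_sum by (intro nL_sum L2f_cmod g)
    also have "\<dots> = (\<Sum>i<n. nL (f i))"
      by (intro sum.cong refl) (metis (no_types, lifting) g(2) nL_cong norm_of_real abs_norm_cancel)
    also have "\<dots> \<le> B" unfolding B_def by (intro sum_le_suminf sm) auto
    finally have "(nL (\<lambda>t. of_real (K n t)))^2 \<le> B^2" by (intro power_mono) auto
    then show ?thesis by (simp add: nL_sq L2sq_def)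
  qed
  have Klim: "(\<lambda>n. (K n t)^2) \<longlonglongrightarrow> H t" if "t \<in> {0..1}" for t
    unfolding K_def H_def using gs[OF that] by (intro tendsto_intros summable_LIMSEQ)
  have HH: "H integrable_on {0..1} \<and> (\<lambda>k. integral {0..1} (\<lambda>t. (K k t)^2)) \<longlonglongrightarrow> integral {0..1} H"
  proof (rule monotone_convergence_increasing)
    show "(K k t)^2 \<le> (K (Suc k) t)^2" for k t
      using Knn[of k t] by (intro power_mono) (auto simp: K_def)
    have "0 \<le> integral {0..1} (\<lambda>t. (K k t)^2)" for k by (intro integral_nonneg Kint) auto
    then show "bounded (range (\<lambda>k. integral {0..1} (\<lambda>t. (K k t)^2)))"
      using Kle by (intro boundedI[of _ "B^2"]) auto
  qed (use Kint Klim in auto)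
  then have Hint: "H integrable_on {0..1}" by blast
  have HB: "integral {0..1} H \<le> B^2"
    using HH Kle by (meson LIMSEQ_le_const2)
  have sH: "(cmod (s t))^2 \<le> H t" if "t \<in> {0..1}" for t
    unfolding s_def H_def using summable_norm[OF gs[OF that]] by (intro power_mono) auto
  have smeas: "s \<in> borel_measurable (lebesgue_on {0..1})"
    unfolding s_def by (rule borel_measurable_suminf) (use g L2f_measurable in auto)
  have sL: "L2f s" by (rule L2f_intro[OF smeas Hint sH])
  have "L2sq s \<le> integral {0..1} H"
    unfolding L2sq_def by (intro integral_le L2f_sq_integrable sL Hint sH)
  then have "(nL s)^2 \<le> B^2" using HB by (simp add: nL_sq)
  then have "nL s \<le> B" using B0 by (rule power2_le_imp_le)
  moreover have "(\<lambda>i. integral {0..t} (f i)) sums integral {0..t} s" if t: "t \<in> {0..1}" for t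
  proof -
    have gi: "g i integrable_on {0..t}" for i using L2f_subinterval(1)[OF g(1)] t by auto
    have "(\<lambda>n. integral {0..t} (\<lambda>r. \<Sum>i<n. g i r)) \<longlonglongrightarrow> integral {0..t} s"
    \<comment> \<open>The partial sums are bounded by the square root of H, hence by the integrable
      function 1 + H.\<close>
    proof (rule dominated_convergence(2)[where h = "\<lambda>r. 1 + H r"])
      show "(\<lambda>r. \<Sum>i<n. g i r) integrable_on {0..t}" for n
        by (intro integrable_sum gi) auto
      have "H integrable_on {0..t}"
        using t by (intro integrable_subinterval_real[OF Hint]) auto
      then show "(\<lambda>r. 1 + H r) integrable_on {0..t}" by (intro integrable_add) auto
      fix r assume "r \<in> {0..t}"
      then have r: "r \<in> {0..1}" using t by auto
      have "norm (\<Sum>i<n. g i r) \<le> 1 + H r" for n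
      proof -
        have "norm (\<Sum>i<n. g i r) \<le> (\<Sum>i<n. cmod (g i r))" by (rule norm_sum)
        also have "\<dots> \<le> (\<Sum>i. cmod (g i r))" by (intro sum_le_suminf gs r) auto
        also have "\<dots> \<le> 1 + H r" (is "?x \<le> _")
        proof -
          have "0 \<le> (?x - 1)^2 + ?x^2" by simp
          then have "2 * ?x \<le> 1 + 2 * H r" by (simp add: H_def power2_eq_square algebra_simps)
          then show ?thesis by simp
        qed
        finally show ?thesis .
      qed
      then show "norm (\<Sum>i<n. g i r) \<le> 1 + H r" for n .
      show "(\<lambda>n. \<Sum>i<n. g i r) \<longlonglongrightarrow> s r"
        unfolding s_def by (intro summable_LIMSEQ summable_norm_cancel[OF gs[OF r]])
    qed
    moreover have "integral {0..t} (\<lambda>r. \<Sum>i<n. g i r) = (\<Sum>i<n. integral {0..t} (f i))" for n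
    proof -
      have "integral {0..t} (\<lambda>r. \<Sum>i<n. g i r) = (\<Sum>i<n. integral {0..t} (g i))"
        by (intro integral_sum gi) auto
      also have "\<dots> = (\<Sum>i<n. integral {0..t} (f i))"
        by (intro sum.cong refl integral_spike[OF N]) (auto simp: g_def)
      finally show ?thesis .
    qed
    ultimately show ?thesis unfolding sums_def by simp
  qed
  moreover have "\<forall>t\<in>{0..1}-N. s t = (\<Sum>i. f i t)"
    by (auto simp: s_def g_def)
  ultimately show ?thesis using that[OF sL] N unfolding B_def by blast
qed

subsection \<open>Absolutely continuous functions with square integrable derivative\<close>

text \<open>Membership in H^1[0,1] with weak derivative v. It is a relation because v is determined
  only up to null sets.\<close>

definition AC :: "(real \<Rightarrow> complex) \<Rightarrow> (real \<Rightarrow> complex) \<Rightarrow> bool" where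
  "AC u v \<longleftrightarrow> L2f v \<and> (\<forall>t\<in>{0..1}. u t = u 0 + integral {0..t} v)"

lemma AC_L2f: "AC u v \<Longrightarrow> L2f v" by (simp add: AC_def)

lemma AC_eq: "AC u v \<Longrightarrow> t \<in> {0..1} \<Longrightarrow> u t = u 0 + integral {0..t} v"
  unfolding AC_def by blast

lemma AC_continuous:
  assumes "AC u v" shows "continuous_on {0..1} u"
proof -
  have "continuous_on {0..1} (\<lambda>t. u 0 + integral {0..t} v)"
    by (intro continuous_intros indefinite_integral_continuous_1 L2f_integrable AC_L2f[OF assms])
  then show ?thesis by (rule continuous_on_eq) (rule AC_eq[OF assms, symmetric])
qed

lemma AC_L2f': "AC u v \<Longrightarrow> L2f u"
  by (intro L2f_continuous AC_continuous)

lemma AC_diff_interval: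
  assumes "AC u v" "0 \<le> s" "s \<le> t" "t \<le> 1"
  shows "u t - u s = integral {s..t} v"
proof -
  have "integral {0..s} v + integral {s..t} v = integral {0..t} v"
    using assms by (intro Henstock_Kurzweil_Integration.integral_combine L2f_subinterval AC_L2f[OF assms(1)]) auto
  moreover have "u t = u 0 + integral {0..t} v" "u s = u 0 + integral {0..s} v"
    by (rule AC_eq[OF assms(1)]; use assms in simp)+
  ultimately show ?thesis by (metis add_diff_cancel_left add_diff_cancel_left')
qed

text \<open>One-dimensional Sobolev embedding: |u| attains its minimum at some s, where it is at
  most the quadratic mean \<open>nL u\<close>, and u changes by at most \<open>nL v\<close> between
  s and t.\<close>

lemma AC_sup:
  assumes "AC u v" "t \<in> {0..1}" shows "cmod (u t) \<le> nL u + nL v"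
proof -
  have "\<exists>s\<in>{0..1}. \<forall>r\<in>{0..1}. cmod (u s) \<le> cmod (u r)"
    by (intro continuous_attains_inf) (auto intro!: continuous_intros AC_continuous[OF assms(1)])
  then obtain s where s: "s \<in> {0..1}" "\<And>r. r \<in> {0..1} \<Longrightarrow> cmod (u s) \<le> cmod (u r)" by blast
  have "nL (\<lambda>r. u s) \<le> nL u" by (intro nL_mono AC_L2f'[OF assms(1)] s(2))
  then have 1: "cmod (u s) \<le> nL u" by simp
  have "cmod (u t - u s) \<le> nL v"
  proof (cases "s \<le> t")
    case True
    then show ?thesis using AC_diff_interval[OF assms(1), of s t] integral_le_nL[OF AC_L2f[OF assms(1)], of s t] s assms by auto
  next
    case False
    then show ?thesis using AC_diff_interval[OF assms(1), of t s] integral_le_nL[OF AC_L2f[OF assms(1)], of t s] s assms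
      by (auto simp: norm_minus_commute)
  qed
  then show ?thesis using 1 norm_triangle_sub[of "u t" "u s"] by simp
qed

lemma AC_cong:
  assumes "\<And>t. t \<in> {0..1} \<Longrightarrow> u t = u' t" "\<And>t. t \<in> {0..1} \<Longrightarrow> v t = v' t"
  shows "AC u v \<longleftrightarrow> AC u' v'"
proof -
  have "integral {0..t} v = integral {0..t} v'" if "t \<in> {0..1}" for t
    using that assms(2) by (intro integral_cong) auto
  then show ?thesis using assms(1) L2f_cong[of v v', OF assms(2)] by (auto simp: AC_def)
qed

lemma AC_add:
  assumes "AC u v" "AC u' v'" shows "AC (\<lambda>t. u t + u' t) (\<lambda>t. v t + v' t)"
  unfolding AC_def
proof (intro conjI ballI L2f_add AC_L2f[OF assms(1)] AC_L2f[OF assms(2)])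
  fix t :: real assume t: "t \<in> {0..1}"
  have "integral {0..t} (\<lambda>t. v t + v' t) = integral {0..t} v + integral {0..t} v'"
    using t by (intro integral_add L2f_subinterval AC_L2f[OF assms(1)] AC_L2f[OF assms(2)]) auto
  then show "u t + u' t = u 0 + u' 0 + integral {0..t} (\<lambda>t. v t + v' t)"
    using arg_cong2[OF AC_eq[OF assms(1) t] AC_eq[OF assms(2) t], of "(+)"] by (simp only: ac_simps)
qed

lemma AC_scale:
  assumes "AC u v" shows "AC (\<lambda>t. c * u t) (\<lambda>t. c * v t)"
  unfolding AC_def
proof (intro conjI ballI L2f_scale AC_L2f[OF assms])
  fix t :: real assume "t \<in> {0..1}"
  from AC_eq[OF assms this] show "c * u t = c * u 0 + integral {0..t} (\<lambda>t. c * v t)"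
    by (metis distrib_left integral_mult_right)
qed

lemma AC_const [simp]: "AC (\<lambda>t. c) (\<lambda>t. 0)"
  by (simp add: AC_def)

lemma AC_sum:
  assumes "\<And>i. i \<in> I \<Longrightarrow> AC (u i) (v i)" shows "AC (\<lambda>t. \<Sum>i\<in>I. u i t) (\<lambda>t. \<Sum>i\<in>I. v i t)"
  using assms by (induction I rule: infinite_finite_induct) (auto intro: AC_add)

lemma AC_deriv:
  assumes "AC u v" "continuous_on {0..1} v" "t \<in> {0..1}"
  shows "(u has_vector_derivative v t) (at t within {0..1})"
proof -
  have "((\<lambda>x. u 0 + integral {0..x} v) has_vector_derivative 0 + v t) (at t within {0..1})"
    using assms by (intro has_vector_derivative_add has_vector_derivative_const integral_has_vector_derivative) auto
  then show ?thesis
    unfolding add_0_left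
    by (rule has_vector_derivative_transform[OF assms(3), rotated]) (rule AC_eq[OF assms(1)])
qed

lemma AC_I:
  assumes "\<And>t. t \<in> {0..1} \<Longrightarrow> (u has_vector_derivative v t) (at t within {0..1})" "continuous_on {0..1} v"
  shows "AC u v"
  unfolding AC_def
proof (intro conjI ballI L2f_continuous assms(2))
  fix t :: real assume t: "t \<in> {0..1}"
  have "(v has_integral (u t - u 0)) {0..t}"
  proof (rule fundamental_theorem_of_calculus)
    show "(u has_vector_derivative v x) (at x within {0..t})" if "x \<in> {0..t}" for x
      using that t by (intro has_vector_derivative_within_subset[OF assms(1)]) auto
  qed (use t in auto)
  then show "u t = u 0 + integral {0..t} v" by (simp add: integral_unique)
qed

lemma AC_unique:
  assumes "AC u v" "AC u v'"
  shows "\<exists>N. negligible N \<and> (\<forall>t\<in>{0..1}-N. v t = v' t)"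
proof -
  have "\<exists>N. negligible N \<and> (\<forall>t\<in>{0..1}-N. v t - v' t = 0)"
  proof (rule integral_zero_imp_AE_zero)
    show "L2f (\<lambda>t. v t - v' t)" by (intro L2f_diff AC_L2f[OF assms(1)] AC_L2f[OF assms(2)])
    fix t :: real assume t: "t \<in> {0..1}"
    have "integral {0..t} (\<lambda>t. v t - v' t) = integral {0..t} v - integral {0..t} v'"
      using t assms by (intro integral_diff L2f_subinterval AC_L2f) auto
    also have "\<dots> = 0"
    proof -
      have "u t = u 0 + integral {0..t} v" "u t = u 0 + integral {0..t} v'"
        using AC_eq[OF assms(1) t] AC_eq[OF assms(2) t] by auto
      then show ?thesis by (metis add_diff_cancel_left' diff_self)
    qed
    finally show "integral {0..t} (\<lambda>t. v t - v' t) = 0" .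
  qed
  then show ?thesis by auto
qed

text \<open>Cut [0,t] into pieces shorter than d and telescope: the total change of P is at most e
  times the fixed number M t - M 0, for every e.\<close>

lemma constant_of_small_oscillation:
  fixes P :: "real \<Rightarrow> complex" and M :: "real \<Rightarrow> real"
  assumes osc: "\<And>e. e > 0 \<Longrightarrow> \<exists>d>0. \<forall>s t. 0 \<le> s \<longrightarrow> s \<le> t \<longrightarrow> t \<le> 1 \<longrightarrow> t - s < d \<longrightarrow> cmod (P t - P s) \<le> e * (M t - M s)"
    and t: "t \<in> {0..1}"
  shows "P t = P 0"
proof -
  have *: "cmod (P t - P 0) \<le> e * (M t - M 0)" if "e > 0" for e
  proof -
    obtain d where d: "d > 0" "\<And>s t. 0 \<le> s \<Longrightarrow> s \<le> t \<Longrightarrow> t \<le> 1 \<Longrightarrow> t - s < d \<Longrightarrow> cmod (P t - P s) \<le> e * (M t - M s)"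
      using osc[OF \<open>e > 0\<close>] by blast
    obtain n :: nat where n: "inverse (real (Suc n)) < d" using reals_Archimedean[OF d(1)] by blast
    define x where "x = (\<lambda>i. t * real i / real (Suc n))"
    have *: "cmod (P (x i) - P 0) \<le> e * (M (x i) - M 0)" if "i \<le> Suc n" for i
      using that
    proof (induction i)
      case 0 then show ?case by (simp add: x_def)
    next
      case (Suc i)
      have "x (Suc i) - x i = t * inverse (real (Suc n))" unfolding x_def by (simp only: of_nat_Suc divide_inverse distrib_left distrib_right)
      also have "\<dots> \<le> inverse (real (Suc n))" using t by (intro mult_left_le_one_le) auto
      finally have "x (Suc i) - x i < d" using n by simp
      moreover have "x i \<le> x (Suc i)" "0 \<le> x i" using t by (auto simp: x_def intro!: divide_right_mono mult_left_mono)
      moreover have "x (Suc i) \<le> 1"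
      proof -
        have "t * real (Suc i) \<le> 1 * real (Suc n)" using t Suc.prems by (intro mult_mono) auto
        then show ?thesis unfolding x_def by (subst pos_divide_le_eq) auto
      qed
      ultimately have "cmod (P (x (Suc i)) - P (x i)) \<le> e * (M (x (Suc i)) - M (x i))" by (intro d(2)) auto
      moreover have "cmod (P (x i) - P 0) \<le> e * (M (x i) - M 0)" using Suc by simp
      ultimately have "cmod (P (x (Suc i)) - P 0) \<le> e * (M (x (Suc i)) - M (x i)) + e * (M (x i) - M 0)"
        using norm_triangle_ineq[of "P (x (Suc i)) - P (x i)" "P (x i) - P 0"] by simp
      then show ?case by (simp add: algebra_simps)
    qed
    have "x (Suc n) = t" unfolding x_def by (simp del: of_nat_Suc)
    then show ?thesis using *[of "Suc n"] by simp
  qed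
  have "cmod (P t - P 0) \<le> 0"
  proof (rule field_le_epsilon)
    fix e :: real assume e: "e > 0"
    define c where "c = \<bar>M t - M 0\<bar> + 1"
    have c: "c > 0" by (simp add: c_def)
    have "cmod (P t - P 0) \<le> e/c * (M t - M 0)" using e c by (intro *) simp
    also have "\<dots> \<le> e/c * c" using e c by (intro mult_left_mono) (auto simp: c_def)
    finally show "cmod (P t - P 0) \<le> 0 + e" using c by simp
  qed
  then show ?thesis by simp
qed

text \<open>The derivatives are merely square integrable, so the product rule cannot be read off
  pointwise. Instead the defect \<open>P\<close> between the product and its expected primitive is
  shown to oscillate by at most e times the increment of \<open>M\<close>, by uniform continuity of
  \<open>u\<close> and \<open>u'\<close>.\<close>

lemma AC_mult:
  assumes u: "AC u v" and u': "AC u' v'"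
  shows "AC (\<lambda>t. u t * u' t) (\<lambda>t. v t * u' t + u t * v' t)"
proof -
  define w where "w = (\<lambda>t. v t * u' t + u t * v' t)"
  note cu = AC_continuous[OF u] and cu' = AC_continuous[OF u']
  note Lv = AC_L2f[OF u] and Lv' = AC_L2f[OF u']
  have Lw: "L2f w"
  proof -
    have "L2f (\<lambda>t. u' t * v t)" "L2f (\<lambda>t. u t * v' t)"
      by (intro L2f_mult_continuous cu cu' Lv Lv')+
    then show ?thesis unfolding w_def by (intro L2f_add) (simp_all add: mult.commute)
  qed
  define P where "P = (\<lambda>t. u t * u' t - integral {0..t} w)"
  define M where "M = (\<lambda>t. integral {0..t} (\<lambda>r. cmod (v r)) + integral {0..t} (\<lambda>r. cmod (v' r)))"
  have "P t = P 0" if "t \<in> {0..1}" for t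
  proof (rule constant_of_small_oscillation[OF _ that, where M = M])
    fix e :: real assume e: "e > 0"
    have "uniformly_continuous_on {0..1} u" "uniformly_continuous_on {0..1} u'"
      using cu cu' by (auto intro: compact_uniformly_continuous)
    then obtain d1 d2 where d: "d1 > 0" "d2 > 0"
      and d1: "\<And>x y. x \<in> {0..1} \<Longrightarrow> y \<in> {0..1} \<Longrightarrow> dist y x < d1 \<Longrightarrow> dist (u y) (u x) < e"
      and d2: "\<And>x y. x \<in> {0..1} \<Longrightarrow> y \<in> {0..1} \<Longrightarrow> dist y x < d2 \<Longrightarrow> dist (u' y) (u' x) < e"
      using e unfolding uniformly_continuous_on_def by metis
    have "cmod (P t - P s) \<le> e * (M t - M s)" if st: "0 \<le> s" "s \<le> t" "t \<le> 1" "t - s < min d1 d2" for s t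
    proof -
      have sub: "h integrable_on {s..t}" "(\<lambda>r. cmod (h r)) integrable_on {s..t}" if "L2f h" for h
        using L2f_subinterval[OF that] st by auto
      have comb: "integral {0..s} h + integral {s..t} h = integral {0..t} h" if "h integrable_on {0..t}" for h :: "real \<Rightarrow> complex"
        using st that by (intro Henstock_Kurzweil_Integration.integral_combine) auto
      have combr: "integral {0..s} h + integral {s..t} h = integral {0..t} h" if "h integrable_on {0..t}" for h :: "real \<Rightarrow> real"
        using st that by (intro Henstock_Kurzweil_Integration.integral_combine) auto
      \<comment> \<open>Each increment is multiplied by a value frozen at an end point. Comparison
        with \<open>w\<close> then leaves only the small factors \<open>u' t - u' r\<close> and
        \<open>u s - u r\<close>.\<close>
      have "P t - P s = (u t - u s) * u' t + u s * (u' t - u' s) - integral {s..t} w"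
        unfolding P_def using comb[OF L2f_subinterval(1)[OF Lw]] st by (auto simp: algebra_simps)
      also have "\<dots> = integral {s..t} (\<lambda>r. v r * u' t) + integral {s..t} (\<lambda>r. u s * v' r) - integral {s..t} w"
        using AC_diff_interval[OF u st(1-3)] AC_diff_interval[OF u' st(1-3)] by simp
      also have "\<dots> = integral {s..t} (\<lambda>r. v r * u' t + u s * v' r - w r)"
      proof -
        have i: "(\<lambda>r. v r * u' t) integrable_on {s..t}" "(\<lambda>r. u s * v' r) integrable_on {s..t}"
          using sub(1)[OF Lv] sub(1)[OF Lv'] by (auto intro: integrable_on_mult_left integrable_on_mult_right)
        have "integral {s..t} (\<lambda>r. v r * u' t + u s * v' r - w r) = integral {s..t} (\<lambda>r. v r * u' t + u s * v' r) - integral {s..t} w"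
          by (intro integral_diff integrable_add i sub Lw)
        then show ?thesis using integral_add[OF i] by simp
      qed
      also have "\<dots> = integral {s..t} (\<lambda>r. v r * (u' t - u' r) + (u s - u r) * v' r)"
        by (intro integral_cong) (simp add: w_def algebra_simps)
      finally have eq: "P t - P s = \<dots>" .
      have "cmod (integral {s..t} (\<lambda>r. v r * (u' t - u' r) + (u s - u r) * v' r))
          \<le> integral {s..t} (\<lambda>r. e * cmod (v r) + e * cmod (v' r))"
      proof (rule integral_norm_bound_integral)
        have "(\<lambda>r. v r * u' t + u s * v' r - w r) integrable_on {s..t}"
          using sub(1)[OF Lv] sub(1)[OF Lv'] sub(1)[OF Lw]
          by (intro integrable_diff integrable_add integrable_on_mult_left integrable_on_mult_right)
        then show "(\<lambda>r. v r * (u' t - u' r) + (u s - u r) * v' r) integrable_on {s..t}"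
          by (simp add: w_def algebra_simps)
        show "(\<lambda>r. e * cmod (v r) + e * cmod (v' r)) integrable_on {s..t}"
          using sub(2)[OF Lv] sub(2)[OF Lv'] by (intro integrable_add integrable_on_mult_right)
        fix r assume r: "r \<in> {s..t}"
        have "cmod (u' t - u' r) \<le> e" "cmod (u s - u r) \<le> e"
          using d2[of r t] d1[of r s] r st by (auto simp: dist_norm)
        then have "cmod (v r) * cmod (u' t - u' r) \<le> cmod (v r) * e" "cmod (u s - u r) * cmod (v' r) \<le> e * cmod (v' r)"
          by (auto intro: mult_left_mono mult_right_mono)
        then show "cmod (v r * (u' t - u' r) + (u s - u r) * v' r) \<le> e * cmod (v r) + e * cmod (v' r)"
          by (intro norm_triangle_le) (simp add: norm_mult mult.commute)
      qed
      also have "\<dots> = e * (integral {s..t} (\<lambda>r. cmod (v r)) + integral {s..t} (\<lambda>r. cmod (v' r)))"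
        using sub(2)[OF Lv] sub(2)[OF Lv']
        by (subst integral_add) (auto simp: distrib_left intro: integrable_on_cmult_left integrable_on_mult_right)
      also have "\<dots> = e * (M t - M s)"
      proof -
        have "integral {0..s} (\<lambda>r. cmod (v r)) + integral {s..t} (\<lambda>r. cmod (v r)) = integral {0..t} (\<lambda>r. cmod (v r))"
          "integral {0..s} (\<lambda>r. cmod (v' r)) + integral {s..t} (\<lambda>r. cmod (v' r)) = integral {0..t} (\<lambda>r. cmod (v' r))"
          using combr[OF L2f_subinterval(2)[OF Lv]] combr[OF L2f_subinterval(2)[OF Lv']] st by auto
        then show ?thesis unfolding M_def by (smt (verit) distrib_left)
      qed
      finally show ?thesis using eq by simp
    qed
    then show "\<exists>d>0. \<forall>s t. 0 \<le> s \<longrightarrow> s \<le> t \<longrightarrow> t \<le> 1 \<longrightarrow> t - s < d \<longrightarrow> cmod (P t - P s) \<le> e * (M t - M s)"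
      using d by (intro exI[of _ "min d1 d2"]) auto
  qed
  moreover have "P t = P 0 \<Longrightarrow> u t * u' t = u 0 * u' 0 + integral {0..t} w" for t
    unfolding P_def by (simp add: algebra_simps)
  ultimately have "AC (\<lambda>t. u t * u' t) w"
    using Lw unfolding AC_def by blast
  then show ?thesis unfolding w_def .
qed

subsection \<open>Sobolev functions on the unit interval\<close>

text \<open>Derivatives below the top order are absolutely continuous, hence continuous and square
  integrable, so only \<open>g n\<close> needs a condition of its own.\<close>

lemma sob_wit_iff:
  "sob_wit n f g \<longleftrightarrow> (\<forall>t\<in>{0..1}. g 0 t = f t) \<and> L2f (g n) \<and> (\<forall>j<n. AC (g j) (g (Suc j)))"
proof
  assume "sob_wit n f g"
  then have *: "\<forall>t\<in>{0..1}. g 0 t = f t" "\<forall>j\<le>n. L2f (g j)" "\<forall>j<n. \<forall>t\<in>{0..1}. g j t = g j 0 + integral {0..t} (g (Suc j))"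
    unfolding sob_wit_def L2f_def by blast+
  then show "(\<forall>t\<in>{0..1}. g 0 t = f t) \<and> L2f (g n) \<and> (\<forall>j<n. AC (g j) (g (Suc j)))"
    unfolding AC_def by (meson Suc_leI order_refl)
next
  assume *: "(\<forall>t\<in>{0..1}. g 0 t = f t) \<and> L2f (g n) \<and> (\<forall>j<n. AC (g j) (g (Suc j)))"
  have "L2f (g j)" if "j \<le> n" for j
    using * that AC_L2f'[of "g j"] by (metis le_neq_implies_less)
  moreover have "continuous_on {0..1} (g j)" if "j < n" for j
    using * that AC_continuous by blast
  moreover have "\<forall>t\<in>{0..1}. g j t = g j 0 + integral {0..t} (g (Suc j))" if "j < n" for j
    using * that unfolding AC_def by blast
  ultimately show "sob_wit n f g" using * unfolding sob_wit_def L2f_def by blast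
qed

lemma sob_wit_0: "sob_wit n f g \<Longrightarrow> t \<in> {0..1} \<Longrightarrow> g 0 t = f t"
  by (simp add: sob_wit_def)

lemma sob_wit_L2f: "sob_wit n f g \<Longrightarrow> j \<le> n \<Longrightarrow> L2f (g j)"
  unfolding sob_wit_def L2f_def by blast

lemma sob_wit_AC: "sob_wit n f g \<Longrightarrow> j < n \<Longrightarrow> AC (g j) (g (Suc j))"
  by (simp add: sob_wit_iff)

text \<open>Below the top order the derivatives are continuous and determined at every point; the
  top one is determined almost everywhere. Hence the norms do not depend on the choice made in
  \<open>sob_D\<close>.\<close>

lemma sob_wit_unique:
  assumes g: "sob_wit n f g" and h: "sob_wit n f h"
  shows "j < n \<Longrightarrow> t \<in> {0..1} \<Longrightarrow> g j t = h j t" "j \<le> n \<Longrightarrow> nL (g j) = nL (h j)"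
proof -
  have eq: "j < n \<Longrightarrow> \<forall>t\<in>{0..1}. g j t = h j t" for j
  proof (induction j)
    case 0
    then show ?case using sob_wit_0[OF g] sob_wit_0[OF h] by simp
  next
    case (Suc j)
    have A: "AC (g j) (g (Suc j))" "AC (h j) (h (Suc j))" using g h Suc.prems by (auto intro: sob_wit_AC)
    have C: "continuous_on {0..1} (g (Suc j))" "continuous_on {0..1} (h (Suc j))"
      using AC_continuous[OF sob_wit_AC[OF g]] AC_continuous[OF sob_wit_AC[OF h]] Suc.prems by auto
    show ?case
    proof
      fix t :: real assume t: "t \<in> {0..1}"
      have "(g j has_vector_derivative g (Suc j) t) (at t within {0..1})"
        by (rule AC_deriv[OF A(1) C(1) t])
      moreover have "(g j has_vector_derivative h (Suc j) t) (at t within {0..1})"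
        by (rule has_vector_derivative_transform[OF t _ AC_deriv[OF A(2) C(2) t]]) (use Suc in auto)
      ultimately show "g (Suc j) t = h (Suc j) t"
        using vector_derivative_unique_within_closed_interval[of 0 1 t "g j"] t by auto
    qed
  qed
  then show "j < n \<Longrightarrow> t \<in> {0..1} \<Longrightarrow> g j t = h j t" by blast
  show "nL (g j) = nL (h j)" if j: "j \<le> n"
  proof (cases j)
    case 0
    then show ?thesis using sob_wit_0[OF g] sob_wit_0[OF h] by (intro nL_cong) simp
  next
    case (Suc i)
    have "AC (h i) (g (Suc i))"
      using sob_wit_AC[OF g, of i] eq[of i] Suc j by (subst AC_cong[of "h i" "g i" "g (Suc i)" "g (Suc i)"]) auto
    moreover have "AC (h i) (h (Suc i))" using sob_wit_AC[OF h, of i] Suc j by simp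
    ultimately obtain N where N: "negligible N" "\<forall>t\<in>{0..1}-N. g (Suc i) t = h (Suc i) t"
      using AC_unique by blast
    then show ?thesis
      unfolding Suc using sob_wit_L2f[OF h, of "Suc i"] Suc j by (intro L2f_spike(2)) auto
  qed
qed

definition dn :: "nat \<Rightarrow> (real \<Rightarrow> complex) \<Rightarrow> nat \<Rightarrow> real" where
  "dn n f p = nL (sob_D n f p)"

lemma dn_nonneg [simp]: "0 \<le> dn n f p" by (simp add: dn_def)

lemma sob_D_wit: "f \<in> sob_H n \<Longrightarrow> sob_wit n f (sob_D n f)"
  unfolding sob_H_def sob_D_def using someI_ex[of "sob_wit n f"] by blast

lemma sob_H_I: "sob_wit n f g \<Longrightarrow> (\<And>t. t \<notin> {0..1} \<Longrightarrow> f t = 0) \<Longrightarrow> f \<in> sob_H n"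
  unfolding sob_H_def by blast

lemma sob_H_off: "f \<in> sob_H n \<Longrightarrow> t \<notin> {0..1} \<Longrightarrow> f t = 0"
  unfolding sob_H_def by blast

lemma dn_eq: 
  assumes "sob_wit n f g" "p \<le> n" shows "dn n f p = nL (g p)"
proof -
  have "sob_wit n f (sob_D n f)" unfolding sob_D_def using assms(1) by (rule someI[of "sob_wit n f"])
  then show ?thesis unfolding dn_def using assms by (intro sob_wit_unique(2))
qed

lemma sob_wit_add:
  assumes "sob_wit n f a" "sob_wit n g b"
  shows "sob_wit n (\<lambda>t. f t + g t) (\<lambda>p t. a p t + b p t)"
  using assms unfolding sob_wit_iff by (auto intro: L2f_add AC_add)

lemma sob_wit_scale:
  assumes "sob_wit n f a" shows "sob_wit n (\<lambda>t. c * f t) (\<lambda>p t. c * a p t)"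
  using assms unfolding sob_wit_iff by (auto intro: L2f_scale AC_scale)

lemma sob_wit_zero: "sob_wit n (\<lambda>t. 0) (\<lambda>p t. 0)"
  unfolding sob_wit_iff by auto

lemma sob_H_add:
  assumes "f \<in> sob_H n" "g \<in> sob_H n"
  shows "(\<lambda>t. f t + g t) \<in> sob_H n" "p \<le> n \<Longrightarrow> dn n (\<lambda>t. f t + g t) p \<le> dn n f p + dn n g p"
proof -
  note w = sob_wit_add[OF sob_D_wit[OF assms(1)] sob_D_wit[OF assms(2)]]
  show "(\<lambda>t. f t + g t) \<in> sob_H n" using w assms by (auto intro: sob_H_I simp: sob_H_off)
  assume "p \<le> n"
  then show "dn n (\<lambda>t. f t + g t) p \<le> dn n f p + dn n g p"
    using dn_eq[OF w] nL_triangle sob_wit_L2f[OF sob_D_wit] assms by (simp add: dn_def)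
qed

lemma sob_H_scale:
  assumes "f \<in> sob_H n"
  shows "(\<lambda>t. c * f t) \<in> sob_H n" "p \<le> n \<Longrightarrow> dn n (\<lambda>t. c * f t) p = cmod c * dn n f p"
proof -
  note w = sob_wit_scale[OF sob_D_wit[OF assms(1)], of c]
  show "(\<lambda>t. c * f t) \<in> sob_H n" using w assms by (auto intro: sob_H_I simp: sob_H_off)
  assume "p \<le> n"
  then show "dn n (\<lambda>t. c * f t) p = cmod c * dn n f p"
    using dn_eq[OF w] nL_scale by (simp add: dn_def)
qed

lemma sob_H_zero: "(\<lambda>t. 0) \<in> sob_H n" "p \<le> n \<Longrightarrow> dn n (\<lambda>t. 0) p = 0"
  using sob_wit_zero by (auto intro: sob_H_I simp: dn_eq[OF sob_wit_zero])

section \<open>The norm of a single Fourier mode\<close>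

definition PQ :: "nat \<Rightarrow> (nat \<times> nat) set" where
  "PQ n = Sigma {..n} (\<lambda>p. {..n - p})"

lemma finite_PQ [simp]: "finite (PQ n)" by (simp add: PQ_def)

lemma PQ_iff: "(p, q) \<in> PQ n \<longleftrightarrow> p + q \<le> n" by (auto simp: PQ_def)

text \<open>Up to the factor \<open>exp (\<sigma> * \<bar>k\<bar>)\<close>, this is the contribution of the \<open>k\<close>-th Fourier mode to the norm of \<open>Y\<close>.\<close>

definition nu :: "nat \<Rightarrow> int \<Rightarrow> (real \<Rightarrow> complex) \<Rightarrow> real" where
  "nu n k f = L2_set (\<lambda>(p, q). \<bar>real_of_int k\<bar> ^ q * dn n f p) (PQ n)"

lemma nu_nonneg [simp]: "0 \<le> nu n k f"
  by (simp add: nu_def L2_set_def sum_nonneg)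

lemma le_nu: "p + q \<le> n \<Longrightarrow> \<bar>real_of_int k\<bar> ^ q * dn n f p \<le> nu n k f"
  unfolding nu_def using member_le_L2_set[of "PQ n" "(p, q)" "\<lambda>(p, q). \<bar>real_of_int k\<bar> ^ q * dn n f p"]
  by (simp add: PQ_iff)

lemma nu_le_sum: "nu n k f \<le> (\<Sum>(p, q)\<in>PQ n. \<bar>real_of_int k\<bar> ^ q * dn n f p)"
  unfolding nu_def by (rule L2_set_le_sum) auto

lemma nu_le:
  fixes M :: real
  assumes "\<And>p q. p + q \<le> n \<Longrightarrow> \<bar>real_of_int k\<bar> ^ q * dn n f p \<le> M"
  shows "nu n k f \<le> card (PQ n) * M"
proof -
  have "(\<Sum>x\<in>PQ n. case x of (p, q) \<Rightarrow> \<bar>real_of_int k\<bar> ^ q * dn n f p) \<le> of_nat (card (PQ n)) * M"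
    by (rule sum_bounded_above) (use assms in \<open>auto simp: PQ_iff\<close>)
  then show ?thesis using nu_le_sum order_trans by blast
qed

lemma nu_triangle:
  assumes "f \<in> sob_H n" "g \<in> sob_H n"
  shows "nu n k (\<lambda>t. f t + g t) \<le> nu n k f + nu n k g"
proof -
  have "nu n k (\<lambda>t. f t + g t) \<le> L2_set (\<lambda>x. (case x of (p, q) \<Rightarrow> \<bar>real_of_int k\<bar> ^ q * dn n f p) + (case x of (p, q) \<Rightarrow> \<bar>real_of_int k\<bar> ^ q * dn n g p)) (PQ n)"
    unfolding nu_def using sob_H_add(2)[OF assms]
    by (intro L2_set_mono) (auto simp: PQ_iff distrib_left[symmetric] intro!: mult_left_mono)
  also have "\<dots> \<le> nu n k f + nu n k g" unfolding nu_def by (rule L2_set_triangle_ineq)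
  finally show ?thesis .
qed

lemma nu_scale:
  assumes "f \<in> sob_H n" shows "nu n k (\<lambda>t. c * f t) = cmod c * nu n k f"
proof -
  have "nu n k (\<lambda>t. c * f t) = L2_set (\<lambda>x. cmod c * (case x of (p, q) \<Rightarrow> \<bar>real_of_int k\<bar> ^ q * dn n f p)) (PQ n)"
    unfolding nu_def by (rule L2_set_cong) (use sob_H_scale(2)[OF assms] in \<open>auto simp: PQ_iff\<close>)
  then show ?thesis by (simp add: nu_def L2_set_right_distrib)
qed

lemma nu_zero [simp]: "nu n k (\<lambda>t. 0) = 0"
  using nu_scale[OF sob_H_zero(1), of n k 0] by simp

lemma sob_wit_sup:
  assumes "sob_wit n f g" "p < n" "t \<in> {0..1}" shows "cmod (g p t) \<le> dn n f p + dn n f (Suc p)"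
  using AC_sup[OF sob_wit_AC[OF assms(1,2)] assms(3)] dn_eq[OF assms(1)] assms(2) by simp

lemma sob_H_sup:
  assumes "f \<in> sob_H n" "0 < n" shows "cmod (f t) \<le> dn n f 0 + dn n f 1"
proof (cases "t \<in> {0..1}")
  case True
  then show ?thesis using sob_wit_sup[OF sob_D_wit[OF assms(1)] assms(2) True] sob_wit_0[OF sob_D_wit[OF assms(1)] True] by simp
next
  case False
  then show ?thesis using sob_H_off[OF assms(1)] by simp
qed

lemma sob_H_sup_nu:
  assumes "f \<in> sob_H n" "0 < n" shows "cmod (f t) \<le> 2 * nu n k f"
  using sob_H_sup[OF assms, of t] le_nu[of 0 0 n k f] le_nu[of 1 0 n k f] assms(2) by simp

text \<open>For n >= 2 the Sobolev embedding in t leaves one power of k to spare. The resulting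
  factor 1 / (1 + |k|) is square summable, which is what makes mode sums and convolutions
  converge.\<close>

lemma sob_H_sup_nu2:
  assumes "f \<in> sob_H n" "2 \<le> n" shows "(1 + \<bar>real_of_int k\<bar>) * (dn n f 0 + dn n f 1) \<le> 4 * nu n k f"
  using le_nu[of 0 0 n k f] le_nu[of 1 0 n k f] le_nu[of 0 1 n k f] le_nu[of 1 1 n k f] assms(2)
  by (simp add: algebra_simps)

lemma sob_H_sup_nu3:
  assumes "f \<in> sob_H n" "2 \<le> n" shows "cmod (f t) \<le> 4 * nu n k f / (1 + \<bar>real_of_int k\<bar>)"
proof -
  have "(1 + \<bar>real_of_int k\<bar>) * cmod (f t) \<le> (1 + \<bar>real_of_int k\<bar>) * (dn n f 0 + dn n f 1)"
    using sob_H_sup[OF assms(1), of t] assms(2) by (intro mult_left_mono) auto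
  then show ?thesis using sob_H_sup_nu2[OF assms, of k] by (simp add: field_simps)
qed

text \<open>Minkowski's inequality for the partial sums, followed by a limit.\<close>

lemma L2_set_suminf:
  assumes "finite A" "\<And>i a. a \<in> A \<Longrightarrow> 0 \<le> (f i a :: real)" "\<And>a. a \<in> A \<Longrightarrow> summable (\<lambda>i::nat. f i a)"
    and sm: "summable (\<lambda>i. L2_set (f i) A)"
  shows "L2_set (\<lambda>a. \<Sum>i. f i a) A \<le> (\<Sum>i. L2_set (f i) A)"
proof (rule LIMSEQ_le_const2)
  have "(\<lambda>n. sqrt (\<Sum>a\<in>A. (\<Sum>i<n. f i a)^2)) \<longlonglongrightarrow> sqrt (\<Sum>a\<in>A. (\<Sum>i. f i a)^2)"
    using assms(3) by (intro tendsto_intros summable_LIMSEQ)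
  then show "(\<lambda>n. L2_set (\<lambda>a. \<Sum>i<n. f i a) A) \<longlonglongrightarrow> L2_set (\<lambda>a. \<Sum>i. f i a) A"
    by (simp add: L2_set_def)
  have "L2_set (\<lambda>a. \<Sum>i<n. f i a) A \<le> (\<Sum>i<n. L2_set (f i) A)" for n
  proof (induction n)
    case 0 show ?case by (simp add: L2_set_def)
  next
    case (Suc n)
    have "L2_set (\<lambda>a. (\<Sum>i<n. f i a) + f n a) A \<le> L2_set (\<lambda>a. \<Sum>i<n. f i a) A + L2_set (f n) A"
      by (rule L2_set_triangle_ineq)
    then show ?case using Suc by simp
  qed
  also have "(\<Sum>i<n. L2_set (f i) A) \<le> (\<Sum>i. L2_set (f i) A)" for n
    by (intro sum_le_suminf sm) (auto simp: L2_set_nonneg)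
  finally show "\<exists>N. \<forall>n\<ge>N. L2_set (\<lambda>a. \<Sum>i<n. f i a) A \<le> (\<Sum>i. L2_set (f i) A)" by blast
qed

text \<open>Term-by-term weak differentiation, based on the convergence of primitives in
  \<open>L2_series\<close>.\<close>

lemma sob_H_series:
  assumes n: "0 < n" and c: "\<And>i::nat. c i \<in> sob_H n" and sm: "summable (\<lambda>i. nu n k (c i))"
  shows "(\<lambda>t. \<Sum>i. c i t) \<in> sob_H n" "nu n k (\<lambda>t. \<Sum>i. c i t) \<le> (\<Sum>i. nu n k (c i))"
    "summable (\<lambda>i. c i t)"
proof -
  note W = sob_D_wit[OF c]
  define d where "d = (\<lambda>i. sob_D n (c i))"
  have dd: "sob_wit n (c i) (d i)" for i using W by (simp add: d_def)
  have dsm: "summable (\<lambda>i. dn n (c i) p)" if "p \<le> n" for p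
    using le_nu[of p 0 n k] that by (intro summable_comparison_test'[OF sm]) auto
  have nLd: "nL (d i p) = dn n (c i) p" for i p by (simp add: dn_def d_def)
  have ptsm: "summable (\<lambda>i. d i p t)" if "p < n" "t \<in> {0..1}" for p t
  proof (rule summable_comparison_test'[where N = 0])
    show "summable (\<lambda>i. dn n (c i) p + dn n (c i) (Suc p))"
      using that by (intro summable_add dsm) auto
  qed (use sob_wit_sup[OF dd that] in auto)
  have "\<exists>s. L2f s \<and> nL s \<le> (\<Sum>i. dn n (c i) p) \<and> (\<forall>t\<in>{0..1}. (\<lambda>i. integral {0..t} (d i p)) sums integral {0..t} s)
     \<and> (\<exists>N. negligible N \<and> (\<forall>t\<in>{0..1}-N. s t = (\<Sum>i. d i p t)))" if "p \<le> n" for p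
  proof -
    have "L2f (d i p)" "summable (\<lambda>i. nL (d i p))" for i using sob_wit_L2f[OF dd that] dsm[OF that] by (auto simp: nLd)
    from L2_series[OF this] show ?thesis unfolding nLd by metis
  qed
  then obtain s where s: "\<And>p. p \<le> n \<Longrightarrow> L2f (s p)" "\<And>p. p \<le> n \<Longrightarrow> nL (s p) \<le> (\<Sum>i. dn n (c i) p)"
      "\<And>p t. p \<le> n \<Longrightarrow> t \<in> {0..1} \<Longrightarrow> (\<lambda>i. integral {0..t} (d i p)) sums integral {0..t} (s p)"
      "\<And>p. p \<le> n \<Longrightarrow> \<exists>N. negligible N \<and> (\<forall>t\<in>{0..1}-N. s p t = (\<Sum>i. d i p t))"
    by metis
  \<comment> \<open>Below order n the series of derivatives converges at every point by the sup
    bound. At order n it is controlled only in L^2, so the limit from \<open>L2_series\<close> is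
    taken.\<close>
  define g where "g = (\<lambda>p t. if p = n then s n t else (\<Sum>i. d i p t))"
  have gs: "\<exists>N. negligible N \<and> (\<forall>t\<in>{0..1}-N. g p t = s p t)" if "p \<le> n" for p
    using s(4)[OF that] by (cases "p = n") (auto simp: g_def)
  have gL: "L2f (g p)" "nL (g p) \<le> (\<Sum>i. dn n (c i) p)" if "p \<le> n" for p
    using gs[OF that] L2f_spike[OF s(1)[OF that]] s(2)[OF that] by metis+
  have wit: "sob_wit n (\<lambda>t. \<Sum>i. c i t) g"
    unfolding sob_wit_iff
  proof (intro conjI ballI allI impI)
    show "g 0 t = (\<Sum>i. c i t)" if "t \<in> {0..1}" for t
      using n sob_wit_0[OF dd that] by (simp add: g_def)
    show "L2f (g n)" using gL by simp
    fix p assume p: "p < n"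
    show "AC (g p) (g (Suc p))" unfolding AC_def
    proof (intro conjI ballI)
      show "L2f (g (Suc p))" using gL p by simp
      fix t :: real assume t: "t \<in> {0..1}"
      obtain N where N: "negligible N" "\<forall>t\<in>{0..1}-N. g (Suc p) t = s (Suc p) t" using gs[of "Suc p"] p by auto
      have int: "integral {0..t} (g (Suc p)) = integral {0..t} (s (Suc p))"
        using N t by (intro integral_spike[OF N(1)]) auto
      have "(\<lambda>i. d i p 0 + integral {0..t} (d i (Suc p))) sums (g p 0 + integral {0..t} (g (Suc p)))"
        unfolding int using p ptsm[OF p, of 0] s(3)[of "Suc p" t] t
        by (intro sums_add) (auto simp: g_def summable_sums)
      moreover have "d i p 0 + integral {0..t} (d i (Suc p)) = d i p t" for i
        by (rule AC_eq[OF sob_wit_AC[OF dd p] t, symmetric])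
      moreover have "(\<lambda>i. d i p t) sums g p t"
        using ptsm[OF p t] p by (simp add: g_def summable_sums)
      ultimately show "g p t = g p 0 + integral {0..t} (g (Suc p))"
        using sums_unique2 by force
    qed
  qed
  show "(\<lambda>t. \<Sum>i. c i t) \<in> sob_H n"
    by (rule sob_H_I[OF wit]) (simp add: sob_H_off[OF c])
  have csm: "summable (\<lambda>i. \<bar>real_of_int k\<bar> ^ q * dn n (c i) p)" if "p + q \<le> n" for p q
    using dsm[of p] that by (intro summable_mult) auto
  have "nu n k (\<lambda>t. \<Sum>i. c i t) \<le> L2_set (\<lambda>x. \<Sum>i. (case x of (p, q) \<Rightarrow> \<bar>real_of_int k\<bar> ^ q * dn n (c i) p)) (PQ n)"
    unfolding nu_def
  proof (intro L2_set_mono, clarsimp simp: PQ_iff)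
    fix p q assume pq: "p + q \<le> n"
    then have "\<bar>real_of_int k\<bar> ^ q * dn n (\<lambda>t. \<Sum>i. c i t) p \<le> \<bar>real_of_int k\<bar> ^ q * (\<Sum>i. dn n (c i) p)"
      using gL(2)[of p] by (intro mult_left_mono) (auto simp: dn_eq[OF wit])
    also have "\<dots> = (\<Sum>i. \<bar>real_of_int k\<bar> ^ q * dn n (c i) p)"
      using dsm[of p] pq by (simp add: suminf_mult)
    finally show "\<bar>real_of_int k\<bar> ^ q * dn n (\<lambda>t. \<Sum>i. c i t) p \<le> \<dots>" .
  qed (auto simp: PQ_iff)
  also have "\<dots> \<le> (\<Sum>i. nu n k (c i))"
    unfolding nu_def
    by (rule L2_set_suminf) (use csm sm in \<open>auto simp: PQ_iff nu_def\<close>)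
  finally show "nu n k (\<lambda>t. \<Sum>i. c i t) \<le> (\<Sum>i. nu n k (c i))" .
  show "summable (\<lambda>i. c i t)"
    by (rule summable_comparison_test'[OF summable_mult[OF sm, of 2], where N = 0]) (use sob_H_sup_nu[OF c n] in auto)
qed

subsection \<open>Products\<close>

text \<open>Pascal's rule, in the form of the induction step of Leibniz's formula.\<close>

lemma sum_binomial_Suc:
  fixes x y :: "nat \<Rightarrow> 'a::comm_ring_1"
  shows "(\<Sum>i\<le>Suc j. of_nat (Suc j choose i) * (x i * y (Suc j - i)))
    = (\<Sum>i\<le>j. of_nat (j choose i) * (x (Suc i) * y (j - i) + x i * y (Suc (j - i))))"
proof -
  have "(\<Sum>i\<le>Suc j. of_nat (Suc j choose i) * (x i * y (Suc j - i)))
     = x 0 * y (Suc j) + (\<Sum>i\<le>j. of_nat (Suc j choose Suc i) * (x (Suc i) * y (j - i)))"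
    by (subst sum.atMost_Suc_shift) simp
  also have "\<dots> = x 0 * y (Suc j) + (\<Sum>i\<le>j. of_nat (j choose Suc i) * (x (Suc i) * y (j - i)))
      + (\<Sum>i\<le>j. of_nat (j choose i) * (x (Suc i) * y (j - i)))"
    by (simp add: sum.distrib distrib_right algebra_simps)
  also have "x 0 * y (Suc j) + (\<Sum>i\<le>j. of_nat (j choose Suc i) * (x (Suc i) * y (j - i)))
      = (\<Sum>i\<le>Suc j. of_nat (j choose i) * (x i * y (Suc j - i)))"
    by (subst sum.atMost_Suc_shift) (simp add: binomial_eq_0)
  also have "\<dots> = (\<Sum>i\<le>j. of_nat (j choose i) * (x i * y (Suc (j - i))))"
    by (auto intro!: sum.cong simp: Suc_diff_le binomial_eq_0)
  finally show ?thesis by (simp add: sum.distrib distrib_left algebra_simps)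
qed

lemma sob_wit_mult:
  assumes a: "sob_wit n f a" and b: "sob_wit n g b" and n: "0 < n"
  shows "sob_wit n (\<lambda>t. f t * g t) (\<lambda>p t. \<Sum>i\<le>p. of_nat (p choose i) * (a i t * b (p - i) t))"
  unfolding sob_wit_iff
proof (intro conjI ballI allI impI)
  show "(\<Sum>i\<le>0. of_nat (0 choose i) * (a i t * b (0 - i) t)) = f t * g t" if "t \<in> {0..1}" for t
    using sob_wit_0[OF a that] sob_wit_0[OF b that] by simp
  \<comment> \<open>The two orders add up to n > 0, so at least one factor has order below n and is
    continuous; for i = n it is the second one.\<close>
  have "L2f (\<lambda>t. a i t * b (n - i) t)" if "i \<le> n" for i
  proof (cases "i = n")
    case True
    have "L2f (\<lambda>t. b 0 t * a n t)"
      by (intro L2f_mult_continuous AC_continuous[OF sob_wit_AC[OF b n]] sob_wit_L2f[OF a]) simp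
    then show ?thesis using True by (simp add: mult.commute)
  next
    case False
    then show ?thesis using that
      by (intro L2f_mult_continuous AC_continuous[OF sob_wit_AC[OF a]] sob_wit_L2f[OF b]) auto
  qed
  then show "L2f (\<lambda>t. \<Sum>i\<le>n. of_nat (n choose i) * (a i t * b (n - i) t))"
    by (intro L2f_sum L2f_scale) auto
  fix j assume j: "j < n"
  have "AC (\<lambda>t. a i t * b (j - i) t) (\<lambda>t. a (Suc i) t * b (j - i) t + a i t * b (Suc (j - i)) t)" if "i \<le> j" for i
    by (intro AC_mult sob_wit_AC[OF a] sob_wit_AC[OF b]) (use that j in auto)
  then have "AC (\<lambda>t. \<Sum>i\<le>j. of_nat (j choose i) * (a i t * b (j - i) t))
     (\<lambda>t. \<Sum>i\<le>j. of_nat (j choose i) * (a (Suc i) t * b (j - i) t + a i t * b (Suc (j - i)) t))"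
    by (intro AC_sum AC_scale) auto
  then show "AC (\<lambda>t. \<Sum>i\<le>j. of_nat (j choose i) * (a i t * b (j - i) t))
     (\<lambda>t. \<Sum>i\<le>Suc j. of_nat (Suc j choose i) * (a i t * b (Suc j - i) t))"
    unfolding sum_binomial_Suc[of j "\<lambda>i. a i t" "\<lambda>i. b i t" for t] .
qed

lemma nL_mult_wit:
  assumes f: "sob_wit n f g" and "b < n" and h: "L2f h"
  shows "nL (\<lambda>t. g b t * h t) \<le> (dn n f b + dn n f (Suc b)) * nL h"
  by (intro L2f_mult(2) continuous_measurable_unit AC_continuous[OF sob_wit_AC[OF f]] assms sob_wit_sup[OF f])

text \<open>Of two factors of orders \<open>a + q\<close> and \<open>b\<close> with \<open>a + q + b \<le> n\<close>, one always has order low enough to be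
  bounded uniformly in \<open>t\<close> with a derivative to spare; the spare derivative yields the decaying weight.\<close>

lemma product_mode_bound:
  assumes f: "f \<in> sob_H n" and g: "g \<in> sob_H n" and n: "2 \<le> n" and le: "a + b + q \<le> n"
  shows "\<bar>real_of_int j\<bar> ^ q * nL (\<lambda>t. sob_D n f a t * sob_D n g b t)
     \<le> 4 * nu n j f * nu n l g * (1 / (1 + \<bar>real_of_int j\<bar>) + 1 / (1 + \<bar>real_of_int l\<bar>))"
proof -
  define J L F G where "J = \<bar>real_of_int j\<bar>" and "L = \<bar>real_of_int l\<bar>" and "F = nu n j f" and "G = nu n l g"
  have pos: "J \<ge> 0" "L \<ge> 0" "F \<ge> 0" "G \<ge> 0" by (auto simp: J_def L_def F_def G_def)
  note wf = sob_D_wit[OF f] and wg = sob_D_wit[OF g]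
  have nLf: "nL (sob_D n f p) = dn n f p" and nLg: "nL (sob_D n g p) = dn n g p" for p by (simp_all add: dn_def)
  have Fb: "J ^ r * dn n f p \<le> F" if "p + r \<le> n" for p r using le_nu[OF that, of j f] by (simp add: J_def F_def)
  have Gb: "L ^ r * dn n g p \<le> G" if "p + r \<le> n" for p r using le_nu[OF that, of l g] by (simp add: L_def G_def)
  let ?N = "J ^ q * nL (\<lambda>t. sob_D n f a t * sob_D n g b t)"
  \<comment> \<open>Which weight is gained depends on where the top order falls; the sum of the two
    weights in the claim covers both outcomes.\<close>
  have "?N \<le> 4 * F * G * (1 / (1 + L)) \<or> ?N \<le> 4 * F * G * (1 / (1 + J))"
  proof (cases "b = n")
    case True
    then have aq: "a = 0" "q = 0" using le by auto
    have "nL (\<lambda>t. sob_D n f 0 t * sob_D n g n t) \<le> (dn n f 0 + dn n f (Suc 0)) * nL (sob_D n g n)"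
      by (rule nL_mult_wit[OF wf]) (use n sob_wit_L2f[OF wg] in auto)
    then have "nL (\<lambda>t. sob_D n f 0 t * sob_D n g n t) \<le> (dn n f 0 + dn n f 1) * dn n g n"
      by (simp only: nLg One_nat_def)
    moreover have "(dn n f 0 + dn n f 1) \<le> 4 * F / (1 + J)"
      using sob_H_sup_nu2[OF f n, of j] pos by (simp add: J_def F_def field_simps)
    moreover have "dn n g n \<le> G" using Gb[of n 0] by simp
    moreover have "0 \<le> 4 * F / (1 + J)" using pos by simp
    ultimately have "nL (\<lambda>t. sob_D n f 0 t * sob_D n g n t) \<le> 4 * F / (1 + J) * G"
      by (meson dn_nonneg mult_mono order_trans)
    then show ?thesis using aq True by (simp add: field_simps)
  next
    case False
    show ?thesis
    proof (cases "a + q = n")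
      case True
      then have b: "b = 0" using le by auto
      have "nL (\<lambda>t. sob_D n g 0 t * sob_D n f a t) \<le> (dn n g 0 + dn n g (Suc 0)) * nL (sob_D n f a)"
        by (rule nL_mult_wit[OF wg]) (use n True sob_wit_L2f[OF wf] in auto)
      then have "nL (\<lambda>t. sob_D n g 0 t * sob_D n f a t) \<le> (dn n g 0 + dn n g 1) * dn n f a"
        by (simp only: nLf One_nat_def)
      then have "?N \<le> J ^ q * ((dn n g 0 + dn n g 1) * dn n f a)"
        using b pos by (intro mult_left_mono) (auto simp: mult.commute)
      also have "\<dots> = (dn n g 0 + dn n g 1) * (J ^ q * dn n f a)" by simp
      also have "\<dots> \<le> 4 * G / (1 + L) * F"
      proof (rule mult_mono)
        show "dn n g 0 + dn n g 1 \<le> 4 * G / (1 + L)"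
          using sob_H_sup_nu2[OF g n, of l] pos by (simp add: L_def G_def field_simps)
        show "J ^ q * dn n f a \<le> F" using Fb True by simp
      qed (use pos in auto)
      finally show ?thesis by (simp add: field_simps)
    next
      case F: False
      \<comment> \<open>Neither factor exhausts the order n: f affords one more t-derivative for its
        sup bound, and g one more power of l, which produces the weight.\<close>
      have "nL (\<lambda>t. sob_D n f a t * sob_D n g b t) \<le> (dn n f a + dn n f (Suc a)) * nL (sob_D n g b)"
        by (rule nL_mult_wit[OF wf]) (use F le sob_wit_L2f[OF wg] in auto)
      then have "nL (\<lambda>t. sob_D n f a t * sob_D n g b t) \<le> (dn n f a + dn n f (Suc a)) * dn n g b"
        by (simp only: nLg)
      then have "?N \<le> J ^ q * ((dn n f a + dn n f (Suc a)) * dn n g b)"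
        using pos by (intro mult_left_mono) auto
      also have "\<dots> = (J ^ q * dn n f a + J ^ q * dn n f (Suc a)) * dn n g b" by (simp add: algebra_simps)
      also have "\<dots> \<le> (2 * F) * (2 * G / (1 + L))"
      proof (rule mult_mono)
        show "J ^ q * dn n f a + J ^ q * dn n f (Suc a) \<le> 2 * F"
          using Fb[of a q] Fb[of "Suc a" q] F le by auto
        have "(1 + L) * dn n g b \<le> 2 * G"
          using Gb[of b 0] Gb[of b 1] False le by (simp add: algebra_simps)
        then show "dn n g b \<le> 2 * G / (1 + L)" using pos by (simp add: field_simps)
      qed (use pos in auto)
      finally show ?thesis by (simp add: field_simps)
    qed
  qed
  moreover have "4 * F * G * (1 / (1 + L)) \<le> 4 * F * G * (1 / (1 + J) + 1 / (1 + L))"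
    "4 * F * G * (1 / (1 + J)) \<le> 4 * F * G * (1 / (1 + J) + 1 / (1 + L))"
    using pos by (intro mult_left_mono; simp)+
  ultimately show ?thesis unfolding J_def L_def F_def G_def by linarith
qed

text \<open>Leibniz's coefficients, times 2^q from splitting |j + l|^q, times 8 = 4 + 4 from
  applying \<open>product_mode_bound\<close> in both orders.\<close>

definition Cmul :: "nat \<Rightarrow> real" where
  "Cmul n = (\<Sum>(p, q)\<in>PQ n. \<Sum>i\<le>p. real (p choose i) * (2 ^ q * 8))"

lemma Cmul_nonneg: "0 \<le> Cmul n"
  unfolding Cmul_def by (intro sum_nonneg) (auto intro!: sum_nonneg)

text \<open>Leibniz's formula, with the frequency power placed on one factor at a time: |j + l|^q is
  at most 2^q (|j|^q + |l|^q), and each half is an instance of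
  \<open>product_mode_bound\<close>.\<close>

lemma sob_H_mult:
  assumes f: "f \<in> sob_H n" and g: "g \<in> sob_H n" and n: "2 \<le> n"
  shows "(\<lambda>t. f t * g t) \<in> sob_H n"
    "nu n (j + l) (\<lambda>t. f t * g t) \<le> Cmul n * (nu n j f * nu n l g * (1 / (1 + \<bar>real_of_int j\<bar>) + 1 / (1 + \<bar>real_of_int l\<bar>)))"
proof -
  have w: "sob_wit n (\<lambda>t. f t * g t) (\<lambda>p t. \<Sum>i\<le>p. of_nat (p choose i) * (sob_D n f i t * sob_D n g (p - i) t))"
    using sob_wit_mult[OF sob_D_wit[OF f] sob_D_wit[OF g]] n by simp
  show "(\<lambda>t. f t * g t) \<in> sob_H n" by (rule sob_H_I[OF w]) (simp add: sob_H_off[OF f])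
  define R where "R = nu n j f * nu n l g * (1 / (1 + \<bar>real_of_int j\<bar>) + 1 / (1 + \<bar>real_of_int l\<bar>))"
  have R0: "0 \<le> R" by (simp add: R_def)
  have main: "\<bar>real_of_int (j + l)\<bar> ^ q * nL (\<lambda>t. sob_D n f i t * sob_D n g (p - i) t) \<le> 2 ^ q * 8 * R"
    if pq: "p + q \<le> n" "i \<le> p" for p q i
  proof -
    let ?N = "nL (\<lambda>t. sob_D n f i t * sob_D n g (p - i) t)"
    have 1: "\<bar>real_of_int j\<bar> ^ q * ?N \<le> 4 * R"
      using product_mode_bound[OF f g n, of i "p - i" q j l] pq by (simp add: R_def algebra_simps)
    have "?N = nL (\<lambda>t. sob_D n g (p - i) t * sob_D n f i t)" by (simp add: mult.commute)
    then have 2: "\<bar>real_of_int l\<bar> ^ q * ?N \<le> 4 * R"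
      using product_mode_bound[OF g f n, of "p - i" i q l j] pq by (simp add: R_def algebra_simps)
    have "\<bar>real_of_int (j + l)\<bar> ^ q \<le> (2 * max \<bar>real_of_int j\<bar> \<bar>real_of_int l\<bar>) ^ q"
      by (intro power_mono) auto
    also have "\<dots> \<le> 2 ^ q * (\<bar>real_of_int j\<bar> ^ q + \<bar>real_of_int l\<bar> ^ q)"
      by (auto simp: power_mult_distrib max_def)
    finally have "\<bar>real_of_int (j + l)\<bar> ^ q * ?N \<le> 2 ^ q * (\<bar>real_of_int j\<bar> ^ q + \<bar>real_of_int l\<bar> ^ q) * ?N"
      by (intro mult_right_mono) auto
    also have "\<dots> = 2 ^ q * (\<bar>real_of_int j\<bar> ^ q * ?N + \<bar>real_of_int l\<bar> ^ q * ?N)" by (simp add: algebra_simps)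
    also have "\<dots> \<le> 2 ^ q * (4 * R + 4 * R)" using 1 2 by (intro mult_left_mono add_mono) auto
    finally show ?thesis by simp
  qed
  have L: "L2f (\<lambda>t. sob_D n f i t * sob_D n g (p - i) t)" if "p \<le> n" "i \<le> p" for p i
  proof (cases "i < n")
    case True
    then show ?thesis using that
      by (intro L2f_mult_continuous AC_continuous[OF sob_wit_AC[OF sob_D_wit[OF f]]] sob_wit_L2f[OF sob_D_wit[OF g]]) auto
  next
    case False
    then have "i = n" "p - i = 0" using that by auto
    moreover have "L2f (\<lambda>t. sob_D n g 0 t * sob_D n f n t)"
      using n by (intro L2f_mult_continuous AC_continuous[OF sob_wit_AC[OF sob_D_wit[OF g]]] sob_wit_L2f[OF sob_D_wit[OF f]]) auto
    ultimately show ?thesis by (simp add: mult.commute)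
  qed
  have "nu n (j + l) (\<lambda>t. f t * g t) \<le> (\<Sum>(p, q)\<in>PQ n. \<bar>real_of_int (j + l)\<bar> ^ q * dn n (\<lambda>t. f t * g t) p)"
    by (rule nu_le_sum)
  also have "\<dots> \<le> (\<Sum>(p, q)\<in>PQ n. \<Sum>i\<le>p. real (p choose i) * (2 ^ q * 8) * R)"
  proof (intro sum_mono, clarsimp simp: PQ_iff)
    fix p q assume pq: "p + q \<le> n"
    have "dn n (\<lambda>t. f t * g t) p = nL (\<lambda>t. \<Sum>i\<le>p. of_nat (p choose i) * (sob_D n f i t * sob_D n g (p - i) t))"
      using dn_eq[OF w, of p] pq by simp
    also have "\<dots> \<le> (\<Sum>i\<le>p. nL (\<lambda>t. of_nat (p choose i) * (sob_D n f i t * sob_D n g (p - i) t)))"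
      using L pq by (intro nL_sum L2f_scale) auto
    also have "\<dots> = (\<Sum>i\<le>p. real (p choose i) * nL (\<lambda>t. sob_D n f i t * sob_D n g (p - i) t))"
      by (intro sum.cong refl, subst nL_scale) simp
    finally have "\<bar>real_of_int (j + l)\<bar> ^ q * dn n (\<lambda>t. f t * g t) p
       \<le> \<bar>real_of_int (j + l)\<bar> ^ q * (\<Sum>i\<le>p. real (p choose i) * nL (\<lambda>t. sob_D n f i t * sob_D n g (p - i) t))"
      by (intro mult_left_mono) auto
    also have "\<dots> = (\<Sum>i\<le>p. real (p choose i) * (\<bar>real_of_int (j + l)\<bar> ^ q * nL (\<lambda>t. sob_D n f i t * sob_D n g (p - i) t)))"
      by (simp add: sum_distrib_left algebra_simps)
    also have "\<dots> \<le> (\<Sum>i\<le>p. real (p choose i) * (2 ^ q * 8 * R))"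
      by (intro sum_mono mult_left_mono main pq) auto
    finally show "\<bar>real_of_int j + real_of_int l\<bar> ^ q * dn n (\<lambda>t. f t * g t) p \<le> (\<Sum>i\<le>p. real (p choose i) * (2 ^ q * 8) * R)"
      by (simp add: mult.assoc)
  qed
  also have "\<dots> = Cmul n * R"
    by (simp add: Cmul_def sum_distrib_right split_def)
  finally show "nu n (j + l) (\<lambda>t. f t * g t) \<le> Cmul n * (nu n j f * nu n l g * (1 / (1 + \<bar>real_of_int j\<bar>) + 1 / (1 + \<bar>real_of_int l\<bar>)))"
    by (simp add: R_def)
qed

text \<open>The enumeration \<open>int_decode\<close> turns the unordered sum over the integers into
  the series of \<open>sob_H_series\<close>; absolute convergence makes the order
  irrelevant.\<close>

lemma sob_H_infsum:
  assumes n: "0 < n" and c: "\<And>i::int. c i \<in> sob_H n" and sm: "(\<lambda>i. nu n k (c i)) summable_on UNIV"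
  shows "(\<lambda>t. \<Sum>\<^sub>\<infinity>i. c i t) \<in> sob_H n" "nu n k (\<lambda>t. \<Sum>\<^sub>\<infinity>i. c i t) \<le> (\<Sum>\<^sub>\<infinity>i. nu n k (c i))"
    "(\<lambda>i. c i t) summable_on UNIV"
proof -
  have sm': "(\<lambda>i::nat. nu n k (c (int_decode i))) summable_on UNIV"
    using summable_on_reindex_bij_betw[OF bij_int_decode, of "\<lambda>i. nu n k (c i)"] sm by simp
  then have sm1: "summable (\<lambda>i. nu n k (c (int_decode i)))" by (rule summable_on_imp_summable)
  show ptsm: "(\<lambda>i. c i t) summable_on UNIV" for t
  proof -
    have "(\<lambda>i. norm (c i t)) summable_on UNIV"
      by (rule Infinite_Sum.abs_summable_on_comparison_test'[OF summable_on_cmult_right[OF sm, of 2]]) (rule sob_H_sup_nu[OF c n])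
    then show ?thesis by (rule abs_summable_summable)
  qed
  have eq: "(\<Sum>\<^sub>\<infinity>i. c i t) = (\<Sum>i. c (int_decode i) t)" for t
  proof -
    have "(\<lambda>i. c (int_decode i) t) summable_on UNIV"
      using summable_on_reindex_bij_betw[OF bij_int_decode, of "\<lambda>i. c i t"] ptsm by simp
    then have "(\<lambda>i. c (int_decode i) t) sums (\<Sum>\<^sub>\<infinity>i. c (int_decode i) t)"
      by (intro has_sum_imp_sums has_sum_infsum)
    then show ?thesis
      using infsum_reindex_bij_betw[OF bij_int_decode, of "\<lambda>i. c i t"] by (simp add: sums_iff)
  qed
  have eqn: "(\<Sum>\<^sub>\<infinity>i. nu n k (c i)) = (\<Sum>i. nu n k (c (int_decode i)))"
  proof -
    have "(\<lambda>i. nu n k (c (int_decode i))) sums (\<Sum>\<^sub>\<infinity>i. nu n k (c (int_decode i)))"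
      using sm' by (intro has_sum_imp_sums has_sum_infsum)
    then show ?thesis
      using infsum_reindex_bij_betw[OF bij_int_decode, of "\<lambda>i. nu n k (c i)"] by (simp add: sums_iff)
  qed
  show "(\<lambda>t. \<Sum>\<^sub>\<infinity>i. c i t) \<in> sob_H n" "nu n k (\<lambda>t. \<Sum>\<^sub>\<infinity>i. c i t) \<le> (\<Sum>\<^sub>\<infinity>i. nu n k (c i))"
    unfolding eq eqn by (rule sob_H_series[OF n c sm1])+
qed

subsection \<open>Differentiation of Sobolev functions\<close>

text \<open>For order at least 2 this classical derivative is canonical, unlike the witness chosen
  by \<open>sob_D\<close>. It is one-sided at the end points and 0 outside [0,1], as
  \<open>sob_H\<close> prescribes.\<close>

definition D1 :: "(real \<Rightarrow> complex) \<Rightarrow> real \<Rightarrow> complex" where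
  "D1 f t = (if t \<in> {0..1} then vector_derivative f (at t within {0..1}) else 0)"

lemma sob_wit_hvd:
  assumes "sob_wit n f g" "2 \<le> n" "t \<in> {0..1}"
  shows "(f has_vector_derivative g 1 t) (at t within {0..1})"
proof (rule has_vector_derivative_transform[OF assms(3)])
  show "(g 0 has_vector_derivative g 1 t) (at t within {0..1})"
    using sob_wit_AC[OF assms(1), of 0] sob_wit_AC[OF assms(1), of 1] AC_continuous[of "g 1"] assms(2,3)
    by (intro AC_deriv) auto
qed (simp add: sob_wit_0[OF assms(1)])

lemma D1_eq:
  assumes "(f has_vector_derivative d) (at t within {0..1})" "t \<in> {0..1}"
  shows "D1 f t = d"
  using assms vector_derivative_within_closed_interval[of 0 1 t f d] by (auto simp: D1_def)

lemma D1_hvd: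
  assumes "f \<in> sob_H n" "2 \<le> n" "t \<in> {0..1}"
  shows "(f has_vector_derivative D1 f t) (at t within {0..1})"
  using sob_wit_hvd[OF sob_D_wit[OF assms(1)] assms(2,3)] D1_eq[OF _ assms(3)] by metis

lemma D1_off [simp]: "t \<notin> {0..1} \<Longrightarrow> D1 f t = 0" by (auto simp: D1_def)

lemma D1_add:
  assumes "f \<in> sob_H n" "g \<in> sob_H n" "2 \<le> n"
  shows "D1 (\<lambda>t. f t + g t) = (\<lambda>t. D1 f t + D1 g t)"
proof
  fix t show "D1 (\<lambda>t. f t + g t) t = D1 f t + D1 g t"
  proof (cases "t \<in> {0..1}")
    case True
    then show ?thesis
      by (intro D1_eq has_vector_derivative_add D1_hvd[OF assms(1,3)] D1_hvd[OF assms(2,3)])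
  qed simp
qed

lemma D1_scale:
  assumes "f \<in> sob_H n" "2 \<le> n"
  shows "D1 (\<lambda>t. c * f t) = (\<lambda>t. c * D1 f t)"
proof
  fix t show "D1 (\<lambda>t. c * f t) t = c * D1 f t"
  proof (cases "t \<in> {0..1}")
    case True
    then show ?thesis
      by (intro D1_eq has_vector_derivative_mult_right D1_hvd[OF assms])
  qed simp
qed

lemma D1_sob_wit:
  assumes "f \<in> sob_H (Suc n)" "0 < n"
  shows "sob_wit n (D1 f) (\<lambda>p. sob_D (Suc n) f (Suc p))"
proof -
  note w = sob_D_wit[OF assms(1)]
  have "D1 f t = sob_D (Suc n) f (Suc 0) t" if "t \<in> {0..1}" for t
    using D1_eq[OF sob_wit_hvd[OF w _ that] that] assms(2) by simp
  then show ?thesis using w unfolding sob_wit_iff by auto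
qed

lemma D1_sob_H:
  assumes "f \<in> sob_H (Suc n)" "0 < n"
  shows "D1 f \<in> sob_H n" "nu n k (D1 f) \<le> card (PQ n) * nu (Suc n) k f"
proof -
  show "D1 f \<in> sob_H n" by (rule sob_H_I[OF D1_sob_wit[OF assms]]) simp
  show "nu n k (D1 f) \<le> card (PQ n) * nu (Suc n) k f"
  proof (rule nu_le)
    fix p q assume "p + q \<le> n"
    then show "\<bar>real_of_int k\<bar> ^ q * dn n (D1 f) p \<le> nu (Suc n) k f"
      using le_nu[of "Suc p" q "Suc n" k f] dn_eq[OF D1_sob_wit[OF assms], of p] by (simp add: dn_def)
  qed
qed

lemma sob_wit_restrict:
  assumes "sob_wit (Suc n) f g" shows "sob_wit n f g"
  using assms sob_wit_L2f[OF assms, of n] unfolding sob_wit_iff by auto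

text \<open>In the last bound the order given up pays for one more power of k; this is the mode form
  of differentiation in x.\<close>

lemma sob_H_restrict:
  assumes "f \<in> sob_H (Suc n)"
  shows "f \<in> sob_H n" "p \<le> n \<Longrightarrow> dn n f p = dn (Suc n) f p"
    "nu n k f \<le> card (PQ n) * nu (Suc n) k f" "\<bar>real_of_int k\<bar> * nu n k f \<le> card (PQ n) * nu (Suc n) k f"
proof -
  note w = sob_wit_restrict[OF sob_D_wit[OF assms]]
  show "f \<in> sob_H n" by (rule sob_H_I[OF w]) (simp add: sob_H_off[OF assms])
  show d: "p \<le> n \<Longrightarrow> dn n f p = dn (Suc n) f p" for p using dn_eq[OF w] by (simp add: dn_def)
  show "nu n k f \<le> card (PQ n) * nu (Suc n) k f"
    by (rule nu_le) (use le_nu d in auto)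
  have "\<bar>real_of_int k\<bar> * nu n k f \<le> \<bar>real_of_int k\<bar> * (\<Sum>(p, q)\<in>PQ n. \<bar>real_of_int k\<bar> ^ q * dn n f p)"
    by (intro mult_left_mono nu_le_sum) auto
  also have "\<dots> = (\<Sum>(p, q)\<in>PQ n. \<bar>real_of_int k\<bar> ^ Suc q * dn n f p)"
    by (simp add: sum_distrib_left split_def mult.assoc)
  also have "\<dots> \<le> of_nat (card (PQ n)) * nu (Suc n) k f"
  proof (rule sum_bounded_above, clarsimp simp: PQ_iff simp del: power_Suc)
    fix p q assume "p + q \<le> n"
    then show "\<bar>real_of_int k\<bar> ^ Suc q * dn n f p \<le> nu (Suc n) k f"
      using le_nu[of p "Suc q" "Suc n" k f] d[of p] by simp
  qed
  finally show "\<bar>real_of_int k\<bar> * nu n k f \<le> card (PQ n) * nu (Suc n) k f" .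
qed

subsection \<open>The Dirichlet problem for a single Fourier mode\<close>

lemma hvd_continuous:
  "(\<And>t. t \<in> {0..1} \<Longrightarrow> ((w :: real \<Rightarrow> complex) has_vector_derivative w1 t) (at t within {0..1})) \<Longrightarrow> continuous_on {0..1} w"
  by (rule continuous_on_vector_derivative)

text \<open>Integrate the derivative of \<open>w1 t * cnj (w t)\<close> over [0,1] and take real
  parts.\<close>

lemma ode_energy:
  fixes k :: real
  assumes w: "\<And>t. t \<in> {0..1} \<Longrightarrow> (w has_vector_derivative w1 t) (at t within {0..1})"
    and w1: "\<And>t. t \<in> {0..1} \<Longrightarrow> (w1 has_vector_derivative of_real (k^2) * w t + r t) (at t within {0..1})"
    and r: "continuous_on {0..1} r"
  shows "L2sq w1 + k^2 * L2sq w = Re (w1 1 * cnj (w 1)) - Re (w1 0 * cnj (w 0)) - Re (integral {0..1} (\<lambda>t. r t * cnj (w t)))"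
proof -
  have cw: "continuous_on {0..1} w" and cw1: "continuous_on {0..1} w1"
    by (rule hvd_continuous[OF w], assumption, rule hvd_continuous[OF w1], assumption)
  have "((\<lambda>t. w1 t * cnj (w1 t) + (of_real (k^2) * w t + r t) * cnj (w t)) has_integral (w1 1 * cnj (w 1) - w1 0 * cnj (w 0))) {0..1}"
  proof (rule fundamental_theorem_of_calculus)
    fix t :: real assume t: "t \<in> {0..1}"
    show "((\<lambda>t. w1 t * cnj (w t)) has_vector_derivative w1 t * cnj (w1 t) + (of_real (k^2) * w t + r t) * cnj (w t)) (at t within {0..1})"
      by (intro has_vector_derivative_mult w1[OF t] bounded_linear.has_vector_derivative[OF bounded_linear_cnj w[OF t]])
  qed simp
  then have "((\<lambda>t. Re (w1 t * cnj (w1 t) + (of_real (k^2) * w t + r t) * cnj (w t))) has_integral Re (w1 1 * cnj (w 1) - w1 0 * cnj (w 0))) {0..1}"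
    by (rule has_integral_Re)
  moreover have "Re (w1 t * cnj (w1 t) + (of_real (k^2) * w t + r t) * cnj (w t))
      = (cmod (w1 t))^2 + k^2 * (cmod (w t))^2 + Re (r t * cnj (w t))" for t
    unfolding cmod_power2 by (simp add: algebra_simps power2_eq_square)
  ultimately have 1: "((\<lambda>t. (cmod (w1 t))^2 + k^2 * (cmod (w t))^2 + Re (r t * cnj (w t))) has_integral Re (w1 1 * cnj (w 1) - w1 0 * cnj (w 0))) {0..1}"
    by simp
  have "(\<lambda>t. r t * cnj (w t)) integrable_on {0..1}"
    by (intro integrable_continuous_interval continuous_intros r cw)
  then have 2: "((\<lambda>t. Re (r t * cnj (w t))) has_integral Re (integral {0..1} (\<lambda>t. r t * cnj (w t)))) {0..1}"
    by (intro has_integral_Re integrable_integral)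
  have 3: "((\<lambda>t. (cmod (w1 t))^2) has_integral L2sq w1) {0..1}" "((\<lambda>t. (cmod (w t))^2) has_integral L2sq w) {0..1}"
    unfolding L2sq_def using L2f_sq_integrable[OF L2f_continuous] cw cw1 by (auto intro: integrable_integral)
  have "((\<lambda>t. (cmod (w1 t))^2 + k^2 * (cmod (w t))^2 + Re (r t * cnj (w t))) has_integral
     L2sq w1 + k^2 * L2sq w + Re (integral {0..1} (\<lambda>t. r t * cnj (w t)))) {0..1}"
    by (intro has_integral_add has_integral_mult_right 2 3)
  then have "L2sq w1 + k^2 * L2sq w + Re (integral {0..1} (\<lambda>t. r t * cnj (w t))) = Re (w1 1 * cnj (w 1) - w1 0 * cnj (w 0))"
    using 1 has_integral_unique by blast
  then show ?thesis by simp
qed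

lemma ode_source_bound:
  assumes r: "continuous_on {0..1} r" and w: "continuous_on {0..1} w" and e: "(e::real) > 0"
  shows "- Re (integral {0..1} (\<lambda>t. r t * cnj (w t))) \<le> (e * (nL w)^2 + (nL r)^2 / e) / 2"
proof -
  have i: "(\<lambda>t. e/2 * (cmod (w t))^2) integrable_on {0..1}" "(\<lambda>t. 1/(2*e) * (cmod (r t))^2) integrable_on {0..1}"
    using L2f_sq_integrable[OF L2f_continuous] r w by (intro integrable_on_mult_right; blast)+
  have "- Re (integral {0..1} (\<lambda>t. r t * cnj (w t))) \<le> cmod (integral {0..1} (\<lambda>t. r t * cnj (w t)))"
    using abs_Re_le_cmod[of "integral {0..1} (\<lambda>t. r t * cnj (w t))"] by linarith
  also have "\<dots> \<le> integral {0..1} (\<lambda>t. e/2 * (cmod (w t))^2 + 1/(2*e) * (cmod (r t))^2)"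
  proof (rule integral_norm_bound_integral)
    show "(\<lambda>t. r t * cnj (w t)) integrable_on {0..1}"
      by (intro integrable_continuous_interval continuous_intros r w)
    show "(\<lambda>t. e/2 * (cmod (w t))^2 + 1/(2*e) * (cmod (r t))^2) integrable_on {0..1}"
      by (intro integrable_add i)
    fix t
    have "0 \<le> (e * cmod (w t) - cmod (r t))^2 / (2*e)" using e by simp
    also have "\<dots> = e/2 * (cmod (w t))^2 + 1/(2*e) * (cmod (r t))^2 - cmod (r t) * cmod (w t)"
      using e by (simp add: power2_eq_square field_simps)
    finally show "cmod (r t * cnj (w t)) \<le> e/2 * (cmod (w t))^2 + 1/(2*e) * (cmod (r t))^2"
      by (simp add: norm_mult)
  qed
  also have "\<dots> = e/2 * L2sq w + 1/(2*e) * L2sq r"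
    unfolding L2sq_def using integral_add[OF i] by simp
  also have "\<dots> = (e * (nL w)^2 + (nL r)^2 / e) / 2" using e by (simp add: nL_sq field_simps)
  finally show ?thesis .
qed

text \<open>The source term of the energy identity is absorbed by a weighted Young inequality.
  Weight e = 1 together with \<open>nL w \<le> nL w1\<close>, which holds since w vanishes at 0,
  gives the first two bounds; e = k^2 gives the two with powers of k.\<close>

lemma ode_dirichlet_bounds:
  fixes k :: int
  assumes w: "\<And>t. t \<in> {0..1} \<Longrightarrow> (w has_vector_derivative w1 t) (at t within {0..1})"
    and w1: "\<And>t. t \<in> {0..1} \<Longrightarrow> (w1 has_vector_derivative of_real ((real_of_int k)^2) * w t + r t) (at t within {0..1})"
    and r: "continuous_on {0..1} r" and bc: "w 0 = 0" "w 1 = 0"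
  shows "nL w \<le> nL r" "nL w1 \<le> nL r" "\<bar>real_of_int k\<bar> * nL w1 \<le> nL r" "\<bar>real_of_int k\<bar>^2 * nL w \<le> nL r"
proof -
  let ?k = "real_of_int k"
  have cw: "continuous_on {0..1} w" and cw1: "continuous_on {0..1} w1"
    by (rule hvd_continuous[OF w], assumption, rule hvd_continuous[OF w1], assumption)
  have E: "(nL w1)^2 + ?k^2 * (nL w)^2 \<le> (e * (nL w)^2 + (nL r)^2 / e) / 2" if "e > 0" for e
    using ode_energy[OF w w1 r] ode_source_bound[OF r cw that] bc by (simp add: nL_sq)
  have wV: "nL w \<le> nL w1"
  proof (rule nL_le_sup)
    fix t :: real assume t: "t \<in> {0..1}"
    have "w t = integral {0..t} w1" using AC_eq[OF AC_I[OF w cw1] t] bc by simp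
    then show "cmod (w t) \<le> nL w1" using integral_le_nL[OF L2f_continuous[OF cw1], of 0 t] t by simp
  qed
  have "(nL w)^2 \<le> (nL w1)^2" using wV by (intro power_mono) auto
  moreover have "0 \<le> ?k^2 * (nL w)^2" by simp
  moreover have "(nL w1)^2 + ?k^2 * (nL w)^2 \<le> ((nL w)^2 + (nL r)^2) / 2" using E[of 1] by simp
  moreover have "V \<le> R" if "W \<le> V" "0 \<le> K" "V + K \<le> (W + R) / 2" for V W R K :: real
    using that by (simp add: field_simps)
  ultimately have "(nL w1)^2 \<le> (nL r)^2" by blast
  then show V: "nL w1 \<le> nL r" by (rule power2_le_imp_le) simp
  then show "nL w \<le> nL r" using wV by simp
  show "\<bar>?k\<bar> * nL w1 \<le> nL r" "\<bar>?k\<bar>^2 * nL w \<le> nL r"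
  proof -
    have "\<bar>?k\<bar> * nL w1 \<le> nL r \<and> \<bar>?k\<bar>^2 * nL w \<le> nL r"
    proof (cases "k = 0")
      case False
      then have k: "?k^2 > 0" by simp
      have "2 * (nL w1)^2 + ?k^2 * (nL w)^2 \<le> (nL r)^2 / ?k^2" using E[OF k] by (simp add: field_simps)
      then have "?k^2 * (2 * (nL w1)^2 + ?k^2 * (nL w)^2) \<le> (nL r)^2"
        using k by (simp add: pos_le_divide_eq mult.commute)
      moreover have "?k^2 * (2 * (nL w1)^2 + ?k^2 * (nL w)^2) = 2 * (\<bar>?k\<bar> * nL w1)^2 + (\<bar>?k\<bar>^2 * nL w)^2"
        by (simp add: power_mult_distrib power2_eq_square algebra_simps)
      moreover have "0 \<le> (\<bar>?k\<bar> * nL w1)^2" "0 \<le> (\<bar>?k\<bar>^2 * nL w)^2" by simp_all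
      ultimately have "(\<bar>?k\<bar> * nL w1)^2 \<le> (nL r)^2" "(\<bar>?k\<bar>^2 * nL w)^2 \<le> (nL r)^2" by linarith+
      then show ?thesis using power2_le_imp_le[OF _ nL_nonneg] by blast
    qed simp
    then show "\<bar>?k\<bar> * nL w1 \<le> nL r" "\<bar>?k\<bar>^2 * nL w \<le> nL r" by blast+
  qed
qed

text \<open>The derivatives of a solution of \<open>w'' = c w + r\<close>, where \<open>g\<close> lists the derivatives of \<open>r\<close>.\<close>

fun ode_wit :: "complex \<Rightarrow> (real \<Rightarrow> complex) \<Rightarrow> (real \<Rightarrow> complex) \<Rightarrow> (nat \<Rightarrow> real \<Rightarrow> complex) \<Rightarrow> nat \<Rightarrow> real \<Rightarrow> complex" where
  "ode_wit c w w1 g 0 = w"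
| "ode_wit c w w1 g (Suc 0) = w1"
| "ode_wit c w w1 g (Suc (Suc p)) = (\<lambda>t. c * ode_wit c w w1 g p t + g p t)"

text \<open>Bootstrapping through the equation: two derivatives in t are exchanged for a factor k^2
  plus a derivative of the source, so bounds on \<open>w\<close> and \<open>w1\<close> with all
  powers of k control every derivative. The constant grows like 2^p because 2^p Q + Q <= 2^(p + 2)
  Q.\<close>

lemma ode_regularity:
  fixes k :: int and Q :: real
  assumes rH: "r \<in> sob_H n" and n: "0 < n" and off: "\<And>t. t \<notin> {0..1} \<Longrightarrow> w t = 0"
    and w: "\<And>t. t \<in> {0..1} \<Longrightarrow> (w has_vector_derivative w1 t) (at t within {0..1})"
    and w1: "\<And>t. t \<in> {0..1} \<Longrightarrow> (w1 has_vector_derivative of_real ((real_of_int k)^2) * w t + r t) (at t within {0..1})"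
    and Q: "\<And>q. q \<le> n + 2 \<Longrightarrow> \<bar>real_of_int k\<bar> ^ q * nL w \<le> Q" "\<And>q. q \<le> n + 1 \<Longrightarrow> \<bar>real_of_int k\<bar> ^ q * nL w1 \<le> Q" "nu n k r \<le> Q"
  shows "w \<in> sob_H (n + 2)" "nu (n + 2) k w \<le> card (PQ (n + 2)) * (2 ^ (n + 2) * Q)"
proof -
  let ?c = "of_real ((real_of_int k)^2) :: complex"
  define g where "g = sob_D n r"
  have g: "sob_wit n r g" unfolding g_def by (rule sob_D_wit[OF rH])
  define G where "G = ode_wit ?c w w1 g"
  have G: "G 0 = w" "G (Suc 0) = w1" "G (Suc (Suc p)) = (\<lambda>t. ?c * G p t + g p t)" for p
    by (simp_all add: G_def)
  have cw: "continuous_on {0..1} w" and cw1: "continuous_on {0..1} w1"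
    by (rule hvd_continuous[OF w], assumption, rule hvd_continuous[OF w1], assumption)
  have cr: "continuous_on {0..1} r"
    using AC_continuous[OF sob_wit_AC[OF g n]] by (rule continuous_on_eq) (rule sob_wit_0[OF g])
  have A: "p < n + 2 \<Longrightarrow> AC (G p) (G (Suc p))" for p
  proof (induction p rule: induct_nat_012)
    case 0
    show ?case unfolding G by (rule AC_I[OF w cw1])
  next
    case 1
    have "AC w1 (\<lambda>t. ?c * w t + r t)" by (intro AC_I w1 continuous_intros cw cr)
    then show ?case unfolding G by (subst AC_cong[where u' = w1 and v' = "\<lambda>t. ?c * w t + r t"]) (use sob_wit_0[OF g] in auto)
  next
    case (ge2 p)
    then show ?case unfolding G(3) by (intro AC_add AC_scale sob_wit_AC[OF g]) auto
  qed
  have LG: "L2f (G p)" if "p \<le> n" for p using AC_L2f'[OF A[of p]] that by simp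
  have wit: "sob_wit (n + 2) w G"
    unfolding sob_wit_iff
  proof (intro conjI ballI allI impI A)
    show "L2f (G (n + 2))" unfolding add_2_eq_Suc' G(3)
      by (intro L2f_add L2f_scale LG sob_wit_L2f[OF g]) auto
  qed (auto simp: G)
  show "w \<in> sob_H (n + 2)" by (rule sob_H_I[OF wit off])
  have Q0: "0 \<le> Q" using Q(3) nu_nonneg order_trans by blast
  have B: "p + q \<le> n + 2 \<Longrightarrow> \<bar>real_of_int k\<bar> ^ q * nL (G p) \<le> 2 ^ p * Q" for p q
  proof (induction p arbitrary: q rule: induct_nat_012)
    case 0 then show ?case using Q(1) by (simp add: G)
  next
    case 1 then show ?case using Q(2)[of q] Q0 by (simp add: G)
  next
    case (ge2 p)
    have "nL (G (Suc (Suc p))) \<le> nL (\<lambda>t. ?c * G p t) + nL (g p)"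
      unfolding G(3) using ge2 by (intro nL_triangle L2f_scale LG sob_wit_L2f[OF g]) auto
    also have "\<dots> = \<bar>real_of_int k\<bar>^2 * nL (G p) + dn n r p"
      by (simp add: nL_scale dn_def g_def norm_power)
    finally have "\<bar>real_of_int k\<bar> ^ q * nL (G (Suc (Suc p))) \<le> \<bar>real_of_int k\<bar> ^ q * (\<bar>real_of_int k\<bar>^2 * nL (G p) + dn n r p)"
      by (intro mult_left_mono) auto
    also have "\<dots> = \<bar>real_of_int k\<bar> ^ (q + 2) * nL (G p) + \<bar>real_of_int k\<bar> ^ q * dn n r p"
      by (simp only: power_add distrib_left mult.assoc)
    also have "\<dots> \<le> 2 ^ p * Q + Q"
    proof (rule add_mono)
      show "\<bar>real_of_int k\<bar> ^ (q + 2) * nL (G p) \<le> 2 ^ p * Q" by (rule ge2(1)) (use ge2(3) in simp)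
      show "\<bar>real_of_int k\<bar> ^ q * dn n r p \<le> Q" using ge2(3) le_nu[of p q n k r] Q(3) by simp
    qed
    also have "\<dots> \<le> 2 ^ p * Q + 3 * (2 ^ p * Q)"
    proof -
      have "1 * Q \<le> 2 ^ p * Q" using Q0 by (intro mult_right_mono) auto
      then show ?thesis using Q0 by linarith
    qed
    finally show ?case by (simp add: mult_ac)
  qed
  show "nu (n + 2) k w \<le> card (PQ (n + 2)) * (2 ^ (n + 2) * Q)"
  proof (rule nu_le)
    fix p q assume pq: "p + q \<le> n + 2"
    have "\<bar>real_of_int k\<bar> ^ q * dn (n + 2) w p \<le> 2 ^ p * Q" using B[OF pq] dn_eq[OF wit, of p] pq by simp
    also have "\<dots> \<le> 2 ^ (n + 2) * Q" using pq Q0 by (intro mult_right_mono power_increasing) auto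
    finally show "\<bar>real_of_int k\<bar> ^ q * dn (n + 2) w p \<le> 2 ^ (n + 2) * Q" .
  qed
qed

definition CG :: "nat \<Rightarrow> real" where
  "CG n = card (PQ (n + 2)) * 2 ^ (n + 2)"

lemma CG_nonneg: "0 \<le> CG n" by (simp add: CG_def)

lemma sob_H_continuous: "f \<in> sob_H n \<Longrightarrow> 0 < n \<Longrightarrow> continuous_on {0..1} f"
  using AC_continuous[OF sob_wit_AC[OF sob_D_wit]] sob_wit_0[OF sob_D_wit] continuous_on_eq by metis

lemma abs_int_le_square: "\<bar>real_of_int k\<bar> \<le> \<bar>real_of_int k\<bar>^2"
proof (cases "k = 0")
  case False
  then have "1 \<le> \<bar>real_of_int k\<bar>" by linarith
  then show ?thesis by (intro self_le_power) auto
qed simp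

text \<open>Each power of k in front of \<open>w\<close> or \<open>w1\<close> is split into the gain
  from \<open>ode_dirichlet_bounds\<close> and a rest that the norm of r pays for, so
  \<open>nu n k r\<close> can serve as the Q of \<open>ode_regularity\<close>.\<close>

lemma dirichlet_hvd_bound:
  fixes k :: int
  assumes rH: "r \<in> sob_H n" and n: "0 < n" and off: "\<And>t. t \<notin> {0..1} \<Longrightarrow> w t = 0"
    and w: "\<And>t. t \<in> {0..1} \<Longrightarrow> (w has_vector_derivative w1 t) (at t within {0..1})"
    and w1: "\<And>t. t \<in> {0..1} \<Longrightarrow> (w1 has_vector_derivative of_real ((real_of_int k)^2) * w t + r t) (at t within {0..1})"
    and bc: "w 0 = 0" "w 1 = 0"
  shows "w \<in> sob_H (n + 2)" "nu (n + 2) k w \<le> CG n * nu n k r"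
proof -
  note B = ode_dirichlet_bounds[OF w w1 sob_H_continuous[OF rH n] bc]
  let ?k = "\<bar>real_of_int k\<bar>"
  have R: "?k ^ q * nL r \<le> nu n k r" if "q \<le> n" for q
    using le_nu[of 0 q n k r] that sob_wit_0[OF sob_D_wit[OF rH]] nL_cong[of r "sob_D n r 0"] by (simp add: dn_def)
  have Q1: "?k ^ q * nL w \<le> nu n k r" if "q \<le> n + 2" for q
  proof -
    consider "q = 0" | "q = 1" | q' where "q = q' + 2"
      by (metis One_nat_def Suc_1 add_2_eq_Suc' not0_implies_Suc)
    then show ?thesis
    proof cases
      case 1 then show ?thesis using B(1) R[of 0] by simp
    next
      case 2
      \<comment> \<open>The energy bounds for w skip the first power of k, but an integer frequency
        satisfies |k| <= k^2.\<close>
      have "?k * nL w \<le> ?k^2 * nL w" by (intro mult_right_mono abs_int_le_square) simp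
      then show ?thesis using 2 B(4) R[of 0] by simp
    next
      case 3
      have "?k ^ q * nL w = ?k ^ q' * (?k^2 * nL w)" by (simp only: 3 power_add mult.assoc)
      also have "\<dots> \<le> ?k ^ q' * nL r" by (intro mult_left_mono B(4) zero_le_power abs_ge_zero)
      also have "\<dots> \<le> nu n k r" using R[of q'] 3 that by simp
      finally show ?thesis .
    qed
  qed
  have Q2: "?k ^ q * nL w1 \<le> nu n k r" if "q \<le> n + 1" for q
  proof (cases q)
    case 0 then show ?thesis using B(2) R[of 0] by simp
  next
    case (Suc q')
    have "?k ^ q * nL w1 = ?k ^ q' * (?k * nL w1)" using Suc by simp
    also have "\<dots> \<le> ?k ^ q' * nL r" by (intro mult_left_mono B(3) zero_le_power abs_ge_zero)
    also have "\<dots> \<le> nu n k r" using R[of q'] Suc that by simp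
    finally show ?thesis .
  qed
  show "w \<in> sob_H (n + 2)" by (rule ode_regularity(1)[OF rH n off w w1 Q1 Q2 order_refl])
  show "nu (n + 2) k w \<le> CG n * nu n k r"
    using ode_regularity(2)[OF rH n off w w1 Q1 Q2 order_refl] by (simp add: CG_def)
qed

text \<open>Mode k of the Poisson equation with zero boundary values: on coefficients the Laplacian
  is w'' - k^2 w.\<close>

definition is_dirichlet :: "nat \<Rightarrow> int \<Rightarrow> (real \<Rightarrow> complex) \<Rightarrow> (real \<Rightarrow> complex) \<Rightarrow> bool" where
  "is_dirichlet n k r w \<longleftrightarrow> w \<in> sob_H (n + 2) \<and> w 0 = 0 \<and> w 1 = 0 \<and>
     (\<forall>t\<in>{0..1}. D1 (D1 w) t = of_real ((real_of_int k)^2) * w t + r t)"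

lemma dirichlet_bound:
  assumes r: "r \<in> sob_H n" and n: "0 < n" and w: "is_dirichlet n k r w"
  shows "nu (n + 2) k w \<le> CG n * nu n k r"
proof (rule dirichlet_hvd_bound(2)[OF r n, where ?w1.0 = "D1 w"])
  have wH: "w \<in> sob_H (Suc (Suc n))" using w by (simp add: is_dirichlet_def)
  show "(w has_vector_derivative D1 w t) (at t within {0..1})" if "t \<in> {0..1}" for t
    by (rule D1_hvd[OF wH _ that]) simp
  show "(D1 w has_vector_derivative of_real ((real_of_int k)^2) * w t + r t) (at t within {0..1})" if "t \<in> {0..1}" for t
    using D1_hvd[OF D1_sob_H(1)[OF wH] _ that] w that n by (simp add: is_dirichlet_def)
  show "w t = 0" if "t \<notin> {0..1}" for t using sob_H_off[OF wH that] .
qed (use w in \<open>auto simp: is_dirichlet_def\<close>)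

lemma is_dirichlet_add:
  assumes "is_dirichlet n k r w" "is_dirichlet n k s v" "0 < n"
  shows "is_dirichlet n k (\<lambda>t. r t + s t) (\<lambda>t. w t + v t)"
proof -
  have H: "w \<in> sob_H (Suc (Suc n))" "v \<in> sob_H (Suc (Suc n))" using assms by (auto simp: is_dirichlet_def)
  have "D1 (D1 (\<lambda>t. w t + v t)) = (\<lambda>t. D1 (D1 w) t + D1 (D1 v) t)"
    using H assms(3) by (simp add: D1_add[OF H] D1_add[OF D1_sob_H(1)[OF H(1)] D1_sob_H(1)[OF H(2)]])
  then show ?thesis using assms sob_H_add(1)[OF H] by (auto simp: is_dirichlet_def algebra_simps)
qed

lemma is_dirichlet_scale:
  assumes "is_dirichlet n k r w" "0 < n"
  shows "is_dirichlet n k (\<lambda>t. c * r t) (\<lambda>t. c * w t)"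
proof -
  have H: "w \<in> sob_H (Suc (Suc n))" using assms by (auto simp: is_dirichlet_def)
  have "D1 (D1 (\<lambda>t. c * w t)) = (\<lambda>t. c * D1 (D1 w) t)"
    using H assms(2) by (simp add: D1_scale[OF H] D1_scale[OF D1_sob_H(1)[OF H]])
  then show ?thesis using assms sob_H_scale(1)[OF H] by (auto simp: is_dirichlet_def algebra_simps)
qed

lemma dirichlet_unique:
  assumes "is_dirichlet n k r w" "is_dirichlet n k r v" "0 < n"
  shows "w = v"
proof
  fix t
  have "is_dirichlet n k (\<lambda>t. r t + - 1 * r t) (\<lambda>t. w t + - 1 * v t)"
    by (intro is_dirichlet_add is_dirichlet_scale assms)
  then have d: "is_dirichlet n k (\<lambda>t. 0) (\<lambda>t. w t - v t)" by simp
  then have "nu (n + 2) k (\<lambda>t. w t - v t) \<le> 0"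
    using dirichlet_bound[OF sob_H_zero(1) assms(3) d] by simp
  moreover have "cmod (w t - v t) \<le> 2 * nu (n + 2) k (\<lambda>t. w t - v t)"
    using d unfolding is_dirichlet_def by (intro sob_H_sup_nu[of "\<lambda>t. w t - v t" "n + 2" t k]) auto
  ultimately have "cmod (w t - v t) \<le> 0" by linarith
  then show "w t = v t" by simp
qed

text \<open>The solutions of \<open>y'' = k\<^sup>2 y\<close> with initial data \<open>(0, 1)\<close> and \<open>(1, 0)\<close>.\<close>

definition si :: "real \<Rightarrow> real \<Rightarrow> real" where
  "si k t = (if k = 0 then t else sinh (k * t) / k)"

definition co :: "real \<Rightarrow> real \<Rightarrow> real" where
  "co k t = cosh (k * t)"

lemma si_deriv: "(si k has_real_derivative co k t) (at t within S)"
proof (cases "k = 0")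
  case True
  then have "si k = (\<lambda>t. t)" by (auto simp: si_def)
  then show ?thesis using True by (auto simp: co_def)
next
  case False
  then have "si k = (\<lambda>t. sinh (k * t) / k)" by (auto simp: si_def)
  then show ?thesis using False by (auto simp: co_def intro!: derivative_eq_intros)
qed

lemma co_deriv: "(co k has_real_derivative k^2 * si k t) (at t within S)"
proof -
  have "(co k has_real_derivative sinh (k * t) * k) (at t within S)"
    unfolding co_def by (auto intro!: derivative_eq_intros)
  then show ?thesis by (cases "k = 0") (auto simp: si_def power2_eq_square mult_ac)
qed

lemma si_co_values [simp]: "si k 0 = 0" "co k 0 = 1"
  by (auto simp: si_def co_def)

lemma co_si_wronskian: "co k t * co k t - k^2 * si k t * si k t = 1"
  using hyperbolic_pythagoras[of "k * t"] by (cases "k = 0") (auto simp: si_def co_def power2_eq_square)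

text \<open>The homogeneous solution that vanishes at 0 does not vanish at 1, so it can be used to
  correct or prescribe the value there.\<close>

lemma si_1_pos: "0 < si k 1"
proof (cases "k > 0")
  case False
  then show ?thesis by (cases "k = 0") (auto simp: si_def divide_neg_neg)
qed (auto simp: si_def)

lemma si_hvd: "((\<lambda>t. of_real (si k t) :: complex) has_vector_derivative of_real (co k t)) (at t within S)"
  using si_deriv by (intro has_vector_derivative_of_real) (simp add: has_real_derivative_iff_has_vector_derivative)

lemma co_hvd: "((\<lambda>t. of_real (co k t) :: complex) has_vector_derivative of_real (k^2 * si k t)) (at t within S)"
  using co_deriv by (intro has_vector_derivative_of_real) (simp add: has_real_derivative_iff_has_vector_derivative)

text \<open>Variation of constants with the fundamental system \<open>S\<close>, \<open>C\<close>,
  whose Wronskian is 1; a multiple of \<open>S\<close> then removes the value at 1.\<close>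

lemma ode_particular:
  fixes k :: real and r :: "real \<Rightarrow> complex"
  assumes r: "continuous_on {0..1} r"
  obtains w w1 where
    "\<And>t. t \<in> {0..1} \<Longrightarrow> (w has_vector_derivative w1 t) (at t within {0..1})"
    "\<And>t. t \<in> {0..1} \<Longrightarrow> (w1 has_vector_derivative of_real (k^2) * w t + r t) (at t within {0..1})"
    "w 0 = 0" "w 1 = 0"
proof -
  define S C where "S = (\<lambda>t. of_real (si k t) :: complex)" and "C = (\<lambda>t. of_real (co k t) :: complex)"
  have dS: "(S has_vector_derivative C t) (at t within {0..1})" for t
    unfolding S_def C_def by (rule si_hvd)
  have dC: "(C has_vector_derivative of_real (k^2) * S t) (at t within {0..1})" for t
    using co_hvd[of k t "{0..1}"] by (simp add: S_def C_def)
  have cS: "continuous_on {0..1} S" and cC: "continuous_on {0..1} C"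
    by (rule hvd_continuous[OF dS], rule hvd_continuous[OF dC])
  have wr: "C t * C t - of_real (k^2) * S t * S t = 1" for t
    unfolding S_def C_def of_real_mult[symmetric] of_real_diff[symmetric] co_si_wronskian by simp
  define A B where "A = (\<lambda>t. integral {0..t} (\<lambda>s. C s * r s))" and "B = (\<lambda>t. integral {0..t} (\<lambda>s. S s * r s))"
  have dA: "(A has_vector_derivative C t * r t) (at t within {0..1})"
    and dB: "(B has_vector_derivative S t * r t) (at t within {0..1})" if "t \<in> {0..1}" for t
    unfolding A_def B_def using that by (intro integral_has_vector_derivative continuous_intros cS cC r; simp)+
  define W W1 where "W = (\<lambda>t. S t * A t - C t * B t)" and "W1 = (\<lambda>t. C t * A t - of_real (k^2) * S t * B t)"
  have dW: "(W has_vector_derivative W1 t) (at t within {0..1})" if t: "t \<in> {0..1}" for t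
  proof -
    have "(W has_vector_derivative (S t * (C t * r t) + C t * A t) - (C t * (S t * r t) + of_real (k^2) * S t * B t)) (at t within {0..1})"
      unfolding W_def by (intro has_vector_derivative_diff has_vector_derivative_mult dS dC dA dB t)
    then show ?thesis by (simp add: W1_def algebra_simps)
  qed
  have dW1: "(W1 has_vector_derivative of_real (k^2) * W t + r t) (at t within {0..1})" if t: "t \<in> {0..1}" for t
  proof -
    have "(W1 has_vector_derivative (C t * (C t * r t) + of_real (k^2) * S t * A t) - (of_real (k^2) * S t * (S t * r t) + (of_real (k^2) * C t) * B t)) (at t within {0..1})"
      unfolding W1_def by (intro has_vector_derivative_diff has_vector_derivative_mult has_vector_derivative_mult_right dS dC dA dB t)
    moreover have "(C t * (C t * r t) + of_real (k^2) * S t * A t) - (of_real (k^2) * S t * (S t * r t) + (of_real (k^2) * C t) * B t)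
       = of_real (k^2) * W t + (C t * C t - of_real (k^2) * S t * S t) * r t"
      by (simp add: W_def algebra_simps)
    ultimately show ?thesis unfolding wr by simp
  qed
  define c where "c = W 1 / S 1"
  have S1: "S 1 \<noteq> 0" using si_1_pos[of k] by (simp add: S_def)
  show ?thesis
  proof (rule that[of "\<lambda>t. W t - c * S t" "\<lambda>t. W1 t - c * C t"])
    fix t :: real assume t: "t \<in> {0..1}"
    show "((\<lambda>t. W t - c * S t) has_vector_derivative W1 t - c * C t) (at t within {0..1})"
      by (intro has_vector_derivative_diff has_vector_derivative_mult_right dW dS t)
    have "((\<lambda>t. W1 t - c * C t) has_vector_derivative of_real (k^2) * W t + r t - c * (of_real (k^2) * S t)) (at t within {0..1})"
      by (intro has_vector_derivative_diff has_vector_derivative_mult_right dW1 dC t)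
    then show "((\<lambda>t. W1 t - c * C t) has_vector_derivative of_real (k^2) * (W t - c * S t) + r t) (at t within {0..1})"
      by (simp add: algebra_simps)
  qed (use S1 in \<open>auto simp: W_def S_def C_def B_def c_def\<close>)
qed

lemma hvd_cut:
  assumes "(w has_vector_derivative d) (at t within {0..1})" "t \<in> {0..1}"
  shows "((\<lambda>t. if t \<in> {0..1} then w t else 0) has_vector_derivative d) (at t within {0..1})"
  by (rule has_vector_derivative_transform[OF assms(2) _ assms(1)]) simp

lemma D1_D1_eq:
  assumes w: "\<And>t. t \<in> {0..1} \<Longrightarrow> (w has_vector_derivative w1 t) (at t within {0..1})"
    and w1: "\<And>t. t \<in> {0..1} \<Longrightarrow> (w1 has_vector_derivative w2 t) (at t within {0..1})" and t: "t \<in> {0..1}"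
  shows "D1 (D1 w) t = w2 t"
  by (rule D1_eq[OF has_vector_derivative_transform[OF t _ w1[OF t]] t]) (rule D1_eq[OF w])

lemma dirichlet_exists:
  assumes r: "r \<in> sob_H n" and n: "0 < n"
  shows "\<exists>w. is_dirichlet n k r w"
proof -
  obtain w w1 where w: "\<And>t. t \<in> {0..1} \<Longrightarrow> (w has_vector_derivative w1 t) (at t within {0..1})"
    "\<And>t. t \<in> {0..1} \<Longrightarrow> (w1 has_vector_derivative of_real ((real_of_int k)^2) * w t + r t) (at t within {0..1})"
    "w 0 = 0" "w 1 = 0"
    using ode_particular[OF sob_H_continuous[OF r n]] by metis
  define v where "v = (\<lambda>t. if t \<in> {0..1} then w t else 0)"
  have v: "(v has_vector_derivative w1 t) (at t within {0..1})"
    "(w1 has_vector_derivative of_real ((real_of_int k)^2) * v t + r t) (at t within {0..1})" if "t \<in> {0..1}" for t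
    using hvd_cut[OF w(1)[OF that] that] w(2)[OF that] that by (simp_all add: v_def)
  have "v \<in> sob_H (n + 2)"
    by (rule dirichlet_hvd_bound(1)[OF r n _ v]) (auto simp: v_def w)
  moreover have "D1 (D1 v) t = of_real ((real_of_int k)^2) * v t + r t" if "t \<in> {0..1}" for t
    by (rule D1_D1_eq[OF v that])
  ultimately have "is_dirichlet n k r v" unfolding is_dirichlet_def by (auto simp: v_def w)
  then show ?thesis by blast
qed

definition dirichlet :: "nat \<Rightarrow> int \<Rightarrow> (real \<Rightarrow> complex) \<Rightarrow> real \<Rightarrow> complex" where
  "dirichlet n k r = (THE w. is_dirichlet n k r w)"

lemma dirichlet: "r \<in> sob_H n \<Longrightarrow> 0 < n \<Longrightarrow> is_dirichlet n k r (dirichlet n k r)"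
  unfolding dirichlet_def using dirichlet_exists dirichlet_unique by (metis theI)

lemma dirichlet_eq: "is_dirichlet n k r w \<Longrightarrow> 0 < n \<Longrightarrow> dirichlet n k r = w"
  unfolding dirichlet_def using dirichlet_unique by (metis the_equality)

subsection \<open>Harmonic extension of boundary values\<close>

text \<open>The solution of y'' = k^2 y with end values f and g, built from sinh (k (1 - t)) / sinh
  k and sinh (k t) / sinh k; for k = 0 it is linear interpolation.\<close>

definition harm :: "int \<Rightarrow> complex \<Rightarrow> complex \<Rightarrow> real \<Rightarrow> complex" where
  "harm k f g t = (if t \<in> {0..1} then f * of_real (si (real_of_int k) (1 - t) / si (real_of_int k) 1) + g * of_real (si (real_of_int k) t / si (real_of_int k) 1) else 0)"

lemma harm_bc [simp]: "harm k f g 0 = f" "harm k f g 1 = g"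
  using si_1_pos[of "real_of_int k"] by (auto simp: harm_def)

text \<open>The quotient is k coth k, the energy of a harmonic profile with end values 0 and 1. Its
  merely linear growth is why data of order m - 1/2 extend to order m.\<close>

lemma co_si_quotient:
  assumes "(k::int) \<noteq> 0" shows "co (real_of_int k) 1 / si (real_of_int k) 1 \<le> 2 * \<bar>real_of_int k\<bar>"
proof -
  let ?K = "\<bar>real_of_int k\<bar>"
  have K: "1 \<le> ?K" using assms by linarith
  have e: "si (real_of_int k) 1 = sinh ?K / ?K" "co (real_of_int k) 1 = cosh ?K"
    using assms by (auto simp: si_def co_def abs_if)
  \<comment> \<open>The target cosh K <= 2 sinh K means 3 exp (- K) <= exp K, which follows from exp
    (2 K) >= 1 + 2 K >= 3.\<close>
  have "3 \<le> exp (2 * ?K)" using exp_ge_add_one_self[of "2 * ?K"] K by linarith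
  then have "3 * exp (- ?K) \<le> exp (2 * ?K) * exp (- ?K)" by (intro mult_right_mono) auto
  also have "\<dots> = exp ?K" by (simp flip: exp_add)
  finally have "cosh ?K \<le> 2 * sinh ?K" by (simp add: cosh_def sinh_def)
  then have "cosh ?K / sinh ?K \<le> 2" using K by (simp add: pos_divide_le_eq)
  then have "?K * (cosh ?K / sinh ?K) \<le> ?K * 2" by (intro mult_left_mono) auto
  moreover have "cosh ?K / (sinh ?K / ?K) = ?K * (cosh ?K / sinh ?K)"
    by (simp only: divide_divide_eq_right times_divide_eq_right mult.commute)
  ultimately show ?thesis unfolding e by (simp only: mult.commute)
qed

text \<open>The energy identity without source gives a total energy of k coth k <= 2 |k|. At the
  highest powers of k the squared norms are thus of size |k|^(2 n + 3), which matches the weight of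
  order (n + 2) - 1/2; \<open>ode_regularity\<close> with zero source does the rest.\<close>

lemma harm_basic:
  fixes k :: int and n :: nat
  assumes off: "\<And>t. t \<notin> {0..1} \<Longrightarrow> w t = 0" and n: "0 < n"
    and w: "\<And>t. t \<in> {0..1} \<Longrightarrow> (w has_vector_derivative w1 t) (at t within {0..1})"
    and w1: "\<And>t. t \<in> {0..1} \<Longrightarrow> (w1 has_vector_derivative of_real ((real_of_int k)^2) * w t) (at t within {0..1})"
    and bd: "Re (w1 1 * cnj (w 1)) - Re (w1 0 * cnj (w 0)) = co (real_of_int k) 1 / si (real_of_int k) 1" "cmod (w 0) \<le> 1"
  shows "w \<in> sob_H (n + 2)" "nu (n + 2) k w \<le> CG n * (2 * sqrt ((1 + (real_of_int k)^2) powr (real (n + 2) - 1/2)))"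
proof -
  let ?K = "\<bar>real_of_int k\<bar>"
  define X where "X = (1 + (real_of_int k)^2) powr (real (n + 2) - 1/2)"
  have X1: "1 \<le> X" unfolding X_def by (intro ge_one_powr_ge_zero) auto
  have w1': "(w1 has_vector_derivative of_real ((real_of_int k)^2) * w t + 0) (at t within {0..1})" if "t \<in> {0..1}" for t
    using w1[OF that] by simp
  have E: "(nL w1)^2 + ?K^2 * (nL w)^2 = co (real_of_int k) 1 / si (real_of_int k) 1"
    using ode_energy[OF w w1'] bd by (simp add: nL_sq)
  have Q: "(\<forall>q\<le>n+2. ?K ^ q * nL w \<le> 2 * sqrt X) \<and> (\<forall>q\<le>n+1. ?K ^ q * nL w1 \<le> 2 * sqrt X)"
  proof (cases "k = 0")
    case True
    \<comment> \<open>For k = 0 the energy controls only \<open>w1\<close>. Together with the end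
      value at 0, of modulus at most 1, this bounds w by 2.\<close>
    have "(nL w1)^2 = 1" using E True by (simp add: si_def co_def)
    then have V: "nL w1 = 1" using nL_nonneg[of w1] by (simp add: power2_eq_1_iff)
    have cw1: "continuous_on {0..1} w1"
      by (rule hvd_continuous[OF w1])
    have "nL w \<le> 2"
    proof (rule nL_le_sup)
      fix t :: real assume t: "t \<in> {0..1}"
      have "w t = w 0 + integral {0..t} w1" by (rule AC_eq[OF AC_I[OF w cw1] t])
      moreover have "cmod (w 0 + integral {0..t} w1) \<le> 1 + nL w1"
        using integral_le_nL[OF L2f_continuous[OF cw1], of 0 t] t bd(2) by (intro norm_triangle_le add_mono) auto
      ultimately show "cmod (w t) \<le> 2" using V by simp
    qed
    moreover have "2 \<le> 2 * sqrt X" using X1 by simp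
    moreover have "?K ^ q * y \<le> 2 * sqrt X" if "y \<le> 2" for q y
      using order_trans[OF that \<open>2 \<le> 2 * sqrt X\<close>] True X1 by (cases q) auto
    ultimately show ?thesis using V by (metis one_le_numeral)
  next
    case False
    then have K: "1 \<le> ?K" by linarith
    have KX: "?K ^ (2 * n + 3) \<le> X"
    proof -
      \<comment> \<open>2 n + 3 is twice the order (n + 2) - 1/2.\<close>
      have "?K ^ (2 * n + 3) = ?K powr (2 * (real (n + 2) - 1/2))"
        using K by (subst powr_realpow[symmetric]) (auto simp: add.commute)
      also have "\<dots> = (?K powr 2) powr (real (n + 2) - 1/2)" by (simp only: powr_powr)
      also have "\<dots> \<le> X" unfolding X_def using K by (intro powr_mono2) auto
      finally show ?thesis .
    qed
    have E2: "(nL w1)^2 + ?K^2 * (nL w)^2 \<le> 2 * ?K" using E co_si_quotient[OF False] by simp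
    have e1: "(?K ^ (n + 2))^2 = ?K ^ (2 * n + 2) * ?K^2" and e2: "(?K ^ (n + 1))^2 = ?K ^ (2 * n + 2)"
      unfolding power_mult[symmetric] power_add[symmetric] by (rule arg_cong[where f = "\<lambda>i. ?K ^ i"], simp)+
    have "?K ^ q * nL w \<le> 2 * sqrt X" if "q \<le> n + 2" for q
    proof -
      have "(?K ^ q * nL w)^2 \<le> (?K ^ (n + 2) * nL w)^2"
        using K that by (intro power_mono mult_right_mono power_increasing) auto
      also have "\<dots> = ?K ^ (2 * n + 2) * (?K^2 * (nL w)^2)"
        by (simp only: power_mult_distrib e1 mult.assoc)
      also have "\<dots> \<le> ?K ^ (2 * n + 2) * (2 * ?K)"
        using E2 by (intro mult_left_mono) (auto intro: order_trans[rotated])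
      also have "\<dots> = 2 * ?K ^ (2 * n + 3)" by (simp add: power_add eval_nat_numeral)
      also have "\<dots> \<le> (2 * sqrt X)^2" using KX X1 by (simp add: power_mult_distrib)
      finally show ?thesis by (rule power2_le_imp_le) (use X1 in simp)
    qed
    moreover have "?K ^ q * nL w1 \<le> 2 * sqrt X" if "q \<le> n + 1" for q
    proof -
      have "(?K ^ q * nL w1)^2 \<le> (?K ^ (n + 1) * nL w1)^2"
        using K that by (intro power_mono mult_right_mono power_increasing) auto
      also have "\<dots> = ?K ^ (2 * n + 2) * (nL w1)^2"
        by (simp only: power_mult_distrib e2)
      also have "\<dots> \<le> ?K ^ (2 * n + 2) * (2 * ?K)"
        using E2 by (intro mult_left_mono) (auto intro: order_trans[rotated])
      also have "\<dots> = 2 * ?K ^ (2 * n + 3)" by (simp add: power_add eval_nat_numeral)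
      also have "\<dots> \<le> (2 * sqrt X)^2" using KX X1 by (simp add: power_mult_distrib)
      finally show ?thesis by (rule power2_le_imp_le) (use X1 in simp)
    qed
    ultimately show ?thesis by blast
  qed
  have Q3: "nu n k (\<lambda>t. 0) \<le> 2 * sqrt X" using X1 by simp
  show "w \<in> sob_H (n + 2)"
    by (rule ode_regularity(1)[OF sob_H_zero(1) n off w w1' _ _ Q3]) (use Q in auto)
  have "nu (n + 2) k w \<le> card (PQ (n + 2)) * (2 ^ (n + 2) * (2 * sqrt X))"
    by (rule ode_regularity(2)[OF sob_H_zero(1) n off w w1' _ _ Q3]) (use Q in auto)
  then show "nu (n + 2) k w \<le> CG n * (2 * sqrt ((1 + (real_of_int k)^2) powr (real (n + 2) - 1/2)))"
    by (simp add: CG_def X_def)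
qed

text \<open>By linearity two profiles suffice, with end values (0, 1) and (1, 0); the second is the
  reflection of the first.\<close>

lemma harm_sob:
  fixes k :: int and n :: nat
  assumes n: "0 < n"
  shows "harm k f g \<in> sob_H (n + 2)"
    "nu (n + 2) k (harm k f g) \<le> 2 * CG n * sqrt ((1 + (real_of_int k)^2) powr (real (n + 2) - 1/2)) * (cmod f + cmod g)"
    "t \<in> {0..1} \<Longrightarrow> D1 (D1 (harm k f g)) t = of_real ((real_of_int k)^2) * harm k f g t"
proof -
  let ?k = "real_of_int k"
  define s where "s = (of_real (si ?k 1) :: complex)"
  have s0: "s \<noteq> 0" using si_1_pos[of ?k] by (simp add: s_def)
  define u where "u = (\<lambda>t. if t \<in> {0..1} then of_real (si ?k t) / s else 0)"
  define u1 where "u1 = (\<lambda>t. of_real (co ?k t) / s)"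
  define v where "v = (\<lambda>t. if t \<in> {0..1} then of_real (si ?k (1 - t)) / s else 0)"
  define v1 where "v1 = (\<lambda>t. - of_real (co ?k (1 - t)) / s)"
  have refl: "((\<lambda>t. h (1 - t)) has_vector_derivative - d) (at t within {0..1})"
    if "(h has_vector_derivative d) (at (1 - t) within {0..1})" for h :: "real \<Rightarrow> complex" and d t
  proof -
    have im: "(\<lambda>t::real. 1 - t) ` {0..1} = {0..1}"
    proof -
      have "x \<in> (\<lambda>t::real. 1 - t) ` {0..1}" if "x \<in> {0..1}" for x
        using that by (intro image_eqI[of _ _ "1 - x"]) auto
      then show ?thesis by auto
    qed
    have "((\<lambda>t::real. 1 - t) has_vector_derivative -1) (at t within {0..1})"
      by (auto intro!: derivative_eq_intros)
    from vector_diff_chain_within[OF this, of h d] that show ?thesis unfolding im by (simp add: o_def)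
  qed
  have du: "(u has_vector_derivative u1 t) (at t within {0..1})" if "t \<in> {0..1}" for t
    unfolding u_def u1_def by (intro hvd_cut has_vector_derivative_divide si_hvd that)
  have du1: "(u1 has_vector_derivative of_real (?k^2) * u t) (at t within {0..1})" if "t \<in> {0..1}" for t
    using has_vector_derivative_divide[OF co_hvd[of ?k t "{0..1}"], of s] that by (simp add: u1_def u_def)
  have dv: "(v has_vector_derivative v1 t) (at t within {0..1})" if "t \<in> {0..1}" for t
    unfolding v_def v1_def by (intro hvd_cut has_vector_derivative_divide refl si_hvd that)
  have dv1: "(v1 has_vector_derivative of_real (?k^2) * v t) (at t within {0..1})" if "t \<in> {0..1}" for t
    using has_vector_derivative_divide[OF has_vector_derivative_minus[OF refl[OF co_hvd[of ?k "1 - t" "{0..1}"]]], of s] that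
    by (simp add: v1_def v_def)
  have ends: "u 0 = 0" "u 1 = 1" "v 0 = 1" "v 1 = 0" using s0 by (auto simp: u_def v_def s_def)
  have off: "t \<notin> {0..1} \<Longrightarrow> u t = 0" "t \<notin> {0..1} \<Longrightarrow> v t = 0" for t by (auto simp: u_def v_def)
  have bu: "Re (u1 1 * cnj (u 1)) - Re (u1 0 * cnj (u 0)) = co ?k 1 / si ?k 1"
    unfolding ends by (simp add: u1_def s_def flip: of_real_divide)
  have bv: "Re (v1 1 * cnj (v 1)) - Re (v1 0 * cnj (v 0)) = co ?k 1 / si ?k 1"
    unfolding ends by (simp add: v1_def s_def flip: of_real_divide)
  have uH: "u \<in> sob_H (n + 2)" and ub: "nu (n + 2) k u \<le> CG n * (2 * sqrt ((1 + ?k^2) powr (real (n + 2) - 1/2)))"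
    by (rule harm_basic[OF off(1) n du du1 bu]; simp add: ends)+
  have vH: "v \<in> sob_H (n + 2)" and vb: "nu (n + 2) k v \<le> CG n * (2 * sqrt ((1 + ?k^2) powr (real (n + 2) - 1/2)))"
    by (rule harm_basic[OF off(2) n dv dv1 bv]; simp add: ends)+
  have h: "harm k f g = (\<lambda>t. f * v t + g * u t)"
    by (auto simp: harm_def u_def v_def s_def fun_eq_iff)
  show "harm k f g \<in> sob_H (n + 2)" unfolding h by (intro sob_H_add(1) sob_H_scale(1) uH vH)
  have "nu (n + 2) k (harm k f g) \<le> nu (n + 2) k (\<lambda>t. f * v t) + nu (n + 2) k (\<lambda>t. g * u t)"
    unfolding h by (intro nu_triangle sob_H_scale(1) uH vH)
  also have "\<dots> = cmod f * nu (n + 2) k v + cmod g * nu (n + 2) k u"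
    by (simp only: nu_scale[OF uH] nu_scale[OF vH])
  also have "\<dots> \<le> cmod f * (CG n * (2 * sqrt ((1 + ?k^2) powr (real (n + 2) - 1/2)))) + cmod g * (CG n * (2 * sqrt ((1 + ?k^2) powr (real (n + 2) - 1/2))))"
    by (intro add_mono mult_left_mono ub vb) auto
  finally show "nu (n + 2) k (harm k f g) \<le> 2 * CG n * sqrt ((1 + ?k^2) powr (real (n + 2) - 1/2)) * (cmod f + cmod g)"
    by (simp add: algebra_simps)
  assume t: "t \<in> {0..1}"
  show "D1 (D1 (harm k f g)) t = of_real (?k^2) * harm k f g t"
  proof (rule D1_D1_eq[OF _ _ t])
    show "(harm k f g has_vector_derivative f * v1 t + g * u1 t) (at t within {0..1})" if "t \<in> {0..1}" for t
      unfolding h by (intro has_vector_derivative_add has_vector_derivative_mult_right du dv that)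
    fix t :: real assume t: "t \<in> {0..1}"
    have "((\<lambda>t. f * v1 t + g * u1 t) has_vector_derivative f * (of_real (?k^2) * v t) + g * (of_real (?k^2) * u t)) (at t within {0..1})"
      by (intro has_vector_derivative_add has_vector_derivative_mult_right du1 dv1 t)
    then show "((\<lambda>t. f * v1 t + g * u1 t) has_vector_derivative of_real (?k^2) * harm k f g t) (at t within {0..1})"
      unfolding h by (simp add: algebra_simps)
  qed
qed

subsection \<open>Square summable families\<close>

definition l2 :: "(int \<Rightarrow> real) \<Rightarrow> bool" where
  "l2 f \<longleftrightarrow> (\<lambda>k. (f k)^2) summable_on UNIV"

definition l2n :: "(int \<Rightarrow> real) \<Rightarrow> real" where
  "l2n f = sqrt (\<Sum>\<^sub>\<infinity>k. (f k)^2)"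

lemma l2n_nonneg [simp]: "0 \<le> l2n f"
  unfolding l2n_def by (intro real_sqrt_ge_zero infsum_nonneg) simp

text \<open>Square summability is checked on finite sets, where Minkowski's inequality is available
  for \<open>L2_set\<close>; a common bound passes to the whole family.\<close>

lemma l2_I:
  assumes "\<And>K. finite K \<Longrightarrow> L2_set f K \<le> M"
  shows "l2 f" "l2n f \<le> M"
proof -
  have M: "0 \<le> M" using assms[of "{}"] by (simp add: L2_set_def)
  have S: "(\<Sum>k\<in>K. (f k)^2) \<le> M^2" if "finite K" for K
    using assms[OF that] M by (simp add: L2_set_def sqrt_le_D real_sqrt_le_iff' sum_nonneg)
  show l: "l2 f" unfolding l2_def
    by (rule nonneg_bdd_above_summable_on) (auto intro!: bdd_aboveI2[where M = "M^2"] S)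
  have "(\<Sum>\<^sub>\<infinity>k. (f k)^2) \<le> M^2"
    by (rule infsum_le_finite_sums) (use l S in \<open>auto simp: l2_def\<close>)
  then show "l2n f \<le> M" unfolding l2n_def using M by (simp add: real_sqrt_le_iff' infsum_nonneg real_le_lsqrt)
qed

lemma L2_set_le_l2n:
  assumes "l2 f" "finite K" shows "L2_set f K \<le> l2n f"
  unfolding l2n_def L2_set_def
  by (intro real_sqrt_le_mono finite_sum_le_infsum) (use assms in \<open>auto simp: l2_def\<close>)

lemma le_l2n: "l2 f \<Longrightarrow> \<bar>f k\<bar> \<le> l2n f"
  using L2_set_le_l2n[of f "{k}"] by (simp add: L2_set_def)

lemma l2_mono:
  assumes "l2 g" "\<And>k. 0 \<le> f k" "\<And>k. f k \<le> g k"
  shows "l2 f" "l2n f \<le> l2n g"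
proof -
  have *: "L2_set f K \<le> l2n g" if "finite K" for K
    using L2_set_mono[of K f g] L2_set_le_l2n[OF assms(1) that] assms(2,3) by (meson order_trans)
  show "l2 f" "l2n f \<le> l2n g" by (rule l2_I[OF *], assumption)+
qed

lemma l2_add:
  assumes "l2 f" "l2 g" shows "l2 (\<lambda>k. f k + g k)" "l2n (\<lambda>k. f k + g k) \<le> l2n f + l2n g"
proof -
  have *: "L2_set (\<lambda>k. f k + g k) K \<le> l2n f + l2n g" if "finite K" for K
    using L2_set_triangle_ineq[of f g K] L2_set_le_l2n[OF assms(1) that] L2_set_le_l2n[OF assms(2) that] by linarith
  show "l2 (\<lambda>k. f k + g k)" "l2n (\<lambda>k. f k + g k) \<le> l2n f + l2n g" by (rule l2_I[OF *], assumption)+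
qed

lemma l2_scale:
  assumes "l2 f" "0 \<le> c" shows "l2 (\<lambda>k. c * f k)" "l2n (\<lambda>k. c * f k) = c * l2n f"
  using assms by (auto simp: l2_def l2n_def power_mult_distrib infsum_cmult_right' real_sqrt_mult intro: summable_on_cmult_right)

lemma l2_Cauchy_Schwarz:
  assumes "l2 f" "l2 g" "\<And>k. 0 \<le> f k" "\<And>k. 0 \<le> g k"
  shows "(\<lambda>k. f k * g k) summable_on UNIV" "(\<Sum>\<^sub>\<infinity>k. f k * g k) \<le> l2n f * l2n g"
proof -
  have S: "(\<Sum>k\<in>K. f k * g k) \<le> l2n f * l2n g" if "finite K" for K
  proof -
    have "(\<Sum>k\<in>K. f k * g k) \<le> L2_set f K * L2_set g K"
      using L2_set_mult_ineq[of f g K] assms(3,4) by simp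
    also have "\<dots> \<le> l2n f * l2n g"
      by (intro mult_mono L2_set_le_l2n assms that) (auto simp: L2_set_nonneg)
    finally show ?thesis .
  qed
  show s: "(\<lambda>k. f k * g k) summable_on UNIV"
    by (rule nonneg_bdd_above_summable_on) (use assms S in \<open>auto intro!: bdd_aboveI2\<close>)
  show "(\<Sum>\<^sub>\<infinity>k. f k * g k) \<le> l2n f * l2n g"
    by (rule infsum_le_finite_sums[OF s]) (use S in auto)
qed

text \<open>The weight gained in \<open>sob_H_mult\<close>. It lies in l^2, so its product with any
  l^2 family is summable.\<close>

definition wt :: "int \<Rightarrow> real" where "wt k = 1 / (1 + \<bar>real_of_int k\<bar>)"

lemma wt_nonneg [simp]: "0 \<le> wt k" and wt_le_1: "wt k \<le> 1"
  by (auto simp: wt_def)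

lemma l2_wt: "l2 wt"
proof -
  define f where "f = (\<lambda>k. (wt k)^2)"
  have sm: "summable (\<lambda>n::nat. inverse ((real (Suc n))^2))"
    using summable_Suc_iff[of "\<lambda>n. inverse ((real n)^2)"] inverse_power_summable[of 2, where 'a = real] by simp
  have pos: "(\<lambda>n. f (int n)) summable_on UNIV"
  proof (subst summable_on_UNIV_nonneg_real_iff)
    show "summable (\<lambda>n. f (int n))"
      using sm by (simp add: f_def wt_def power_divide inverse_eq_divide)
  qed (simp add: f_def)
  have neg: "(\<lambda>n. f (- int (Suc n))) summable_on UNIV"
  proof (subst summable_on_UNIV_nonneg_real_iff)
    show "summable (\<lambda>n. f (- int (Suc n)))"
    proof (rule summable_comparison_test'[OF sm])
      show "norm (f (- int (Suc n))) \<le> inverse ((real (Suc n))^2)" for n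
        unfolding f_def wt_def by (auto simp: power_divide inverse_eq_divide intro!: divide_left_mono power_mono)
    qed
  qed (simp add: f_def)
  have "f summable_on (range int)"
    using pos by (subst summable_on_reindex) (auto simp: o_def)
  moreover have "f summable_on (range (\<lambda>n. - int (Suc n)))"
    using neg by (subst summable_on_reindex) (auto simp: o_def inj_on_def)
  moreover have "range int \<inter> range (\<lambda>n. - int (Suc n)) = {}" by auto
  ultimately have "f summable_on (range int \<union> range (\<lambda>n. - int (Suc n)))"
    by (rule summable_on_Un_disjoint)
  moreover have "x \<in> range int \<union> range (\<lambda>n. - int (Suc n))" for x
    by (cases x rule: int_cases) blast+
  then have "range int \<union> range (\<lambda>n. - int (Suc n)) = UNIV" by blast
  ultimately show ?thesis by (simp add: l2_def f_def)
qed

lemma L2_set_infsum: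
  assumes "finite A" and sm: "\<And>a. a \<in> A \<Longrightarrow> (\<lambda>i. f i a :: real) summable_on UNIV"
    and B: "\<And>J. finite J \<Longrightarrow> (\<Sum>i\<in>J. L2_set (f i) A) \<le> B"
  shows "L2_set (\<lambda>a. \<Sum>\<^sub>\<infinity>i. f i a) A \<le> B"
proof (rule tendsto_upperbound)
  show "((\<lambda>J. sqrt (\<Sum>a\<in>A. (\<Sum>i\<in>J. f i a)^2)) \<longlongrightarrow> L2_set (\<lambda>a. \<Sum>\<^sub>\<infinity>i. f i a) A) (finite_subsets_at_top UNIV)"
    unfolding L2_set_def using sm by (intro tendsto_intros infsum_tendsto)
  have "L2_set (\<lambda>a. \<Sum>i\<in>J. f i a) A \<le> (\<Sum>i\<in>J. L2_set (f i) A)" if "finite J" for J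
    using that
  proof (induction J rule: finite_induct)
    case (insert x J)
    have "L2_set (\<lambda>a. f x a + (\<Sum>i\<in>J. f i a)) A \<le> L2_set (f x) A + L2_set (\<lambda>a. \<Sum>i\<in>J. f i a) A"
      by (rule L2_set_triangle_ineq)
    then show ?case using insert by simp
  qed (simp add: L2_set_def)
  then show "\<forall>\<^sub>F J in finite_subsets_at_top UNIV. sqrt (\<Sum>a\<in>A. (\<Sum>i\<in>J. f i a)^2) \<le> B"
    using B by (intro eventually_finite_subsets_at_top_weakI) (auto simp: L2_set_def intro: order_trans)
qed simp

text \<open>Convolution of l^2 with l^1: Minkowski's inequality over j, since each shifted copy of f
  has the same norm.\<close>

lemma young:
  assumes f: "l2 f" "\<And>k. 0 \<le> f k" and g: "g summable_on UNIV" "\<And>k. 0 \<le> g k"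
  shows "(\<lambda>j. f (k - j) * g j) summable_on UNIV"
    "l2 (\<lambda>k. \<Sum>\<^sub>\<infinity>j. f (k - j) * g j)" "l2n (\<lambda>k. \<Sum>\<^sub>\<infinity>j. f (k - j) * g j) \<le> l2n f * (\<Sum>\<^sub>\<infinity>j. g j)"
proof -
  show sm: "(\<lambda>j. f (k - j) * g j) summable_on UNIV" for k
  proof (rule summable_on_comparison_test)
    show "(\<lambda>j. l2n f * g j) summable_on UNIV" using g(1) by (rule summable_on_cmult_right)
    show "f (k - j) * g j \<le> l2n f * g j" for j
      using le_l2n[OF f(1), of "k - j"] g(2)[of j] by (intro mult_right_mono) auto
  qed (use f g in auto)
  have *: "L2_set (\<lambda>k. \<Sum>\<^sub>\<infinity>j. f (k - j) * g j) K \<le> l2n f * (\<Sum>\<^sub>\<infinity>j. g j)" if K: "finite K" for K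
  proof (rule L2_set_infsum[OF K sm])
    fix J :: "int set" assume J: "finite J"
    have "L2_set (\<lambda>k. f (k - j) * g j) K \<le> l2n f * g j" for j
    proof -
      have "L2_set (\<lambda>k. f (k - j) * g j) K = L2_set (\<lambda>k. f (k - j)) K * g j"
        using L2_set_left_distrib[OF g(2)[of j], of "\<lambda>k. f (k - j)" K] by simp
      also have "L2_set (\<lambda>k. f (k - j)) K = L2_set f ((\<lambda>k. k - j) ` K)"
        unfolding L2_set_def by (subst sum.reindex) (auto simp: inj_on_def)
      also have "\<dots> \<le> l2n f" using K by (intro L2_set_le_l2n[OF f(1)]) auto
      finally show ?thesis using g(2)[of j] by (simp add: mult_right_mono)
    qed
    then have "(\<Sum>j\<in>J. L2_set (\<lambda>k. f (k - j) * g j) K) \<le> (\<Sum>j\<in>J. l2n f * g j)" by (intro sum_mono)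
    also have "\<dots> = l2n f * (\<Sum>j\<in>J. g j)" by (simp add: sum_distrib_left)
    also have "\<dots> \<le> l2n f * (\<Sum>\<^sub>\<infinity>j. g j)"
      using g J by (intro mult_left_mono finite_sum_le_infsum) auto
    finally show "(\<Sum>j\<in>J. L2_set (\<lambda>k. f (k - j) * g j) K) \<le> l2n f * (\<Sum>\<^sub>\<infinity>j. g j)" .
  qed
  show "l2 (\<lambda>k. \<Sum>\<^sub>\<infinity>j. f (k - j) * g j)" "l2n (\<lambda>k. \<Sum>\<^sub>\<infinity>j. f (k - j) * g j) \<le> l2n f * (\<Sum>\<^sub>\<infinity>j. g j)"
    by (rule l2_I[OF *], assumption)+
qed

lemma bij_int_reflect: "bij (\<lambda>j. (k::int) - j)"
  by (rule bij_betw_byWitness[where f' = "\<lambda>j. k - j"]) auto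

lemma young':
  assumes f: "l2 f" "\<And>k. 0 \<le> f k" and g: "g summable_on UNIV" "\<And>k. 0 \<le> g k"
  shows "(\<lambda>j. f j * g (k - j)) summable_on UNIV"
    "l2 (\<lambda>k. \<Sum>\<^sub>\<infinity>j. f j * g (k - j))" "l2n (\<lambda>k. \<Sum>\<^sub>\<infinity>j. f j * g (k - j)) \<le> l2n f * (\<Sum>\<^sub>\<infinity>j. g j)"
proof -
  have eq: "(\<Sum>\<^sub>\<infinity>j. f j * g (k - j)) = (\<Sum>\<^sub>\<infinity>j. f (k - j) * g j)" for k
    using infsum_reindex_bij_betw[OF bij_int_reflect, of "\<lambda>j. f j * g (k - j)" k] by simp
  show "(\<lambda>j. f j * g (k - j)) summable_on UNIV"
    using summable_on_reindex_bij_betw[OF bij_int_reflect, of "\<lambda>j. f j * g (k - j)" k] young(1)[OF f g] by simp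
  show "l2 (\<lambda>k. \<Sum>\<^sub>\<infinity>j. f j * g (k - j))" "l2n (\<lambda>k. \<Sum>\<^sub>\<infinity>j. f j * g (k - j)) \<le> l2n f * (\<Sum>\<^sub>\<infinity>j. g j)"
    unfolding eq using young(2,3)[OF f g] by blast+
qed

subsection \<open>The spaces \<open>Y\<close>\<close>

definition mu :: "real \<Rightarrow> nat \<Rightarrow> (int \<Rightarrow> real \<Rightarrow> complex) \<Rightarrow> int \<Rightarrow> real" where
  "mu \<sigma> n b k = exp (\<sigma> * \<bar>real_of_int k\<bar>) * nu n k (b k)"

lemma mu_nonneg [simp]: "0 \<le> mu \<sigma> n b k" by (simp add: mu_def)

text \<open>Exhibits \<open>Y_sp\<close> as an l^2 space of mode norms, so that estimates can be
  made mode by mode.\<close>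

lemma Y_sum_mu: "Y_sum \<sigma> n b k = (mu \<sigma> n b k)^2"
proof -
  have "(mu \<sigma> n b k)^2 = exp (2 * \<sigma> * \<bar>real_of_int k\<bar>) * (nu n k (b k))^2"
    by (simp add: mu_def power_mult_distrib power2_eq_square flip: exp_add)
  also have "(nu n k (b k))^2 = (\<Sum>(p, q)\<in>PQ n. (\<bar>real_of_int k\<bar> ^ q * dn n (b k) p)^2)"
    by (simp add: nu_def L2_set_def sum_nonneg split_def)
  also have "\<dots> = (\<Sum>p\<le>n. \<Sum>q\<le>n - p. (\<bar>real_of_int k\<bar> ^ q * dn n (b k) p)^2)"
    unfolding PQ_def by (subst sum.Sigma[symmetric]) auto
  also have "\<dots> = (\<Sum>p\<le>n. \<Sum>q\<le>n - p. (real_of_int k)^(2*q) * L2sq (sob_D n (b k) p))"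
    by (simp add: power_mult_distrib dn_def nL_sq power_even_eq power_abs[symmetric])
  finally show ?thesis unfolding Y_sum_def by (simp add: sum_distrib_left mult_ac)
qed

lemma Y_sp_iff: "b \<in> Y_sp \<sigma> n \<longleftrightarrow> (\<forall>k. b k \<in> sob_H n) \<and> l2 (mu \<sigma> n b)"
proof -
  have "Y_sum \<sigma> n b = (\<lambda>k. (mu \<sigma> n b k)^2)" using Y_sum_mu by blast
  then show ?thesis by (simp add: Y_sp_def l2_def)
qed

lemma Y_norm_l2n: "Y_norm \<sigma> n b = l2n (mu \<sigma> n b)"
proof -
  have "Y_sum \<sigma> n b = (\<lambda>k. (mu \<sigma> n b k)^2)" using Y_sum_mu by blast
  then show ?thesis by (simp add: Y_norm_def l2n_def)
qed

lemma Y_norm_nonneg [simp]: "0 \<le> Y_norm \<sigma> n b" by (simp add: Y_norm_l2n)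

lemma Y_sp_mode: "b \<in> Y_sp \<sigma> n \<Longrightarrow> b k \<in> sob_H n" by (simp add: Y_sp_iff)

lemma mu_le_Y_norm: "b \<in> Y_sp \<sigma> n \<Longrightarrow> mu \<sigma> n b k \<le> Y_norm \<sigma> n b"
  using le_l2n[of "mu \<sigma> n b" k] by (simp add: Y_sp_iff Y_norm_l2n)

lemma nu_le_mu: "0 \<le> \<sigma> \<Longrightarrow> nu n k (b k) \<le> mu \<sigma> n b k"
  using mult_right_mono[of 1 "exp (\<sigma> * \<bar>real_of_int k\<bar>)" "nu n k (b k)"] by (simp add: mu_def)

lemma Y_sp_add:
  assumes "a \<in> Y_sp \<sigma> n" "b \<in> Y_sp \<sigma> n"
  shows "a + b \<in> Y_sp \<sigma> n" "Y_norm \<sigma> n (a + b) \<le> Y_norm \<sigma> n a + Y_norm \<sigma> n b"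
proof -
  have eq: "(a + b) k = (\<lambda>t. a k t + b k t)" for k by (simp add: fun_eq_iff)
  have L: "l2 (\<lambda>k. mu \<sigma> n a k + mu \<sigma> n b k)" "l2n (\<lambda>k. mu \<sigma> n a k + mu \<sigma> n b k) \<le> Y_norm \<sigma> n a + Y_norm \<sigma> n b"
    using assms l2_add by (auto simp: Y_sp_iff Y_norm_l2n)
  have le: "mu \<sigma> n (a + b) k \<le> mu \<sigma> n a k + mu \<sigma> n b k" for k
    using nu_triangle[OF Y_sp_mode[OF assms(1)] Y_sp_mode[OF assms(2)], of k k k] unfolding mu_def eq
    by (simp flip: distrib_left)
  show "a + b \<in> Y_sp \<sigma> n"
    unfolding Y_sp_iff
  proof (intro conjI allI l2_mono(1)[OF L(1) mu_nonneg le])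
    show "(a + b) k \<in> sob_H n" for k unfolding eq by (intro sob_H_add(1) Y_sp_mode[OF assms(1)] Y_sp_mode[OF assms(2)])
  qed
  show "Y_norm \<sigma> n (a + b) \<le> Y_norm \<sigma> n a + Y_norm \<sigma> n b"
    using l2_mono(2)[OF L(1) mu_nonneg le] L(2) by (simp add: Y_norm_l2n)
qed

lemma Y_sp_scale:
  assumes "a \<in> Y_sp \<sigma> n"
  shows "Y_scale c a \<in> Y_sp \<sigma> n" "Y_norm \<sigma> n (Y_scale c a) = cmod c * Y_norm \<sigma> n a"
proof -
  have "mu \<sigma> n (Y_scale c a) = (\<lambda>k. cmod c * mu \<sigma> n a k)"
    using nu_scale[OF Y_sp_mode[OF assms]] by (auto simp: mu_def Y_scale_def fun_eq_iff)
  then show "Y_scale c a \<in> Y_sp \<sigma> n" "Y_norm \<sigma> n (Y_scale c a) = cmod c * Y_norm \<sigma> n a"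
    using l2_scale[of "mu \<sigma> n a" "cmod c"] assms sob_H_scale(1) by (auto simp: Y_sp_iff Y_norm_l2n Y_scale_def)
qed

lemma Y_sp_zero: "0 \<in> Y_sp \<sigma> n"
  unfolding Y_sp_iff using sob_H_zero(1) by (auto simp: mu_def l2_def zero_fun_def)

lemma Y_norm_eq_0:
  assumes "a \<in> Y_sp \<sigma> n" "Y_norm \<sigma> n a = 0" "0 < n" shows "a = 0"
proof (intro ext)
  fix k t
  have "mu \<sigma> n a k \<le> 0" using mu_le_Y_norm[OF assms(1), of k] assms(2) by simp
  then have "nu n k (a k) = 0" using nu_nonneg[of n k "a k"] by (auto simp: mu_def mult_le_0_iff)
  then show "a k t = 0 k t" using sob_H_sup_nu[OF Y_sp_mode[OF assms(1)] assms(3), of k t k] by simp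
qed

text \<open>For maps acting on each mode separately a bound with constant independent of k suffices;
  the exponential weight is carried along unchanged.\<close>

lemma Y_mode_operator:
  assumes "b \<in> Y_sp \<sigma> n" "\<And>k. c k \<in> sob_H n'" "\<And>k. nu n' k (c k) \<le> C * nu n k (b k)" "0 \<le> C"
  shows "c \<in> Y_sp \<sigma> n'" "Y_norm \<sigma> n' c \<le> C * Y_norm \<sigma> n b"
proof -
  have L: "l2 (\<lambda>k. C * mu \<sigma> n b k)" "l2n (\<lambda>k. C * mu \<sigma> n b k) = C * Y_norm \<sigma> n b"
    using l2_scale[of "mu \<sigma> n b" C] assms by (auto simp: Y_sp_iff Y_norm_l2n)
  have le: "mu \<sigma> n' c k \<le> C * mu \<sigma> n b k" for k
    using assms(3)[of k] by (simp add: mu_def mult.left_commute)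
  show "c \<in> Y_sp \<sigma> n'" unfolding Y_sp_iff using l2_mono(1)[OF L(1) mu_nonneg le] assms by auto
  show "Y_norm \<sigma> n' c \<le> C * Y_norm \<sigma> n b" using l2_mono(2)[OF L(1) mu_nonneg le] L(2) by (simp add: Y_norm_l2n)
qed

text \<open>Minkowski twice: within each mode by \<open>sob_H_series\<close>, then across finitely
  many modes by \<open>L2_set_suminf\<close>.\<close>

lemma Y_series:
  assumes n: "0 < n" and \<sigma>: "0 \<le> \<sigma>" and d: "\<And>i::nat. d i \<in> Y_sp \<sigma> n" and sm: "summable (\<lambda>i. Y_norm \<sigma> n (d i))"
  shows "(\<lambda>k t. \<Sum>i. d i k t) \<in> Y_sp \<sigma> n" "Y_norm \<sigma> n (\<lambda>k t. \<Sum>i. d i k t) \<le> (\<Sum>i. Y_norm \<sigma> n (d i))"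
    "summable (\<lambda>i. d i k t)"
proof -
  have dH: "d i k \<in> sob_H n" for i k using d by (rule Y_sp_mode)
  have musm: "summable (\<lambda>i. mu \<sigma> n (d i) k)" for k
    by (rule summable_comparison_test'[OF sm, where N = 0]) (use mu_le_Y_norm[OF d] in auto)
  have nusm: "summable (\<lambda>i. nu n k (d i k))" for k
    by (rule summable_comparison_test'[OF musm[of k], where N = 0]) (use nu_le_mu[OF \<sigma>] in auto)
  note S = sob_H_series[OF n dH nusm]
  show "summable (\<lambda>i. d i k t)" by (rule S(3))
  have le: "mu \<sigma> n (\<lambda>k t. \<Sum>i. d i k t) k \<le> (\<Sum>i. mu \<sigma> n (d i) k)" for k
  proof -
    have "mu \<sigma> n (\<lambda>k t. \<Sum>i. d i k t) k \<le> exp (\<sigma> * \<bar>real_of_int k\<bar>) * (\<Sum>i. nu n k (d i k))"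
      unfolding mu_def by (intro mult_left_mono S(2)) auto
    also have "\<dots> = (\<Sum>i. mu \<sigma> n (d i) k)" unfolding mu_def using nusm by (simp add: suminf_mult)
    finally show ?thesis .
  qed
  have *: "L2_set (mu \<sigma> n (\<lambda>k t. \<Sum>i. d i k t)) K \<le> (\<Sum>i. Y_norm \<sigma> n (d i))" if K: "finite K" for K
  proof -
    have l: "L2_set (mu \<sigma> n (d i)) K \<le> Y_norm \<sigma> n (d i)" for i
      using L2_set_le_l2n[OF _ K] d by (auto simp: Y_sp_iff Y_norm_l2n)
    have lsm: "summable (\<lambda>i. L2_set (mu \<sigma> n (d i)) K)"
      by (rule summable_comparison_test'[OF sm, where N = 0]) (use l in \<open>auto simp: L2_set_nonneg\<close>)
    have "L2_set (mu \<sigma> n (\<lambda>k t. \<Sum>i. d i k t)) K \<le> L2_set (\<lambda>k. \<Sum>i. mu \<sigma> n (d i) k) K"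
      by (intro L2_set_mono le) auto
    also have "\<dots> \<le> (\<Sum>i. L2_set (mu \<sigma> n (d i)) K)"
      by (rule L2_set_suminf[OF K _ musm lsm]) auto
    also have "\<dots> \<le> (\<Sum>i. Y_norm \<sigma> n (d i))" by (intro suminf_le l lsm sm)
    finally show ?thesis .
  qed
  have "l2 (mu \<sigma> n (\<lambda>k t. \<Sum>i. d i k t))" "l2n (mu \<sigma> n (\<lambda>k t. \<Sum>i. d i k t)) \<le> (\<Sum>i. Y_norm \<sigma> n (d i))"
    by (rule l2_I[OF *], assumption)+
  then show "(\<lambda>k t. \<Sum>i. d i k t) \<in> Y_sp \<sigma> n" "Y_norm \<sigma> n (\<lambda>k t. \<Sum>i. d i k t) \<le> (\<Sum>i. Y_norm \<sigma> n (d i))"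
    using S(1) by (auto simp: Y_sp_iff Y_norm_l2n)
qed

text \<open>The limit is x 0 plus the series of increments, and \<open>T i\<close> is the tail of
  that series. The rate 1/2 is that of the iteration in \<open>contraction\<close>.\<close>

lemma Y_complete:
  assumes n: "0 < n" and \<sigma>: "0 \<le> \<sigma>" and x: "\<And>i::nat. x i \<in> Y_sp \<sigma> n"
    and geo: "\<And>i. Y_norm \<sigma> n (x (Suc i) - x i) \<le> B * (1/2)^i"
  shows "\<exists>s\<in>Y_sp \<sigma> n. (\<lambda>i. Y_norm \<sigma> n (s - x i)) \<longlonglongrightarrow> 0"
proof -
  define d where "d = (\<lambda>i. x (Suc i) - x i)"
  have minus: "- y = Y_scale (-1) y" for y by (simp add: Y_scale_def fun_eq_iff)
  have d: "d i \<in> Y_sp \<sigma> n" for i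
    unfolding d_def using Y_sp_add(1)[OF x, of "- x i" "Suc i"] Y_sp_scale(1)[OF x, of "-1" i] by (simp add: minus[symmetric])
  have gsm: "summable (\<lambda>l. B * (1/2)^(i + l))" for i
    unfolding power_add by (intro summable_mult summable_geometric) auto
  have sm: "summable (\<lambda>l. Y_norm \<sigma> n (d (i + l)))" for i
    by (rule summable_comparison_test'[OF gsm[of i], where N = 0]) (use geo in \<open>auto simp: d_def\<close>)
  define T where "T = (\<lambda>i k t. \<Sum>l. d (i + l) k t)"
  have TY: "T i \<in> Y_sp \<sigma> n" and Tle: "Y_norm \<sigma> n (T i) \<le> 2 * B * (1/2)^i" for i
  proof -
    show "T i \<in> Y_sp \<sigma> n" unfolding T_def by (rule Y_series(1)[OF n \<sigma> d sm])
    have "Y_norm \<sigma> n (T i) \<le> (\<Sum>l. Y_norm \<sigma> n (d (i + l)))" unfolding T_def by (rule Y_series(2)[OF n \<sigma> d sm])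
    also have "\<dots> \<le> (\<Sum>l. B * (1/2)^(i + l))" using geo by (intro suminf_le sm gsm) (auto simp: d_def)
    also have "\<dots> = B * (1/2)^i * (\<Sum>l. (1/2)^l)"
      unfolding power_add mult.assoc[symmetric] by (intro suminf_mult summable_geometric) auto
    also have "\<dots> = 2 * B * (1/2)^i" by (subst suminf_geometric) auto
    finally show "Y_norm \<sigma> n (T i) \<le> 2 * B * (1/2)^i" .
  qed
  define s where "s = x 0 + T 0"
  have sx: "s - x i = T i" for i
  proof (intro ext)
    fix k t
    have "(\<Sum>l. d l k t) = (\<Sum>l. d (l + i) k t) + (\<Sum>l<i. d l k t)"
      using Y_series(3)[OF n \<sigma> d sm[of 0], of k t] by (intro suminf_split_initial_segment) simp
    moreover have "(\<Sum>l<i. d l k t) = x i k t - x 0 k t"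
      unfolding d_def by (simp add: sum_lessThan_telescope[of "\<lambda>l. x l k t"])
    ultimately show "(s - x i) k t = T i k t" by (simp add: s_def T_def add.commute)
  qed
  have "s \<in> Y_sp \<sigma> n" unfolding s_def by (intro Y_sp_add(1) x TY)
  moreover have "(\<lambda>i. Y_norm \<sigma> n (s - x i)) \<longlonglongrightarrow> 0"
  proof (rule tendsto_sandwich[where f = "\<lambda>_. 0" and h = "\<lambda>i. 2 * B * (1/2)^i"])
    show "(\<lambda>i. 2 * B * (1/2)^i) \<longlonglongrightarrow> 0"
      using tendsto_mult_right_zero[OF LIMSEQ_power_zero[of "1/2::real"], of "2 * B"] by simp
  qed (auto simp: sx Tle)
  ultimately show ?thesis by blast
qed

subsection \<open>The convolution product\<close>

text \<open>The Fourier coefficients of a pointwise product, as \<open>yfun_conv\<close>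
  confirms.\<close>

definition conv :: "(int \<Rightarrow> real \<Rightarrow> complex) \<Rightarrow> (int \<Rightarrow> real \<Rightarrow> complex) \<Rightarrow> int \<Rightarrow> real \<Rightarrow> complex" where
  "conv a b k t = (\<Sum>\<^sub>\<infinity>j. a j t * b (k - j) t)"

definition Cconv :: "nat \<Rightarrow> real" where
  "Cconv n = 2 * Cmul n * l2n wt"

lemma Cconv_nonneg: "0 \<le> Cconv n" by (simp add: Cconv_def Cmul_nonneg)

text \<open>The mode estimate \<open>sob_H_mult\<close> splits into two convolutions, each of an l^2
  family with an l^2 family times \<open>wt\<close>. The latter is summable by Cauchy-Schwarz, so
  Young's inequality applies to both halves, which explains the 2 in \<open>Cconv\<close>.\<close>

lemma conv_bound:
  assumes a: "a \<in> Y_sp \<sigma> n" and b: "b \<in> Y_sp \<sigma> n" and n: "2 \<le> n" and \<sigma>: "0 \<le> \<sigma>"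
  shows "conv a b \<in> Y_sp \<sigma> n" "Y_norm \<sigma> n (conv a b) \<le> Cconv n * Y_norm \<sigma> n a * Y_norm \<sigma> n b"
    "(\<lambda>j. a j t * b (k - j) t) summable_on UNIV"
proof -
  define A B where "A = mu \<sigma> n a" and "B = mu \<sigma> n b"
  have A: "l2 A" "\<And>k. 0 \<le> A k" and B: "l2 B" "\<And>k. 0 \<le> B k" using a b by (auto simp: A_def B_def Y_sp_iff)
  have Aw: "(\<lambda>k. A k * wt k) summable_on UNIV" "(\<Sum>\<^sub>\<infinity>k. A k * wt k) \<le> l2n A * l2n wt"
    using l2_Cauchy_Schwarz[OF A(1) l2_wt A(2)] by auto
  have Bw: "(\<lambda>k. B k * wt k) summable_on UNIV" "(\<Sum>\<^sub>\<infinity>k. B k * wt k) \<le> l2n B * l2n wt"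
    using l2_Cauchy_Schwarz[OF B(1) l2_wt B(2)] by auto
  have Aw0: "0 \<le> A k * wt k" and Bw0: "0 \<le> B k * wt k" for k using A B by auto
  note Y1 = young[OF B Aw(1) Aw0] and Y2 = young'[OF A Bw(1) Bw0]
  define M where "M = (\<lambda>k j. Cmul n * (B (k - j) * (A j * wt j) + A j * (B (k - j) * wt (k - j))))"
  have Msm: "(\<lambda>j. M k j) summable_on UNIV" for k
    unfolding M_def by (intro summable_on_cmult_right summable_on_add Y1(1) Y2(1))
  have Minf: "(\<Sum>\<^sub>\<infinity>j. M k j) = Cmul n * ((\<Sum>\<^sub>\<infinity>j. B (k - j) * (A j * wt j)) + (\<Sum>\<^sub>\<infinity>j. A j * (B (k - j) * wt (k - j))))" for k
    unfolding M_def by (simp add: infsum_cmult_right' infsum_add[OF Y1(1) Y2(1)])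
  define c where "c = (\<lambda>k j t. a j t * b (k - j) t)"
  have cH: "c k j \<in> sob_H n" for k j
    unfolding c_def by (intro sob_H_mult(1) Y_sp_mode[OF a] Y_sp_mode[OF b] n)
  have cle: "exp (\<sigma> * \<bar>real_of_int k\<bar>) * nu n k (c k j) \<le> M k j" for k j
  proof -
    have "nu n k (c k j) \<le> Cmul n * (nu n j (a j) * nu n (k - j) (b (k - j)) * (wt j + wt (k - j)))"
      using sob_H_mult(2)[OF Y_sp_mode[OF a] Y_sp_mode[OF b] n, of j "k - j" j "k - j"] by (simp add: c_def wt_def)
    \<comment> \<open>Subadditivity of the absolute value distributes the exponential weight over
      the two factors; this uses \<sigma> \<ge> 0.\<close>
    moreover have "exp (\<sigma> * \<bar>real_of_int k\<bar>) \<le> exp (\<sigma> * \<bar>real_of_int j\<bar>) * exp (\<sigma> * \<bar>real_of_int (k - j)\<bar>)"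
    proof -
      have "\<sigma> * \<bar>real_of_int k\<bar> \<le> \<sigma> * (\<bar>real_of_int j\<bar> + \<bar>real_of_int (k - j)\<bar>)" using \<sigma> by (intro mult_left_mono) auto
      then show ?thesis by (simp add: distrib_left flip: exp_add)
    qed
    ultimately have "exp (\<sigma> * \<bar>real_of_int k\<bar>) * nu n k (c k j) \<le> (exp (\<sigma> * \<bar>real_of_int j\<bar>) * exp (\<sigma> * \<bar>real_of_int (k - j)\<bar>))
        * (Cmul n * (nu n j (a j) * nu n (k - j) (b (k - j)) * (wt j + wt (k - j))))"
      by (intro mult_mono) auto
    also have "\<dots> = M k j" by (simp add: M_def A_def B_def mu_def algebra_simps)
    finally show ?thesis .
  qed
  have csm: "(\<lambda>j. nu n k (c k j)) summable_on UNIV" for k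
  proof (rule summable_on_comparison_test[OF Msm[of k]])
    fix j
    have "1 * nu n k (c k j) \<le> exp (\<sigma> * \<bar>real_of_int k\<bar>) * nu n k (c k j)" using \<sigma> by (intro mult_right_mono) auto
    then show "nu n k (c k j) \<le> M k j" using cle[of k j] by simp
  qed auto
  have n0: "0 < n" using n by simp
  have conv: "conv a b k = (\<lambda>t. \<Sum>\<^sub>\<infinity>j. c k j t)" for k by (auto simp: conv_def c_def)
  show "(\<lambda>j. a j t * b (k - j) t) summable_on UNIV" using sob_H_infsum(3)[OF n0 cH csm] unfolding c_def .
  have H: "conv a b k \<in> sob_H n" for k unfolding conv by (rule sob_H_infsum(1)[OF n0 cH csm])
  have le: "mu \<sigma> n (conv a b) k \<le> (\<Sum>\<^sub>\<infinity>j. M k j)" for k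
  proof -
    have "mu \<sigma> n (conv a b) k \<le> exp (\<sigma> * \<bar>real_of_int k\<bar>) * (\<Sum>\<^sub>\<infinity>j. nu n k (c k j))"
      unfolding mu_def conv by (intro mult_left_mono sob_H_infsum(2)[OF n0 cH csm]) auto
    also have "\<dots> = (\<Sum>\<^sub>\<infinity>j. exp (\<sigma> * \<bar>real_of_int k\<bar>) * nu n k (c k j))" by (simp add: infsum_cmult_right')
    also have "\<dots> \<le> (\<Sum>\<^sub>\<infinity>j. M k j)" by (intro infsum_mono summable_on_cmult_right csm Msm cle)
    finally show ?thesis .
  qed
  have L: "l2 (\<lambda>k. \<Sum>\<^sub>\<infinity>j. M k j)" unfolding Minf by (intro l2_scale(1) l2_add(1) Y1(2) Y2(2) Cmul_nonneg)
  have "l2n (\<lambda>k. \<Sum>\<^sub>\<infinity>j. M k j) \<le> Cmul n * (l2n B * (l2n A * l2n wt) + l2n A * (l2n B * l2n wt))"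
    unfolding Minf l2_scale(2)[OF l2_add(1)[OF Y1(2) Y2(2)] Cmul_nonneg]
  proof (intro mult_left_mono Cmul_nonneg order_trans[OF l2_add(2)[OF Y1(2) Y2(2)]] add_mono)
    show "l2n (\<lambda>k. \<Sum>\<^sub>\<infinity>j. B (k - j) * (A j * wt j)) \<le> l2n B * (l2n A * l2n wt)"
      using Y1(3) mult_left_mono[OF Aw(2) l2n_nonneg[of B]] by linarith
    show "l2n (\<lambda>k. \<Sum>\<^sub>\<infinity>j. A j * (B (k - j) * wt (k - j))) \<le> l2n A * (l2n B * l2n wt)"
      using Y2(3) mult_left_mono[OF Bw(2) l2n_nonneg[of A]] by linarith
  qed
  also have "\<dots> = Cconv n * l2n A * l2n B" by (simp add: Cconv_def algebra_simps)
  finally have L2: "l2n (\<lambda>k. \<Sum>\<^sub>\<infinity>j. M k j) \<le> Cconv n * l2n A * l2n B" .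
  show "conv a b \<in> Y_sp \<sigma> n" unfolding Y_sp_iff using H l2_mono(1)[OF L mu_nonneg le] by blast
  show "Y_norm \<sigma> n (conv a b) \<le> Cconv n * Y_norm \<sigma> n a * Y_norm \<sigma> n b"
    using l2_mono(2)[OF L mu_nonneg le] L2 by (simp add: Y_norm_l2n A_def B_def)
qed

lemma conv_add_left:
  assumes "a \<in> Y_sp \<sigma> n" "a' \<in> Y_sp \<sigma> n" "b \<in> Y_sp \<sigma> n" "2 \<le> n" "0 \<le> \<sigma>"
  shows "conv (a + a') b = conv a b + conv a' b"
  using infsum_add[OF conv_bound(3)[OF assms(1,3,4,5)] conv_bound(3)[OF assms(2,3,4,5)]]
  by (auto simp: conv_def fun_eq_iff distrib_right)

lemma conv_add_right:
  assumes "a \<in> Y_sp \<sigma> n" "b \<in> Y_sp \<sigma> n" "b' \<in> Y_sp \<sigma> n" "2 \<le> n" "0 \<le> \<sigma>"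
  shows "conv a (b + b') = conv a b + conv a b'"
  using infsum_add[OF conv_bound(3)[OF assms(1,2,4,5)] conv_bound(3)[OF assms(1,3,4,5)]]
  by (auto simp: conv_def fun_eq_iff distrib_left)

lemma conv_scale_left: "conv (Y_scale c a) b = Y_scale c (conv a b)"
  by (auto simp: conv_def Y_scale_def fun_eq_iff mult.assoc infsum_cmult_right')

lemma conv_scale_right: "conv a (Y_scale c b) = Y_scale c (conv a b)"
  by (auto simp: conv_def Y_scale_def fun_eq_iff mult.left_commute infsum_cmult_right')

subsection \<open>Quadratic perturbations of linear maps\<close>

text \<open>The spaces depend on \<sigma> and on the order, so they are carrier sets inside function
  types, with explicit scalars and norm. The structure is seminormed; definiteness and completeness
  are added in \<open>banach_carrier\<close>.\<close>

locale cnorm =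
  fixes C :: "'a::ab_group_add set" and sc :: "complex \<Rightarrow> 'a \<Rightarrow> 'a" and nm :: "'a \<Rightarrow> real"
  assumes zero: "0 \<in> C"
    and add: "x \<in> C \<Longrightarrow> y \<in> C \<Longrightarrow> x + y \<in> C"
    and scale: "x \<in> C \<Longrightarrow> sc c x \<in> C"
    and nm_add: "x \<in> C \<Longrightarrow> y \<in> C \<Longrightarrow> nm (x + y) \<le> nm x + nm y"
    and nm_scale: "x \<in> C \<Longrightarrow> nm (sc c x) = cmod c * nm x"
    and nm_ge0: "x \<in> C \<Longrightarrow> 0 \<le> nm x"
    and sc_add: "sc c (x + y) = sc c x + sc c y"
    and sc_minus1: "sc (-1) x = - x"
begin

lemma uminus: "x \<in> C \<Longrightarrow> - x \<in> C"
  using scale[of x "-1"] by (simp add: sc_minus1)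

lemma diff: "x \<in> C \<Longrightarrow> y \<in> C \<Longrightarrow> x - y \<in> C"
  using add[of x "- y"] uminus by simp

lemma nm_minus: "x \<in> C \<Longrightarrow> nm (- x) = nm x"
  using nm_scale[of x "-1"] by (simp add: sc_minus1)

lemma nm_diff: "x \<in> C \<Longrightarrow> y \<in> C \<Longrightarrow> nm (x - y) \<le> nm x + nm y"
  using nm_add[of x "- y"] uminus nm_minus by simp

lemma nm_diff_commute: "x \<in> C \<Longrightarrow> y \<in> C \<Longrightarrow> nm (x - y) = nm (y - x)"
  using nm_minus[OF diff, of x y] by simp

lemma nm_zero: "nm 0 = 0"
proof -
  have "sc 0 0 = sc 0 0 + sc 0 0" using sc_add[of 0 0 0] by simp
  then have "sc 0 0 = 0" by simp
  then show ?thesis using nm_scale[OF zero, of 0] by simp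
qed

end

definition blin ::
  "'a::ab_group_add set \<Rightarrow> (complex \<Rightarrow> 'a \<Rightarrow> 'a) \<Rightarrow> ('a \<Rightarrow> real) \<Rightarrow> 'b::ab_group_add set \<Rightarrow> (complex \<Rightarrow> 'b \<Rightarrow> 'b) \<Rightarrow> ('b \<Rightarrow> real) \<Rightarrow> ('a \<Rightarrow> 'b) \<Rightarrow> bool"
where
  "blin C sc nm C' sc' nm' L \<longleftrightarrow> (\<forall>x\<in>C. L x \<in> C') \<and> (\<forall>x\<in>C. \<forall>y\<in>C. L (x + y) = L x + L y) \<and>
     (\<forall>c. \<forall>x\<in>C. L (sc c x) = sc' c (L x)) \<and> (\<exists>K\<ge>0. \<forall>x\<in>C. nm' (L x) \<le> K * nm x)"

text \<open>One constant serves growth, derivative and remainder. Everything is confined to the unit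
  ball, where higher powers of the norm are dominated by lower ones.\<close>

definition good_const :: "'z::ab_group_add set \<Rightarrow> ('z \<Rightarrow> real) \<Rightarrow> ('a::ab_group_add \<Rightarrow> real) \<Rightarrow> nat \<Rightarrow> ('z \<Rightarrow> 'a) \<Rightarrow> ('z \<Rightarrow> 'z \<Rightarrow> 'a) \<Rightarrow> real \<Rightarrow> bool" where
  "good_const Z nZ nA e M M' K \<longleftrightarrow> 0 \<le> K \<and> (\<forall>z\<in>Z. nZ z \<le> 1 \<longrightarrow> nA (M z) \<le> K * nZ z \<and>
     (\<forall>h\<in>Z. nA (M' z h) \<le> K * nZ z ^ e * nZ h) \<and>
     (\<forall>h\<in>Z. nZ (z + h) \<le> 1 \<longrightarrow> nA (M (z + h) - M z - M' z h) \<le> K * (nZ h)^2))"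

lemma good_constD:
  assumes "good_const Z nZ nA e M M' K"
  shows "0 \<le> K" "z \<in> Z \<Longrightarrow> nZ z \<le> 1 \<Longrightarrow> nA (M z) \<le> K * nZ z"
    "z \<in> Z \<Longrightarrow> nZ z \<le> 1 \<Longrightarrow> h \<in> Z \<Longrightarrow> nA (M' z h) \<le> K * nZ z ^ e * nZ h"
    "z \<in> Z \<Longrightarrow> nZ z \<le> 1 \<Longrightarrow> h \<in> Z \<Longrightarrow> nZ (z + h) \<le> 1 \<Longrightarrow> nA (M (z + h) - M z - M' z h) \<le> K * (nZ h)^2"
  using assms unfolding good_const_def by blast+

text \<open>\<open>M' z\<close> is the derivative of \<open>M\<close> at \<open>z\<close>, with quadratic remainder on the unit ball;
  \<open>e = 1\<close> means that \<open>M\<close> vanishes to second order at the origin.\<close>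

definition good ::
  "'z::ab_group_add set \<Rightarrow> (complex \<Rightarrow> 'z \<Rightarrow> 'z) \<Rightarrow> ('z \<Rightarrow> real) \<Rightarrow> 'a::ab_group_add set \<Rightarrow> (complex \<Rightarrow> 'a \<Rightarrow> 'a) \<Rightarrow> ('a \<Rightarrow> real)
     \<Rightarrow> nat \<Rightarrow> ('z \<Rightarrow> 'a) \<Rightarrow> ('z \<Rightarrow> 'z \<Rightarrow> 'a) \<Rightarrow> bool"
where
  "good Z sZ nZ A sA nA e M M' \<longleftrightarrow>
     (\<forall>z\<in>Z. M z \<in> A) \<and> (\<forall>z\<in>Z. \<forall>h\<in>Z. M' z h \<in> A) \<and>
     (\<forall>z\<in>Z. \<forall>h\<in>Z. \<forall>h'\<in>Z. M' z (h + h') = M' z h + M' z h') \<and>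
     (\<forall>z\<in>Z. \<forall>h\<in>Z. \<forall>c. M' z (sZ c h) = sA c (M' z h)) \<and>
     (\<exists>K. good_const Z nZ nA e M M' K)"

lemma good_D:
  assumes "good Z sZ nZ A sA nA e M M'"
  shows "z \<in> Z \<Longrightarrow> M z \<in> A" "z \<in> Z \<Longrightarrow> h \<in> Z \<Longrightarrow> M' z h \<in> A"
    "z \<in> Z \<Longrightarrow> h \<in> Z \<Longrightarrow> h' \<in> Z \<Longrightarrow> M' z (h + h') = M' z h + M' z h'"
    "z \<in> Z \<Longrightarrow> h \<in> Z \<Longrightarrow> M' z (sZ c h) = sA c (M' z h)"
  using assms unfolding good_def by blast+

lemma good_bound:
  assumes "good Z sZ nZ A sA nA e M M'"
  obtains K where "good_const Z nZ nA e M M' K"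
  using assms unfolding good_def by blast

text \<open>A linear map is its own derivative, with zero remainder. Its derivative does not become
  small at the origin, hence order 0.\<close>

lemma good_blin:
  assumes Z: "cnorm Z sZ nZ" and A: "cnorm A sA nA" and L: "blin Z sZ nZ A sA nA L"
  shows "good Z sZ nZ A sA nA 0 L (\<lambda>z h. L h)"
proof -
  interpret Z: cnorm Z sZ nZ by fact
  interpret A: cnorm A sA nA by fact
  obtain K where K: "K \<ge> 0" "\<And>x. x \<in> Z \<Longrightarrow> nA (L x) \<le> K * nZ x"
    using L unfolding blin_def by blast
  have "L (z + h) - L z - L h = 0" if "z \<in> Z" "h \<in> Z" for z h
    using L that unfolding blin_def by simp
  then show ?thesis
    using L K unfolding good_def blin_def by (intro conjI) (auto simp: A.nm_zero good_const_def intro!: exI[of _ K])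
qed

lemma good_weaken:
  assumes Z: "cnorm Z sZ nZ" and M: "good Z sZ nZ A sA nA 1 M M'"
  shows "good Z sZ nZ A sA nA 0 M M'"
proof -
  interpret Z: cnorm Z sZ nZ by fact
  obtain K where "good_const Z nZ nA 1 M M' K" by (rule good_bound[OF M])
  note K = good_constD[OF this]
  have "nA (M' z h) \<le> K * nZ z ^ 0 * nZ h" if "z \<in> Z" "nZ z \<le> 1" "h \<in> Z" for z h
  proof -
    have "K * nZ z ^ 1 * nZ h \<le> K * nZ z ^ 0 * nZ h"
      using K(1) that Z.nm_ge0[of h] by (intro mult_right_mono mult_left_mono) auto
    then show ?thesis using K(3)[OF that] by linarith
  qed
  then show ?thesis
    unfolding good_def using good_D[OF M] K by (intro conjI) (auto simp: good_const_def intro!: exI[of _ K])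
qed

lemma good_add:
  assumes Z: "cnorm Z sZ nZ" and A: "cnorm A sA nA"
    and M: "good Z sZ nZ A sA nA e M M'" and N: "good Z sZ nZ A sA nA e N N'"
  shows "good Z sZ nZ A sA nA e (\<lambda>z. M z + N z) (\<lambda>z h. M' z h + N' z h)"
proof -
  interpret Z: cnorm Z sZ nZ by fact
  interpret A: cnorm A sA nA by fact
  note MD = good_D[OF M] and ND = good_D[OF N]
  obtain K where "good_const Z nZ nA e M M' K" by (rule good_bound[OF M])
  note K = good_constD[OF this]
  obtain J where "good_const Z nZ nA e N N' J" by (rule good_bound[OF N])
  note J = good_constD[OF this]
  have 1: "nA (M z + N z) \<le> (K + J) * nZ z" if "z \<in> Z" "nZ z \<le> 1" for z
    using A.nm_add[OF MD(1) ND(1), of z z] K(2) J(2) that by (fastforce simp: distrib_right)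
  have 2: "nA (M' z h + N' z h) \<le> (K + J) * nZ z ^ e * nZ h" if "z \<in> Z" "nZ z \<le> 1" "h \<in> Z" for z h
    using A.nm_add[OF MD(2) ND(2), of z h z h] K(3)[OF that] J(3)[OF that] that by (simp add: distrib_right)
  have 3: "nA ((M (z + h) + N (z + h)) - (M z + N z) - (M' z h + N' z h)) \<le> (K + J) * (nZ h)^2"
    if "z \<in> Z" "nZ z \<le> 1" "h \<in> Z" "nZ (z + h) \<le> 1" for z h
  proof -
    have eq: "(M (z + h) + N (z + h)) - (M z + N z) - (M' z h + N' z h) = (M (z + h) - M z - M' z h) + (N (z + h) - N z - N' z h)"
      by simp
    have "nA ((M (z + h) - M z - M' z h) + (N (z + h) - N z - N' z h)) \<le> nA (M (z + h) - M z - M' z h) + nA (N (z + h) - N z - N' z h)"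
      using that by (intro A.nm_add A.diff MD ND Z.add)
    then show ?thesis unfolding eq distrib_right using K(4)[OF that] J(4)[OF that] by linarith
  qed
  show ?thesis
    unfolding good_def good_const_def using MD ND K(1) J(1)
    by (intro conjI exI[of _ "K + J"]) (auto simp: A.add A.sc_add 1 2 3)
qed

lemma good_post:
  assumes Z: "cnorm Z sZ nZ" and A: "cnorm A sA nA" and Y: "cnorm Y sY nY"
    and M: "good Z sZ nZ A sA nA e M M'" and L: "blin A sA nA Y sY nY L"
  shows "good Z sZ nZ Y sY nY e (\<lambda>z. L (M z)) (\<lambda>z h. L (M' z h))"
proof -
  interpret Z: cnorm Z sZ nZ by fact
  interpret A: cnorm A sA nA by fact
  interpret Y: cnorm Y sY nY by fact
  note MD = good_D[OF M]
  obtain K where "good_const Z nZ nA e M M' K" by (rule good_bound[OF M])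
  note K = good_constD[OF this]
  obtain J where J: "J \<ge> 0" "\<And>x. x \<in> A \<Longrightarrow> nY (L x) \<le> J * nA x"
    using L unfolding blin_def by blast
  have LA: "x \<in> A \<Longrightarrow> L x \<in> Y" "x \<in> A \<Longrightarrow> y \<in> A \<Longrightarrow> L (x + y) = L x + L y" "x \<in> A \<Longrightarrow> L (sA c x) = sY c (L x)" for x y c
    using L unfolding blin_def by blast+
  have Ld: "L (x - y) = L x - L y" if "x \<in> A" "y \<in> A" for x y
    using LA(2)[OF A.diff[OF that] that(2)] by (simp add: algebra_simps)
  have JJ: "nY (L x) \<le> (J * K) * b" if "x \<in> A" "nA x \<le> K * b" for x b
    using J(2)[OF that(1)] mult_left_mono[OF that(2) J(1)] by (simp add: mult.assoc)
  have 3: "nY (L (M (z + h)) - L (M z) - L (M' z h)) \<le> (J * K) * (nZ h)^2"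
    if "z \<in> Z" "nZ z \<le> 1" "h \<in> Z" "nZ (z + h) \<le> 1" for z h
  proof -
    have "L (M (z + h)) - L (M z) - L (M' z h) = L (M (z + h) - M z - M' z h)"
      using that by (simp add: Ld MD Z.add A.diff)
    then show ?thesis using that K(4)[OF that] by (simp only:) (intro JJ A.diff MD Z.add)
  qed
  have 2: "nY (L (M' z h)) \<le> (J * K) * nZ z ^ e * nZ h" if "z \<in> Z" "nZ z \<le> 1" "h \<in> Z" for z h
    using JJ[OF MD(2)[OF that(1,3)], of "nZ z ^ e * nZ h"] K(3)[OF that] by (simp add: mult.assoc)
  show ?thesis
    unfolding good_def good_const_def using MD K(1,2) J(1)
    by (intro conjI exI[of _ "J * K"]) (auto simp: LA 2 3 intro!: JJ)
qed

locale bilinear_product = cnorm A sA nA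
  for A :: "'a::ab_group_add set" and sA :: "complex \<Rightarrow> 'a \<Rightarrow> 'a" and nA :: "'a \<Rightarrow> real" +
  fixes mul :: "'a \<Rightarrow> 'a \<Rightarrow> 'a" and B :: real
  assumes mul_in: "x \<in> A \<Longrightarrow> y \<in> A \<Longrightarrow> mul x y \<in> A"
    and mul_add_left: "x \<in> A \<Longrightarrow> x' \<in> A \<Longrightarrow> y \<in> A \<Longrightarrow> mul (x + x') y = mul x y + mul x' y"
    and mul_add_right: "x \<in> A \<Longrightarrow> y \<in> A \<Longrightarrow> y' \<in> A \<Longrightarrow> mul x (y + y') = mul x y + mul x y'"
    and mul_sc_left: "x \<in> A \<Longrightarrow> y \<in> A \<Longrightarrow> mul (sA c x) y = sA c (mul x y)"
    and mul_sc_right: "x \<in> A \<Longrightarrow> y \<in> A \<Longrightarrow> mul x (sA c y) = sA c (mul x y)"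
    and nm_mul: "x \<in> A \<Longrightarrow> y \<in> A \<Longrightarrow> nA (mul x y) \<le> B * nA x * nA y"
    and B_ge0: "0 \<le> B"
begin

lemma mul_diff_left: "x \<in> A \<Longrightarrow> x' \<in> A \<Longrightarrow> y \<in> A \<Longrightarrow> mul (x - x') y = mul x y - mul x' y"
  using mul_add_left[OF diff, of x x' x' y] by (simp add: algebra_simps)

lemma mul_diff_right: "x \<in> A \<Longrightarrow> y \<in> A \<Longrightarrow> y' \<in> A \<Longrightarrow> mul x (y - y') = mul x y - mul x y'"
  using mul_add_right[OF _ diff, of x y y' y'] by (simp add: algebra_simps)

lemma nm_mul_le:
  assumes "x \<in> A" "y \<in> A" "nA x \<le> a" "nA y \<le> b" shows "nA (mul x y) \<le> B * (a * b)"
proof -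
  have "nA x * nA y \<le> a * b"
    using assms nm_ge0[of x] nm_ge0[of y] by (intro mult_mono) auto
  then show ?thesis using nm_mul[OF assms(1,2)] mult_left_mono[OF _ B_ge0] by (fastforce simp: mult.assoc)
qed

text \<open>Both factors are of size \<open>nZ z\<close>, so each term of the derivative keeps one
  small factor and the order rises to 1.\<close>

lemma good_mult:
  assumes Z: "cnorm Z sZ nZ"
    and M: "good Z sZ nZ A sA nA 0 M M'" and N: "good Z sZ nZ A sA nA 0 N N'"
  shows "good Z sZ nZ A sA nA 1 (\<lambda>z. mul (M z) (N z)) (\<lambda>z h. mul (M' z h) (N z) + mul (M z) (N' z h))"
proof -
  interpret Z: cnorm Z sZ nZ by fact
  note MD = good_D[OF M] and ND = good_D[OF N]
  obtain K where "good_const Z nZ nA 0 M M' K" by (rule good_bound[OF M])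
  note K = good_constD[OF this]
  obtain J where "good_const Z nZ nA 0 N N' J" by (rule good_bound[OF N])
  note J = good_constD[OF this]
  \<comment> \<open>5 = 1 + 3 + 1 collects the three parts of the remainder; the estimates of value
    and derivative take only 1 and 2.\<close>
  define T where "T = 5 * (B * (K * J))"
  have BKJ: "0 \<le> B * (K * J)" using B_ge0 K(1) J(1) by simp
  have T0: "0 \<le> T" using BKJ by (simp add: T_def)
  have Mle: "nA (M z) \<le> K" and Nle: "nA (N z) \<le> J" if "z \<in> Z" "nZ z \<le> 1" for z
    using K(2)[OF that] J(2)[OF that] mult_left_mono[OF that(2) K(1)] mult_left_mono[OF that(2) J(1)] by auto
  have M'le: "nA (M' z h) \<le> K * nZ h" and N'le: "nA (N' z h) \<le> J * nZ h" if "z \<in> Z" "nZ z \<le> 1" "h \<in> Z" for z h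
    using K(3)[OF that] J(3)[OF that] by auto
  have 1: "nA (mul (M z) (N z)) \<le> T * nZ z" if z: "z \<in> Z" "nZ z \<le> 1" for z
  proof -
    have "nA (mul (M z) (N z)) \<le> B * (K * nZ z * J)"
      by (intro nm_mul_le MD ND z K(2) Nle)
    also have "\<dots> = 1 * (B * (K * J)) * nZ z" by simp
    also have "\<dots> \<le> T * nZ z" unfolding T_def using BKJ Z.nm_ge0[OF z(1)] by (intro mult_right_mono) auto
    finally show ?thesis .
  qed
  have 2: "nA (mul (M' z h) (N z) + mul (M z) (N' z h)) \<le> T * nZ z ^ 1 * nZ h" if z: "z \<in> Z" "nZ z \<le> 1" "h \<in> Z" for z h
  proof -
    have "nA (mul (M' z h) (N z)) \<le> B * ((K * nZ h) * (J * nZ z))"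
      by (intro nm_mul_le MD ND z M'le J(2))
    moreover have "nA (mul (M z) (N' z h)) \<le> B * ((K * nZ z) * (J * nZ h))"
      by (intro nm_mul_le MD ND z N'le K(2))
    moreover have "nA (mul (M' z h) (N z) + mul (M z) (N' z h)) \<le> nA (mul (M' z h) (N z)) + nA (mul (M z) (N' z h))"
      by (intro nm_add mul_in MD ND z)
    ultimately have "nA (mul (M' z h) (N z) + mul (M z) (N' z h)) \<le> 2 * (B * (K * J)) * (nZ z * nZ h)"
      by (simp add: algebra_simps)
    also have "\<dots> \<le> T * (nZ z * nZ h)" unfolding T_def using BKJ Z.nm_ge0[OF z(1)] Z.nm_ge0[OF z(3)] by (intro mult_right_mono) auto
    finally show ?thesis by (simp add: mult.assoc)
  qed
  have 3: "nA (mul (M (z + h)) (N (z + h)) - mul (M z) (N z) - (mul (M' z h) (N z) + mul (M z) (N' z h))) \<le> T * (nZ h)^2"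
    if z: "z \<in> Z" "nZ z \<le> 1" "h \<in> Z" "nZ (z + h) \<le> 1" for z h
  proof -
    have zh: "z + h \<in> Z" using z Z.add by blast
    \<comment> \<open>Both z and z + h lie in the unit ball. The bound turns the quadratic part of
      the increment \<open>dN\<close> into a linear one.\<close>
    have h2: "nZ h \<le> 2" using Z.nm_diff[OF zh z(1)] z by simp
    have h0: "0 \<le> nZ h" using Z.nm_ge0[OF z(3)] .
    define R1 R2 dN where "R1 = M (z + h) - M z - M' z h" and "R2 = N (z + h) - N z - N' z h" and "dN = N (z + h) - N z"
    have in_A: "M z \<in> A" "N z \<in> A" "M (z + h) \<in> A" "N (z + h) \<in> A" "M' z h \<in> A" "N' z h \<in> A"
      using MD ND z zh by auto
    have inR: "R1 \<in> A" "R2 \<in> A" "dN \<in> A" unfolding R1_def R2_def dN_def by (intro diff in_A)+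
    have R: "nA R1 \<le> K * (nZ h)^2" "nA R2 \<le> J * (nZ h)^2" unfolding R1_def R2_def by (intro K(4) J(4) z)+
    have "dN = N' z h + R2" by (simp add: dN_def R2_def)
    then have "nA dN \<le> J * nZ h + J * (nZ h)^2" using nm_add[OF in_A(6) inR(2)] N'le[OF z(1-3)] R(2) by simp
    also have "\<dots> \<le> J * nZ h + J * (2 * nZ h)"
      using h2 h0 J(1) by (intro add_left_mono mult_left_mono) (auto simp: power2_eq_square mult_right_mono)
    finally have dN: "nA dN \<le> 3 * J * nZ h" by simp
    \<comment> \<open>Telescoping that pairs each remainder with a bounded factor and leaves one
      product of two first-order quantities.\<close>
    have eq: "mul (M (z + h)) (N (z + h)) - mul (M z) (N z) - (mul (M' z h) (N z) + mul (M z) (N' z h))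
       = mul R1 (N (z + h)) + mul (M' z h) dN + mul (M z) R2"
    proof -
      have "mul R1 (N (z + h)) = mul (M (z + h)) (N (z + h)) - mul (M z) (N (z + h)) - mul (M' z h) (N (z + h))"
        unfolding R1_def using in_A by (simp add: mul_diff_left diff)
      moreover have "mul (M' z h) dN = mul (M' z h) (N (z + h)) - mul (M' z h) (N z)"
        unfolding dN_def using in_A by (simp add: mul_diff_right)
      moreover have "mul (M z) R2 = mul (M z) (N (z + h)) - mul (M z) (N z) - mul (M z) (N' z h)"
        unfolding R2_def using in_A by (simp add: mul_diff_right diff)
      ultimately show ?thesis by simp
    qed
    have "nA (mul R1 (N (z + h)) + mul (M' z h) dN + mul (M z) R2)
        \<le> nA (mul R1 (N (z + h))) + nA (mul (M' z h) dN) + nA (mul (M z) R2)"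
      using nm_add[OF add[OF mul_in[OF inR(1) in_A(4)] mul_in[OF in_A(5) inR(3)]] mul_in[OF in_A(1) inR(2)]]
        nm_add[OF mul_in[OF inR(1) in_A(4)] mul_in[OF in_A(5) inR(3)]] by linarith
    also have "\<dots> \<le> B * (K * (nZ h)^2 * J) + B * (K * nZ h * (3 * J * nZ h)) + B * (K * (J * (nZ h)^2))"
      by (intro add_mono nm_mul_le inR in_A R dN M'le Mle Nle z zh)
    also have "\<dots> = T * (nZ h)^2" by (simp add: T_def power2_eq_square algebra_simps)
    finally show ?thesis unfolding eq .
  qed
  have lin1: "mul (M' z (h + h')) (N z) + mul (M z) (N' z (h + h'))
      = (mul (M' z h) (N z) + mul (M z) (N' z h)) + (mul (M' z h') (N z) + mul (M z) (N' z h'))"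
    if "z \<in> Z" "h \<in> Z" "h' \<in> Z" for z h h'
    using that MD ND by (simp add: mul_add_left mul_add_right algebra_simps)
  have lin2: "mul (M' z (sZ c h)) (N z) + mul (M z) (N' z (sZ c h)) = sA c (mul (M' z h) (N z) + mul (M z) (N' z h))"
    if "z \<in> Z" "h \<in> Z" for z h c
    using that MD ND by (simp add: mul_sc_left mul_sc_right sc_add)
  show ?thesis
    unfolding good_def good_const_def
    by (intro conjI exI[of _ T] ballI allI impI; (assumption | rule T0 lin1 lin2 1 2 3 add mul_in MD(1,2) ND(1,2))+)
qed

end

section \<open>Products of carriers and the contraction principle\<close>

definition prodsc :: "(complex \<Rightarrow> 'a \<Rightarrow> 'a) \<Rightarrow> (complex \<Rightarrow> 'b \<Rightarrow> 'b) \<Rightarrow> complex \<Rightarrow> 'a \<times> 'b \<Rightarrow> 'a \<times> 'b" where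
  "prodsc s t c z = (s c (fst z), t c (snd z))"

definition prodnm :: "('a \<Rightarrow> real) \<Rightarrow> ('b \<Rightarrow> real) \<Rightarrow> 'a \<times> 'b \<Rightarrow> real" where
  "prodnm n m z = n (fst z) + m (snd z)"

lemma cnorm_prod:
  assumes "cnorm C s n" "cnorm C' s' n'"
  shows "cnorm (C \<times> C') (prodsc s s') (prodnm n n')"
proof -
  interpret C: cnorm C s n by fact
  interpret C': cnorm C' s' n' by fact
  show ?thesis
  proof
    fix x y assume "x \<in> C \<times> C'" "y \<in> C \<times> C'"
    then show "prodnm n n' (x + y) \<le> prodnm n n' x + prodnm n n' y"
      using C.nm_add[of "fst x" "fst y"] C'.nm_add[of "snd x" "snd y"] by (auto simp: prodnm_def mem_Times_iff)
  qed (auto simp: prodsc_def prodnm_def zero_prod_def mem_Times_iff C.zero C'.zero C.add C'.add C.scale C'.scale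
      C.nm_scale C'.nm_scale distrib_left C.nm_ge0 C'.nm_ge0 C.sc_add C'.sc_add C.sc_minus1 C'.sc_minus1 prod_eq_iff)
qed

text \<open>Completeness is asked for sequences with increments decaying like (1/2)^i, exactly what
  the iterates of a contraction with factor 1/2 supply.\<close>

locale banach_carrier = cnorm C sc nm
  for C :: "'a::ab_group_add set" and sc nm +
  assumes nm_eq_0: "x \<in> C \<Longrightarrow> nm x = 0 \<Longrightarrow> x = 0"
    and complete: "(\<And>i::nat. X i \<in> C) \<Longrightarrow> (\<And>i. nm (X (Suc i) - X i) \<le> b * (1/2)^i) \<Longrightarrow> \<exists>s\<in>C. (\<lambda>i. nm (s - X i)) \<longlonglongrightarrow> 0"
begin

lemma contraction_unique:
  assumes "x \<in> C" "y \<in> C" "nm (x - y) \<le> nm (x - y) / 2" shows "x = y"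
proof -
  have "nm (x - y) = 0" using assms nm_ge0[OF diff[OF assms(1,2)]] by simp
  then show ?thesis using nm_eq_0[OF diff[OF assms(1,2)]] by simp
qed

lemma contraction:
  assumes r: "0 \<le> r" and F: "\<And>x. x \<in> C \<Longrightarrow> nm x \<le> r \<Longrightarrow> F x \<in> C \<and> nm (F x) \<le> r"
    and lip: "\<And>x y. x \<in> C \<Longrightarrow> nm x \<le> r \<Longrightarrow> y \<in> C \<Longrightarrow> nm y \<le> r \<Longrightarrow> nm (F x - F y) \<le> nm (x - y) / 2"
  shows "\<exists>x\<in>C. nm x \<le> r \<and> F x = x"
proof -
  define x where "x = rec_nat 0 (\<lambda>_. F)"
  have x0: "x 0 = 0" and xS: "x (Suc i) = F (x i)" for i by (auto simp: x_def)
  have xC: "x i \<in> C \<and> nm (x i) \<le> r" for i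
    by (induction i) (use F r in \<open>auto simp: x0 xS zero nm_zero\<close>)
  have "nm (x (Suc i) - x i) \<le> nm (x 1 - x 0) * (1/2)^i" for i
  proof (induction i)
    case (Suc i)
    have "nm (x (Suc (Suc i)) - x (Suc i)) \<le> nm (x (Suc i) - x i) / 2"
      unfolding xS[of "Suc i"] xS[of i] using xC[of i] xC[of "Suc i"] by (intro lip) (auto simp: xS)
    then show ?case using Suc by simp
  qed simp
  then obtain s where s: "s \<in> C" "(\<lambda>i. nm (s - x i)) \<longlonglongrightarrow> 0"
    using complete[of x] xC by blast
  have sr: "nm s \<le> r"
  proof (rule LIMSEQ_le_const)
    show "(\<lambda>i. nm (s - x i) + r) \<longlonglongrightarrow> r" using tendsto_add[OF s(2) tendsto_const[of r]] by simp
    have "nm s \<le> nm (s - x i) + r" for i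
      using nm_add[OF diff[OF s(1)], of "x i" "x i"] xC[of i] by simp
    then show "\<exists>N. \<forall>n\<ge>N. nm s \<le> nm (s - x n) + r" by blast
  qed
  have FsC: "F s \<in> C" using F[OF s(1) sr] by blast
  \<comment> \<open>The carrier has no topology, so the fixed point property is obtained by bounding
    this norm by a null sequence.\<close>
  have "nm (F s - s) \<le> 0"
  proof (rule LIMSEQ_le_const)
    show "(\<lambda>i. nm (s - x i) / 2 + nm (s - x (Suc i))) \<longlonglongrightarrow> 0"
      using tendsto_add[OF tendsto_divide[OF s(2) tendsto_const[of 2]] LIMSEQ_Suc[OF s(2)]] by simp
    have "nm (F s - s) \<le> nm (s - x i) / 2 + nm (s - x (Suc i))" for i
    proof -
      have "F s - s = (F s - F (x i)) + (x (Suc i) - s)" by (simp add: xS)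
      then have "nm (F s - s) \<le> nm (F s - F (x i)) + nm (x (Suc i) - s)"
        using nm_add[OF diff diff, of "F s" "F (x i)" "x (Suc i)" s] FsC s(1) xC[of "Suc i"] by (simp add: xS)
      moreover have "nm (F s - F (x i)) \<le> nm (s - x i) / 2" using s(1) sr xC[of i] by (intro lip) auto
      ultimately show ?thesis using nm_diff_commute[of "x (Suc i)" s] xC[of "Suc i"] s(1) by simp
    qed
    then show "\<exists>N. \<forall>n\<ge>N. nm (F s - s) \<le> nm (s - x n) / 2 + nm (s - x (Suc n))" by blast
  qed
  then have "F s - s = 0" using nm_eq_0[OF diff[OF FsC s(1)]] nm_ge0[OF diff[OF FsC s(1)]] by simp
  then show ?thesis using s(1) sr by auto
qed

end

text \<open>The solution map \<open>S\<close> is obtained from the contraction principle; its derivative \<open>S' h\<close> at \<open>u\<close> is in turn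
  the fixed point of the affine contraction \<open>v \<mapsto> L h + M' (u, S u) (h, v)\<close>.\<close>

theorem quadratic_fixed_point:
  assumes D: "cnorm D sD nD" and Y: "banach_carrier Y sY nY" and L: "blin D sD nD Y sY nY L"
    and M: "good (D \<times> Y) (prodsc sD sY) (prodnm nD nY) Y sY nY 1 M M'" and \<rho>0: "\<rho>0 > 0"
  obtains \<rho> \<delta> S where "0 < \<rho>" "\<rho> \<le> \<rho>0" "0 < \<delta>"
    "\<And>u. u \<in> D \<Longrightarrow> nD u < \<delta> \<Longrightarrow> S u \<in> Y \<and> nY (S u) \<le> \<rho> \<and> S u = L u + M (u, S u)"
    "\<And>u w. u \<in> D \<Longrightarrow> nD u < \<delta> \<Longrightarrow> w \<in> Y \<Longrightarrow> nY w \<le> \<rho> \<Longrightarrow> w = L u + M (u, w) \<Longrightarrow> w = S u"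
    "\<And>u. u \<in> D \<Longrightarrow> nD u < \<delta> \<Longrightarrow> \<exists>S'. blin D sD nD Y sY nY S' \<and>
       (\<exists>K\<ge>0. \<forall>h\<in>D. nD (u + h) < \<delta> \<longrightarrow> nY (S (u + h) - S u - S' h) \<le> K * (nD h)^2)"
proof -
  interpret D: cnorm D sD nD by fact
  interpret Y: banach_carrier Y sY nY by fact
  define Z sZ nZ where "Z = D \<times> Y" and "sZ = prodsc sD sY" and "nZ = prodnm nD nY"
  have cY: "cnorm Y sY nY" by unfold_locales
  interpret Z: cnorm Z sZ nZ unfolding Z_def sZ_def nZ_def by (rule cnorm_prod[OF D cY])
  have nZ: "nZ (u, w) = nD u + nY w" for u w by (simp add: nZ_def prodnm_def)
  have sZ: "sZ c (u, w) = (sD c u, sY c w)" for c u w by (simp add: sZ_def prodsc_def)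
  have ZI: "u \<in> D \<Longrightarrow> w \<in> Y \<Longrightarrow> (u, w) \<in> Z" for u w by (simp add: Z_def)
  note MD = good_D[OF M, folded Z_def sZ_def]
  obtain K where "good_const Z nZ nY 1 M M' K" unfolding Z_def nZ_def by (rule good_bound[OF M])
  note K0 = good_constD(1)[OF this] and K1 = good_constD(2)[OF this] and K2' = good_constD(3)[OF this] and K3 = good_constD(4)[OF this]
  have K2: "nY (M' z h) \<le> K * nZ z * nZ h" if "z \<in> Z" "nZ z \<le> 1" "h \<in> Z" for z h
    using K2'[OF that] by simp
  obtain C where C: "C \<ge> 0" "\<And>x. x \<in> D \<Longrightarrow> nY (L x) \<le> C * nD x" using L unfolding blin_def by blast
  have LY: "L x \<in> Y" if "x \<in> D" for x using L that unfolding blin_def by blast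
  have Ladd: "L (x + y) = L x + L y" if "x \<in> D" "y \<in> D" for x y using L that unfolding blin_def by blast
  have Lsc: "L (sD c x) = sY c (L x)" if "x \<in> D" for c x using L that unfolding blin_def by blast
  have M0: "M 0 = 0"
  proof -
    have "nY (M 0) \<le> 0" using K1[OF Z.zero] by (simp add: Z.nm_zero)
    then show ?thesis using Y.nm_eq_0 Y.nm_ge0 MD(1)[OF Z.zero] by (meson order_antisym)
  qed
  \<comment> \<open>K \<rho> <= 1/8 makes the derivative on the ball of radius 2 \<rho> and the
    quadratic remainder contribute at most 1/4 each; \<rho> <= 1/2 keeps that ball inside the unit
    ball.\<close>
  define \<rho> where "\<rho> = min \<rho>0 (min (1/2) (1 / (8 * (K + 1))))"
  \<comment> \<open>(C + 1) \<delta> = \<rho> / 2: the terms \<open>L u\<close> and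
    \<open>M (u, 0)\<close> use up half of the radius, the contraction away from w = 0 the other
    half.\<close>
  define \<delta> where "\<delta> = \<rho> / (2 * (C + 1))"
  have "\<rho> \<le> 1/2" unfolding \<rho>_def by (meson min.cobounded1 min.cobounded2 order_trans)
  then have \<rho>: "0 < \<rho>" "\<rho> \<le> \<rho>0" "\<rho> \<le> 1/2" using \<rho>0 K0 by (auto simp: \<rho>_def)
  have K\<rho>: "K * \<rho> \<le> 1/8"
  proof -
    have "(K + 1) * \<rho> \<le> (K + 1) * (1 / (8 * (K + 1)))" using K0 by (intro mult_left_mono) (auto simp: \<rho>_def)
    also have "\<dots> = 1/8" using K0 by simp
    finally show ?thesis using \<rho>(1) by (simp add: distrib_right)
  qed
  have \<delta>: "0 < \<delta>" "\<delta> \<le> \<rho>/2" using \<rho>(1) C(1) by (auto simp: \<delta>_def field_simps)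
  have *: "c * (\<rho> / (2 * c)) = \<rho>/2" if "c > 0" for c :: real using that by simp
  have "(C + 1) * \<delta> = \<rho>/2" unfolding \<delta>_def by (rule * ) (use C(1) in simp)
  then have C\<delta>: "C * \<delta> + \<delta> = \<rho>/2" by (simp add: distrib_right)
  have quarter: "nY (M' z h) \<le> nZ h / 4" if "z \<in> Z" "nZ z \<le> 2 * \<rho>" "h \<in> Z" for z h
  proof -
    have "nY (M' z h) \<le> K * nZ z * nZ h" using that \<rho> by (intro K2) auto
    also have "\<dots> \<le> (K * (2 * \<rho>)) * nZ h" using that K0 Z.nm_ge0 by (intro mult_right_mono mult_left_mono) auto
    also have "\<dots> \<le> (1/4) * nZ h" using K\<rho> Z.nm_ge0 that by (intro mult_right_mono) auto
    finally show ?thesis by simp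
  qed
  have lip: "nY (M (u, x) - M (u, y)) \<le> nY (x - y) / 2"
    if u: "u \<in> D" "nD u < \<delta>" and x: "x \<in> Y" "nY x \<le> \<rho>" and y: "y \<in> Y" "nY y \<le> \<rho>" for u x y
  proof -
    define z h where "z = (u, y)" and "h = (0::'a, x - y)"
    have zh: "z + h = (u, x)" by (simp add: z_def h_def)
    have z: "z \<in> Z" "nZ z \<le> 2 * \<rho>" using u y \<delta> by (auto simp: z_def nZ intro!: ZI)
    have h: "h \<in> Z" and nh: "nZ h = nY (x - y)" using x y D.zero by (auto simp: h_def nZ D.nm_zero intro!: ZI Y.diff)
    have nh2: "nZ h \<le> 2 * \<rho>" using Y.nm_diff[OF x(1) y(1)] x y by (simp add: nh)
    have zz: "nZ z \<le> 1" "nZ (z + h) \<le> 1" using z \<rho> u x \<delta> by (auto simp: zh nZ)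
    have in1: "M (z + h) - M z \<in> Y" using MD(1) z h Z.add Y.diff by blast
    have "nY (M (z + h) - M z) \<le> nY (M (z + h) - M z - M' z h) + nY (M' z h)"
      using Y.nm_add[OF Y.diff[OF in1 MD(2)[OF z(1) h]] MD(2)[OF z(1) h]] by simp
    also have "\<dots> \<le> K * (nZ h)^2 + nZ h / 4" by (intro add_mono K3 quarter z h zz)
    also have "K * (nZ h)^2 \<le> nZ h / 4"
    proof -
      have "K * (nZ h)^2 = (K * nZ h) * nZ h" by (simp add: power2_eq_square)
      also have "\<dots> \<le> (K * (2 * \<rho>)) * nZ h" using nh2 K0 Z.nm_ge0[OF h] by (intro mult_right_mono mult_left_mono) auto
      also have "\<dots> \<le> (1/4) * nZ h" using K\<rho> Z.nm_ge0[OF h] by (intro mult_right_mono) auto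
      finally show ?thesis by simp
    qed
    finally show ?thesis unfolding zh nh by (simp add: z_def)
  qed
  \<comment> \<open>At the origin both M and its derivative vanish, so only the quadratic remainder
    is left.\<close>
  have M_u0: "nY (M (u, 0)) \<le> \<delta>" if u: "u \<in> D" "nD u < \<delta>" for u
  proof -
    have z: "(u, 0) \<in> Z" using u Y.zero by (intro ZI)
    have n: "nZ (u, 0) = nD u" by (simp add: nZ Y.nm_zero)
    have "nY (M (0 + (u, 0)) - M 0 - M' 0 (u, 0)) \<le> K * (nZ (u, 0))^2"
      using z u \<delta> \<rho> by (intro K3 Z.zero) (auto simp: n Z.nm_zero)
    moreover have "M' 0 (u, 0) = 0"
    proof -
      have "nY (M' 0 (u, 0)) \<le> K * nZ 0 * nZ (u, 0)" by (intro K2 Z.zero z) (simp add: Z.nm_zero)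
      then have "nY (M' 0 (u, 0)) \<le> 0" by (simp add: Z.nm_zero)
      then show ?thesis using Y.nm_eq_0 Y.nm_ge0 MD(2)[OF Z.zero z] by (meson order_antisym)
    qed
    ultimately have "nY (M (u, 0)) \<le> K * (nD u)^2" by (simp add: M0 n)
    also have "\<dots> \<le> K * (\<rho> * nD u)"
      using u \<delta> \<rho> K0 D.nm_ge0[OF u(1)] unfolding power2_eq_square by (intro mult_left_mono mult_right_mono) auto
    also have "\<dots> = (K * \<rho>) * nD u" by simp
    also have "\<dots> \<le> 1 * nD u" using K\<rho> D.nm_ge0[OF u(1)] by (intro mult_right_mono) auto
    finally show ?thesis using u by simp
  qed
  have ex: "\<exists>w\<in>Y. nY w \<le> \<rho> \<and> L u + M (u, w) = w" if u: "u \<in> D" "nD u < \<delta>" for u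
  proof (rule Y.contraction)
    fix x assume x: "x \<in> Y" "nY x \<le> \<rho>"
    have inY: "M (u, x) \<in> Y" "M (u, 0) \<in> Y" using MD(1) ZI u x Y.zero by auto
    have "nY (M (u, x) - M (u, 0)) \<le> \<rho> / 2" using lip[OF u x Y.zero] x \<rho> by (simp add: Y.nm_zero)
    moreover have "nY (M (u, x)) \<le> nY (M (u, x) - M (u, 0)) + nY (M (u, 0))"
      using Y.nm_add[OF Y.diff[OF inY] inY(2)] by simp
    moreover have "nY (L u) \<le> C * \<delta>" using C(2)[OF u(1)] mult_left_mono[OF less_imp_le[OF u(2)] C(1)] by linarith
    moreover have "nY (L u + M (u, x)) \<le> nY (L u) + nY (M (u, x))" by (intro Y.nm_add LY u inY)
    ultimately show "L u + M (u, x) \<in> Y \<and> nY (L u + M (u, x)) \<le> \<rho>"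
      using M_u0[OF u] C\<delta> Y.add[OF LY[OF u(1)] inY(1)] by simp
  next
    fix x y assume "x \<in> Y" "nY x \<le> \<rho>" "y \<in> Y" "nY y \<le> \<rho>"
    then show "nY (L u + M (u, x) - (L u + M (u, y))) \<le> nY (x - y) / 2" using lip[OF u] by simp
  qed (use \<rho> in simp)
  define S where "S = (\<lambda>u. SOME w. w \<in> Y \<and> nY w \<le> \<rho> \<and> L u + M (u, w) = w)"
  have S: "S u \<in> Y" "nY (S u) \<le> \<rho>" "S u = L u + M (u, S u)" if u: "u \<in> D" "nD u < \<delta>" for u
  proof -
    have "S u \<in> Y \<and> nY (S u) \<le> \<rho> \<and> L u + M (u, S u) = S u"
      unfolding S_def by (rule someI_ex) (use ex[OF u] in blast)
    then show "S u \<in> Y" "nY (S u) \<le> \<rho>" "S u = L u + M (u, S u)" by auto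
  qed
  have uniq: "w = S u" if u: "u \<in> D" "nD u < \<delta>" and w: "w \<in> Y" "nY w \<le> \<rho>" "w = L u + M (u, w)" for u w
  proof (rule Y.contraction_unique)
    have "w - S u = M (u, w) - M (u, S u)"
      using arg_cong2[OF w(3) S(3)[OF u], of "(-)"] by simp
    then show "nY (w - S u) \<le> nY (w - S u) / 2" using lip[OF u w(1,2) S(1,2)[OF u]] by simp
  qed (use S u w in auto)
  have deriv: "\<exists>S'. blin D sD nD Y sY nY S' \<and>
       (\<exists>J\<ge>0. \<forall>h\<in>D. nD (u + h) < \<delta> \<longrightarrow> nY (S (u + h) - S u - S' h) \<le> J * (nD h)^2)"
    if u: "u \<in> D" "nD u < \<delta>" for u
  proof -
    define z where "z = (u, S u)"
    have z: "z \<in> Z" "nZ z \<le> 2 * \<rho>" using u S[OF u] \<delta> by (auto simp: z_def nZ intro!: ZI)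
    have zv: "nY (M' z (0, v)) \<le> nY v / 4" if "v \<in> Y" for v
      using quarter[OF z, of "(0, v)"] that D.zero by (simp add: nZ D.nm_zero ZI)
    have split: "M' z (h, v) - M' z (h, v') = M' z (0, v - v')" if "h \<in> D" "v \<in> Y" "v' \<in> Y" for h v v'
      using MD(3)[OF z(1), of "(0, v - v')" "(h, v')"] that D.zero by (simp add: ZI Y.diff)
    \<comment> \<open>The linearised equation, solved by contraction in v alone. The radius of the
      ball at the same time provides the operator bound for the derivative.\<close>
    have lin_ex: "\<exists>v\<in>Y. L h + M' z (h, v) = v \<and> nY v \<le> 2 * (C + 1) * nD h" if h: "h \<in> D" for h
    proof -
      have "\<exists>v\<in>Y. nY v \<le> 2 * (C + 1) * nD h \<and> L h + M' z (h, v) = v"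
      proof (rule Y.contraction)
        show "0 \<le> 2 * (C + 1) * nD h" using C(1) D.nm_ge0[OF h] by simp
        fix v assume v: "v \<in> Y" "nY v \<le> 2 * (C + 1) * nD h"
        have inY: "M' z (h, v) \<in> Y" using MD(2) z h v ZI by blast
        have "nY (M' z (h, v)) \<le> nZ (h, v) / 4" by (intro quarter z ZI h v)
        moreover have "nY (L h + M' z (h, v)) \<le> nY (L h) + nY (M' z (h, v))" by (intro Y.nm_add LY h inY)
        ultimately have "nY (L h + M' z (h, v)) \<le> C * nD h + (nD h + 2 * (C + 1) * nD h) / 4"
          using C(2)[OF h] divide_right_mono[OF add_left_mono[OF v(2), of "nD h"], of 4] unfolding nZ by linarith
        also have "\<dots> \<le> 2 * (C + 1) * nD h"
          using C(1) D.nm_ge0[OF h] mult_nonneg_nonneg[OF C(1) D.nm_ge0[OF h]] by (simp add: algebra_simps)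
        finally show "L h + M' z (h, v) \<in> Y \<and> nY (L h + M' z (h, v)) \<le> 2 * (C + 1) * nD h"
          using Y.add[OF LY[OF h] inY] by simp
      next
        fix v v' assume v: "v \<in> Y" "v' \<in> Y"
        have "L h + M' z (h, v) - (L h + M' z (h, v')) = M' z (0, v - v')" using split[OF h v] by simp
        then show "nY (L h + M' z (h, v) - (L h + M' z (h, v'))) \<le> nY (v - v') / 2"
          using zv[OF Y.diff[OF v]] Y.nm_ge0[OF Y.diff[OF v]] by simp
      qed
      then show ?thesis by blast
    qed
    have lin_uniq: "v = v'" if "h \<in> D" "v \<in> Y" "v' \<in> Y" "L h + M' z (h, v) = v" "L h + M' z (h, v') = v'" for h v v'
    proof (rule Y.contraction_unique)
      have "v - v' = M' z (0, v - v')"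
        using split[OF that(1-3)] arg_cong2[OF that(4,5), of "(-)"] by simp
      then show "nY (v - v') \<le> nY (v - v') / 2"
        using zv[OF Y.diff[OF that(2,3)]] Y.nm_ge0[OF Y.diff[OF that(2,3)]] by simp
    qed (use that in auto)
    define S' where "S' = (\<lambda>h. SOME v. v \<in> Y \<and> L h + M' z (h, v) = v \<and> nY v \<le> 2 * (C + 1) * nD h)"
    have S': "S' h \<in> Y" "L h + M' z (h, S' h) = S' h" "nY (S' h) \<le> 2 * (C + 1) * nD h" if h: "h \<in> D" for h
    proof -
      have "S' h \<in> Y \<and> L h + M' z (h, S' h) = S' h \<and> nY (S' h) \<le> 2 * (C + 1) * nD h"
        unfolding S'_def by (rule someI_ex) (use lin_ex[OF h] in blast)
      then show "S' h \<in> Y" "L h + M' z (h, S' h) = S' h" "nY (S' h) \<le> 2 * (C + 1) * nD h" by auto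
    qed
    have "blin D sD nD Y sY nY S'"
      unfolding blin_def
    proof (intro conjI ballI allI)
      show "\<exists>K\<ge>0. \<forall>x\<in>D. nY (S' x) \<le> K * nD x" using S'(3) C(1) by (intro exI[of _ "2 * (C + 1)"]) auto
      fix h assume h: "h \<in> D"
      show "S' h \<in> Y" by (rule S'(1)[OF h])
      show "S' (sD c h) = sY c (S' h)" for c
      proof (rule lin_uniq[OF D.scale[OF h] S'(1)[OF D.scale[OF h]] Y.scale[OF S'(1)[OF h]] S'(2)[OF D.scale[OF h]]])
        have "L (sD c h) + M' z (sD c h, sY c (S' h)) = sY c (L h) + sY c (M' z (h, S' h))"
          using MD(4)[OF z(1) ZI[OF h S'(1)[OF h]], of c] Lsc[OF h] by (simp add: sZ)
        also have "\<dots> = sY c (S' h)" by (simp add: S'(2)[OF h] flip: Y.sc_add)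
        finally show "L (sD c h) + M' z (sD c h, sY c (S' h)) = sY c (S' h)" .
      qed
      fix k assume k: "k \<in> D"
      show "S' (h + k) = S' h + S' k"
      proof (rule lin_uniq[OF D.add[OF h k] S'(1)[OF D.add[OF h k]] Y.add[OF S'(1)[OF h] S'(1)[OF k]] S'(2)[OF D.add[OF h k]]])
        have "M' z (h + k, S' h + S' k) = M' z (h, S' h) + M' z (k, S' k)"
          using MD(3)[OF z(1) ZI[OF h S'(1)[OF h]] ZI[OF k S'(1)[OF k]]] by simp
        then have "L (h + k) + M' z (h + k, S' h + S' k) = (L h + M' z (h, S' h)) + (L k + M' z (k, S' k))"
          by (simp add: Ladd[OF h k])
        then show "L (h + k) + M' z (h + k, S' h + S' k) = S' h + S' k" by (simp add: S'(2)[OF h] S'(2)[OF k])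
      qed
    qed
    moreover have "nY (S (u + h) - S u - S' h) \<le> (2 * K * (4 * C + 5)^2) * (nD h)^2" if h: "h \<in> D" "nD (u + h) < \<delta>" for h
    proof -
      note uh = D.add[OF u(1) h(1)]
      define d where "d = S (u + h) - S u"
      define e where "e = d - S' h"
      have dY: "d \<in> Y" unfolding d_def using S(1) u h uh by (intro Y.diff) auto
      have eY: "e \<in> Y" unfolding e_def by (intro Y.diff dY S' h)
      have hd: "(h, d) \<in> Z" by (intro ZI h dY)
      have zd: "z + (h, d) = (u + h, S (u + h))" by (simp add: z_def d_def)
      have zd1: "nZ (z + (h, d)) \<le> 1" and z1: "nZ z \<le> 1"
        using S(2)[OF uh h(2)] h(2) \<delta> \<rho> z by (auto simp: zd nZ)
      define R where "R = M (z + (h, d)) - M z - M' z (h, d)"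
      have RY: "R \<in> Y" unfolding R_def by (intro Y.diff MD z hd Z.add)
      have R: "nY R \<le> K * (nZ (h, d))^2" unfolding R_def by (intro K3 z z1 hd zd1)
      \<comment> \<open>This crude bound makes K times \<open>nZ (h, d)\<close> at most 1/2, so the
        remainder can be absorbed when d is estimated.\<close>
      have nhd: "nZ (h, d) \<le> 4 * \<rho>"
      proof -
        have "nD h \<le> nD (u + h) + nD u" using D.nm_diff[OF uh u(1)] by simp
        moreover have "nY d \<le> nY (S (u + h)) + nY (S u)" unfolding d_def using S(1) u h uh by (intro Y.nm_diff) auto
        ultimately show ?thesis using S(2)[OF uh h(2)] S(2)[OF u] h(2) u(2) \<delta> by (simp add: nZ)
      qed
      have R': "nY R \<le> nZ (h, d) / 2"
      proof -
        have "K * (nZ (h, d))^2 = (K * nZ (h, d)) * nZ (h, d)" by (simp add: power2_eq_square)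
        also have "\<dots> \<le> (K * (4 * \<rho>)) * nZ (h, d)" using nhd K0 Z.nm_ge0[OF hd] by (intro mult_right_mono mult_left_mono) auto
        also have "\<dots> \<le> (1/2) * nZ (h, d)" using K\<rho> Z.nm_ge0[OF hd] by (intro mult_right_mono) auto
        finally show ?thesis using R by simp
      qed
      \<comment> \<open>The true increment d solves the linearised equation up to the remainder
        R.\<close>
      have deq: "d = L h + M' z (h, d) + R"
      proof -
        have "S (u + h) = L (u + h) + M (z + (h, d))" unfolding zd by (rule S(3)[OF uh h(2)])
        moreover have "S u = L u + M z" unfolding z_def by (rule S(3)[OF u])
        ultimately have "d = L (u + h) + M (z + (h, d)) - (L u + M z)" unfolding d_def by argo
        then show ?thesis by (simp add: R_def Ladd[OF u(1) h(1)] add_diff_eq)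
      qed
      have M'Y: "M' z (h, d) \<in> Y" by (intro MD z hd)
      have "nY d \<le> nY (L h) + nY (M' z (h, d)) + nY R"
        using Y.nm_add[OF Y.add[OF LY[OF h(1)] M'Y] RY] Y.nm_add[OF LY[OF h(1)] M'Y] deq by simp
      also have "\<dots> \<le> C * nD h + nZ (h, d) / 4 + nZ (h, d) / 2"
        by (intro add_mono C h quarter z hd R')
      finally have "nY d \<le> C * nD h + nZ (h, d) / 4 + nZ (h, d) / 2" .
      \<comment> \<open>After absorption a quarter of \<open>nY d\<close> remains on the left, hence
        the factor 4.\<close>
      then have "nY d \<le> 4 * (C * nD h) + 3 * nD h" unfolding nZ by argo
      then have dle: "nY d \<le> (4 * C + 3) * nD h" by (simp add: algebra_simps)
      have "nZ (h, d) \<le> (4 * C + 5) * nD h" using dle D.nm_ge0[OF h(1)] unfolding nZ distrib_right by linarith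
      then have "(nZ (h, d))^2 \<le> ((4 * C + 5) * nD h)^2" using Z.nm_ge0[OF hd] by (intro power_mono) auto
      then have R2: "nY R \<le> K * ((4 * C + 5)^2 * (nD h)^2)"
        using R mult_left_mono[OF _ K0] by (fastforce simp: power_mult_distrib)
      \<comment> \<open>Subtracting the equation of \<open>S' h\<close> leaves R as the only source;
        the factor 1/4 in front of e then bounds e by twice R.\<close>
      have "e = M' z (0, e) + R"
      proof -
        have "d - S' h = L h + M' z (h, d) + R - (L h + M' z (h, S' h))" by (simp only: S'(2)[OF h(1)] flip: deq)
        then show ?thesis using split[OF h(1) dY S'(1)[OF h(1)]] by (simp add: e_def)
      qed
      then have "nY e \<le> nY (M' z (0, e)) + nY R"
        using Y.nm_add[OF MD(2)[OF z(1) ZI[OF D.zero eY]] RY] by simp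
      then have "nY e \<le> 2 * nY R" using zv[OF eY] Y.nm_ge0[OF RY] by linarith
      then show ?thesis using R2 by (simp add: e_def d_def mult.assoc)
    qed
    moreover have "0 \<le> 2 * K * (4 * C + 5)^2" using K0 by simp
    ultimately show ?thesis by blast
  qed
  show ?thesis
    using that[of \<rho> \<delta> S] \<rho> \<delta> S uniq deriv by blast
qed

subsection \<open>Fourier series\<close>

text \<open>Integrate first: the series of derivatives converges uniformly to a continuous
  \<open>G\<close>, whose integral is the increment of the sum; differentiating that integral gives
  the claim.\<close>

lemma infsum_has_vector_derivative:
  fixes f f' :: "int \<Rightarrow> real \<Rightarrow> complex"
  assumes d: "\<And>k t. t \<in> {a..b} \<Longrightarrow> (f k has_vector_derivative f' k t) (at t within {a..b})"
    and c: "\<And>k. continuous_on {a..b} (f' k)"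
    and M: "\<And>k t. t \<in> {a..b} \<Longrightarrow> cmod (f' k t) \<le> M k" "M summable_on UNIV"
    and sm: "\<And>t. t \<in> {a..b} \<Longrightarrow> (\<lambda>k. f k t) summable_on UNIV" and t: "t \<in> {a..b}"
  shows "((\<lambda>t. \<Sum>\<^sub>\<infinity>k. f k t) has_vector_derivative (\<Sum>\<^sub>\<infinity>k. f' k t)) (at t within {a..b})"
proof -
  define F G where "F = (\<lambda>t. \<Sum>\<^sub>\<infinity>k. f k t)" and "G = (\<lambda>t. \<Sum>\<^sub>\<infinity>k. f' k t)"
  have u: "uniform_limit {a..b} (\<lambda>J t. \<Sum>k\<in>J. f' k t) G (finite_subsets_at_top UNIV)"
    unfolding G_def by (rule Weierstrass_m_test_general[OF M(1) M(2)])
  have cG: "continuous_on {a..b} G"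
    by (rule uniform_limit_theorem[OF _ u]) (auto intro!: always_eventually continuous_intros c)
  have eq: "F s = F a + integral {a..s} G" if s: "s \<in> {a..b}" for s
  proof -
    have us: "uniform_limit {a..s} (\<lambda>J t. \<Sum>k\<in>J. f' k t) G (finite_subsets_at_top UNIV)"
      by (rule uniform_limit_on_subset[OF u]) (use s in auto)
    have cs: "continuous_on {a..s} (\<lambda>t. \<Sum>k\<in>J. f' k t)" for J
      by (rule continuous_on_subset[of "{a..b}"]) (use s in \<open>auto intro!: continuous_intros c\<close>)
    obtain I J where IJ: "\<And>n. ((\<lambda>t. \<Sum>k\<in>n. f' k t) has_integral I n) {a..s}" "(G has_integral J) {a..s}"
      "(I \<longlongrightarrow> J) (finite_subsets_at_top UNIV)"
      by (rule uniform_limit_integral[OF us cs finite_subsets_at_top_neq_bot]) (rule that)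
    have "((\<lambda>t. \<Sum>k\<in>n. f' k t) has_integral (\<Sum>k\<in>n. f k s) - (\<Sum>k\<in>n. f k a)) {a..s}" for n
    proof (rule fundamental_theorem_of_calculus)
      show "a \<le> s" using s by simp
      fix x assume x: "x \<in> {a..s}"
      then have "((\<lambda>t. \<Sum>k\<in>n. f k t) has_vector_derivative (\<Sum>k\<in>n. f' k x)) (at x within {a..b})"
        using s by (intro has_vector_derivative_sum d) auto
      then show "((\<lambda>t. \<Sum>k\<in>n. f k t) has_vector_derivative (\<Sum>k\<in>n. f' k x)) (at x within {a..s})"
        by (rule has_vector_derivative_within_subset) (use s in auto)
    qed
    then have "I = (\<lambda>n. (\<Sum>k\<in>n. f k s) - (\<Sum>k\<in>n. f k a))" using IJ(1) has_integral_unique by blast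
    moreover have "((\<lambda>n. (\<Sum>k\<in>n. f k s) - (\<Sum>k\<in>n. f k a)) \<longlongrightarrow> F s - F a) (finite_subsets_at_top UNIV)"
      unfolding F_def using s t by (intro tendsto_diff infsum_tendsto sm) auto
    ultimately have "J = F s - F a" using IJ(3) by (meson finite_subsets_at_top_neq_bot tendsto_unique)
    moreover have "integral {a..s} G = J" using IJ(2) by (rule integral_unique)
    ultimately show ?thesis by simp
  qed
  have "((\<lambda>s. F a + integral {a..s} G) has_vector_derivative 0 + G t) (at t within {a..b})"
    by (intro has_vector_derivative_add has_vector_derivative_const integral_has_vector_derivative cG t)
  then have "(F has_vector_derivative G t) (at t within {a..b})"
    unfolding add_0_left by (rule has_vector_derivative_transform[OF t, rotated]) (rule eq)
  then show ?thesis by (simp add: F_def G_def)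
qed

lemma cis_has_vector_derivative:
  "((\<lambda>x. cis (k * x)) has_vector_derivative \<i> * of_real k * cis (k * x)) (at x within S)"
proof -
  have "((\<lambda>x. exp (\<i> * of_real k * of_real x)) has_vector_derivative \<i> * of_real k * exp (\<i> * of_real k * of_real x)) (at x within S)"
    by (rule has_vector_derivative_real_field) (auto intro!: derivative_eq_intros)
  then show ?thesis by (simp add: cis_conv_exp mult.assoc)
qed

lemma integral_cis:
  fixes j :: int
  shows "((\<lambda>x. cis (real_of_int j * x)) has_integral (if j = 0 then of_real (2 * pi) else 0)) {0..2 * pi}"
proof (cases "j = 0")
  case True
  then show ?thesis using has_integral_const_real[of "1::complex" 0 "2 * pi"] by (simp add: scaleR_conv_of_real)
next
  case False
  have "((\<lambda>x. cis (real_of_int j * x)) has_integral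
     (1 / (\<i> * of_int j) * cis (real_of_int j * (2 * pi)) - 1 / (\<i> * of_int j) * cis (real_of_int j * 0))) {0..2 * pi}"
  proof (rule fundamental_theorem_of_calculus)
    fix x
    have "((\<lambda>x. 1 / (\<i> * of_int j) * cis (real_of_int j * x)) has_vector_derivative
       1 / (\<i> * of_int j) * (\<i> * of_real (real_of_int j) * cis (real_of_int j * x))) (at x within {0..2 * pi})"
      by (intro has_vector_derivative_mult_right cis_has_vector_derivative)
    then show "((\<lambda>x. 1 / (\<i> * of_int j) * cis (real_of_int j * x)) has_vector_derivative cis (real_of_int j * x)) (at x within {0..2 * pi})"
      using False by simp
  qed simp
  moreover have "cis (real_of_int j * (2 * pi)) = 1"
    using cis_multiple_2pi[of "real_of_int j"] by (simp add: mult_ac)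
  ultimately show ?thesis using False by simp
qed

text \<open>Multiply by exp (- i l x) and integrate termwise over a period; orthogonality leaves 2
  pi times the coefficient of index l.\<close>

lemma fourier_unique:
  fixes c :: "int \<Rightarrow> complex"
  assumes sm: "(\<lambda>k. cmod (c k)) summable_on UNIV" and z: "\<And>x. (\<Sum>\<^sub>\<infinity>k. c k * cis (real_of_int k * x)) = 0"
  shows "c l = 0"
proof -
  let ?f = "\<lambda>k x. c k * cis (real_of_int (k - l) * x)"
  have shift: "?f k x = cis (- real_of_int l * x) * (c k * cis (real_of_int k * x))" for k x
    by (simp add: cis_mult algebra_simps)
  have "(\<Sum>\<^sub>\<infinity>k. ?f k x) = 0" for x
    unfolding shift using z[of x] by (simp add: infsum_cmult_right')
  moreover have "uniform_limit {0..2 * pi} (\<lambda>J x. \<Sum>k\<in>J. ?f k x) (\<lambda>x. \<Sum>\<^sub>\<infinity>k. ?f k x) (finite_subsets_at_top UNIV)"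
    by (rule Weierstrass_m_test_general[OF _ sm]) (simp add: norm_mult)
  ultimately have u: "uniform_limit {0..2 * pi} (\<lambda>J x. \<Sum>k\<in>J. ?f k x) (\<lambda>x. 0) (finite_subsets_at_top UNIV)"
    by simp
  have cn: "continuous_on {0..2 * pi} (\<lambda>x. \<Sum>k\<in>J. ?f k x)" for J
    by (intro continuous_intros)
  obtain I J where IJ: "\<And>n. ((\<lambda>x. \<Sum>k\<in>n. ?f k x) has_integral I n) {0..2 * pi}" "((\<lambda>x. 0::complex) has_integral J) {0..2 * pi}"
      "(I \<longlongrightarrow> J) (finite_subsets_at_top UNIV)"
    by (rule uniform_limit_integral[OF u cn finite_subsets_at_top_neq_bot]) (rule that)
  have J0: "J = 0" using IJ(2) has_integral_unique[OF _ has_integral_0] by blast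
  have In: "I n = (\<Sum>k\<in>n. c k * (if k - l = 0 then of_real (2 * pi) else 0))" if "finite n" for n
    by (rule has_integral_unique[OF IJ(1)]) (intro has_integral_sum has_integral_mult_right integral_cis that)
  \<comment> \<open>Along the net of finite index sets the integral is constant as soon as l belongs
    to the set.\<close>
  have "eventually (\<lambda>n. I n = c l * of_real (2 * pi)) (finite_subsets_at_top UNIV)"
    unfolding eventually_finite_subsets_at_top
  proof (intro exI[of _ "{l}"] conjI allI impI)
    fix n :: "int set" assume n: "finite n \<and> {l} \<subseteq> n \<and> n \<subseteq> UNIV"
    then have "I n = (\<Sum>k\<in>n. c k * (if k - l = 0 then of_real (2 * pi) else 0))" by (intro In) simp
    also have "\<dots> = (\<Sum>k\<in>n. if k = l then c l * of_real (2 * pi) else 0)" by (rule sum.cong) auto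
    also have "\<dots> = c l * of_real (2 * pi)" using n by simp
    finally show "I n = c l * of_real (2 * pi)" .
  qed auto
  then have "(I \<longlongrightarrow> c l * of_real (2 * pi)) (finite_subsets_at_top UNIV)"
    by (rule tendsto_eventually)
  then have "c l * of_real (2 * pi) = 0"
    using IJ(3) J0 by (meson finite_subsets_at_top_neq_bot tendsto_unique)
  then show ?thesis by simp
qed

subsection \<open>Functions represented by elements of \<open>Y\<close>\<close>

text \<open>A summable majorant of mode k, uniform in t; the factor 4 is that of
  \<open>sob_H_sup_nu3\<close>.\<close>

definition maj :: "real \<Rightarrow> nat \<Rightarrow> (int \<Rightarrow> real \<Rightarrow> complex) \<Rightarrow> int \<Rightarrow> real" where
  "maj \<sigma> n b k = 4 * (mu \<sigma> n b k * wt k)"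

lemma maj_summable:
  assumes "b \<in> Y_sp \<sigma> n"
  shows "maj \<sigma> n b summable_on UNIV" "(\<Sum>\<^sub>\<infinity>k. maj \<sigma> n b k) \<le> 4 * l2n wt * Y_norm \<sigma> n b"
proof -
  note CS = l2_Cauchy_Schwarz[where f = "mu \<sigma> n b" and g = wt, OF _ l2_wt mu_nonneg wt_nonneg]
  have l: "l2 (mu \<sigma> n b)" using assms by (simp add: Y_sp_iff)
  have e: "maj \<sigma> n b = (\<lambda>k. 4 * (mu \<sigma> n b k * wt k))" by (simp add: maj_def fun_eq_iff)
  show "maj \<sigma> n b summable_on UNIV" unfolding e by (intro summable_on_cmult_right CS(1) l)
  show "(\<Sum>\<^sub>\<infinity>k. maj \<sigma> n b k) \<le> 4 * l2n wt * Y_norm \<sigma> n b"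
    unfolding e infsum_cmult_right' Y_norm_l2n using CS(2)[OF l] by (simp add: mult.commute)
qed

lemma le_maj:
  assumes "b \<in> Y_sp \<sigma> n" "2 \<le> n" "0 \<le> \<sigma>"
  shows "cmod (b k t) \<le> maj \<sigma> n b k"
proof -
  have "cmod (b k t) \<le> 4 * nu n k (b k) * wt k"
    using sob_H_sup_nu3[OF Y_sp_mode[OF assms(1)] assms(2), of k t k] by (simp add: wt_def)
  also have "\<dots> \<le> 4 * mu \<sigma> n b k * wt k"
    using nu_le_mu[OF assms(3), of n k b] by (intro mult_right_mono mult_left_mono) auto
  finally show ?thesis by (simp add: maj_def mult.assoc)
qed

lemma Y_abs_summable:
  assumes "b \<in> Y_sp \<sigma> n" "2 \<le> n" "0 \<le> \<sigma>"
  shows "(\<lambda>k. cmod (b k t)) summable_on UNIV" "(\<lambda>k. cmod (b k t * cis (real_of_int k * x))) summable_on UNIV"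
    "(\<lambda>k. b k t * cis (real_of_int k * x)) summable_on UNIV"
proof -
  show 1: "(\<lambda>k. cmod (b k t)) summable_on UNIV"
    by (rule Infinite_Sum.abs_summable_on_comparison_test'[OF maj_summable(1)[OF assms(1)]]) (rule le_maj[OF assms])
  have "(\<lambda>k. cmod (b k t * cis (real_of_int k * x))) = (\<lambda>k. cmod (b k t))"
    by (intro ext) (simp add: norm_mult)
  then show 2: "(\<lambda>k. cmod (b k t * cis (real_of_int k * x))) summable_on UNIV" using 1 by (simp only:)
  show "(\<lambda>k. b k t * cis (real_of_int k * x)) summable_on UNIV" by (rule Infinite_Sum.abs_summable_summable[OF 2])
qed

lemma yfun_bound:
  assumes "b \<in> Y_sp \<sigma> n" "2 \<le> n" "0 \<le> \<sigma>"
  shows "cmod (yfun b x t) \<le> 4 * l2n wt * Y_norm \<sigma> n b"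
proof -
  have "cmod (yfun b x t) \<le> (\<Sum>\<^sub>\<infinity>k. cmod (b k t * cis (real_of_int k * x)))"
    unfolding yfun_def by (rule norm_infsum_bound[OF Y_abs_summable(2)[OF assms]])
  also have "\<dots> \<le> (\<Sum>\<^sub>\<infinity>k. maj \<sigma> n b k)"
    by (rule infsum_mono[OF Y_abs_summable(2)[OF assms] maj_summable(1)[OF assms(1)]])
      (use le_maj[OF assms] in \<open>simp add: norm_mult\<close>)
  finally show ?thesis using maj_summable(2)[OF assms(1)] by simp
qed

lemma yfun_add:
  assumes "a \<in> Y_sp \<sigma> n" "b \<in> Y_sp \<sigma> n" "2 \<le> n" "0 \<le> \<sigma>"
  shows "yfun (a + b) x t = yfun a x t + yfun b x t"
  unfolding yfun_def using infsum_add[OF Y_abs_summable(3)[OF assms(1,3,4)] Y_abs_summable(3)[OF assms(2,3,4)]]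
  by (simp add: distrib_right)

lemma yfun_scale: "yfun (Y_scale c b) x t = c * yfun b x t"
  by (simp add: yfun_def Y_scale_def mult.assoc infsum_cmult_right')

text \<open>The Cauchy product of two absolutely convergent series; absolute summability over pairs
  (j, k) allows the sums to be exchanged.\<close>

lemma yfun_conv:
  assumes a: "a \<in> Y_sp \<sigma> n" and b: "b \<in> Y_sp \<sigma> n" and n: "2 \<le> n" "0 \<le> \<sigma>"
  shows "yfun (conv a b) x t = yfun a x t * yfun b x t"
proof -
  define A B where "A = (\<lambda>k. a k t * cis (real_of_int k * x))" and "B = (\<lambda>k. b k t * cis (real_of_int k * x))"
  have A: "(\<lambda>k. cmod (A k)) summable_on UNIV" "A summable_on UNIV"
    and B: "(\<lambda>k. cmod (B k)) summable_on UNIV" "B summable_on UNIV"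
    unfolding A_def B_def by (intro Y_abs_summable[OF a n] Y_abs_summable[OF b n])+
  have Bs: "(\<lambda>k. cmod (B (k - j))) summable_on UNIV" "(\<Sum>\<^sub>\<infinity>k. cmod (B (k - j))) = (\<Sum>\<^sub>\<infinity>k. cmod (B k))"
    "(\<Sum>\<^sub>\<infinity>k. B (k - j)) = (\<Sum>\<^sub>\<infinity>k. B k)" for j
  proof -
    have bij: "bij (\<lambda>k. k - j)" by (rule bij_betw_byWitness[where f' = "\<lambda>k. k + j"]) auto
    show "(\<lambda>k. cmod (B (k - j))) summable_on UNIV"
      using summable_on_reindex_bij_betw[OF bij, of "\<lambda>k. cmod (B k)"] B(1) by simp
    show "(\<Sum>\<^sub>\<infinity>k. cmod (B (k - j))) = (\<Sum>\<^sub>\<infinity>k. cmod (B k))"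
      by (rule infsum_reindex_bij_betw[OF bij])
    show "(\<Sum>\<^sub>\<infinity>k. B (k - j)) = (\<Sum>\<^sub>\<infinity>k. B k)" by (rule infsum_reindex_bij_betw[OF bij])
  qed
  have "(\<lambda>z. norm (case z of (j, k) \<Rightarrow> A j * B (k - j))) summable_on UNIV \<times> UNIV"
    unfolding Infinite_Sum.abs_summable_on_Sigma_iff
  proof (intro conjI ballI)
    show "(\<lambda>k. norm (case (j, k) of (j, k) \<Rightarrow> A j * B (k - j))) summable_on UNIV" for j
      using summable_on_cmult_right[OF Bs(1), of "cmod (A j)" j] by (simp add: norm_mult)
    have "(\<Sum>\<^sub>\<infinity>k. norm (case (j, k) of (j, k) \<Rightarrow> A j * B (k - j))) = cmod (A j) * (\<Sum>\<^sub>\<infinity>k. cmod (B k))" for j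
      by (simp add: norm_mult infsum_cmult_right' Bs(2))
    then show "(\<lambda>j. norm (\<Sum>\<^sub>\<infinity>k. norm (case (j, k) of (j, k) \<Rightarrow> A j * B (k - j)))) summable_on UNIV"
      using summable_on_cmult_left[OF A(1), of "\<Sum>\<^sub>\<infinity>k. cmod (B k)"] by (simp add: abs_mult infsum_nonneg)
  qed
  then have S: "(\<lambda>(j, k). A j * B (k - j)) summable_on UNIV \<times> UNIV" by (rule abs_summable_summable)
  have "yfun a x t * yfun b x t = (\<Sum>\<^sub>\<infinity>j. A j) * (\<Sum>\<^sub>\<infinity>k. B k)"
    by (simp add: yfun_def A_def B_def)
  also have "\<dots> = (\<Sum>\<^sub>\<infinity>j. \<Sum>\<^sub>\<infinity>k. A j * B (k - j))"
    by (simp add: infsum_cmult_right' infsum_cmult_left' Bs(3))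
  also have "\<dots> = (\<Sum>\<^sub>\<infinity>k. \<Sum>\<^sub>\<infinity>j. A j * B (k - j))"
    using infsum_swap_banach[of "\<lambda>j k. A j * B (k - j)" UNIV UNIV] S by simp
  also have "\<dots> = yfun (conv a b) x t"
  proof -
    have "A j * B (k - j) = a j t * b (k - j) t * cis (real_of_int k * x)" for j k
    proof -
      have "cis (real_of_int j * x) * cis (real_of_int (k - j) * x) = cis (real_of_int k * x)"
        by (simp add: cis_mult algebra_simps)
      then show ?thesis by (simp add: A_def B_def mult_ac)
    qed
    then show ?thesis by (simp add: yfun_def conv_def infsum_cmult_left')
  qed
  finally show ?thesis by simp
qed

lemma yfun_unique:
  assumes "a \<in> Y_sp \<sigma> n" "b \<in> Y_sp \<sigma> n" "2 \<le> n" "0 \<le> \<sigma>" "\<And>x. yfun a x t = yfun b x t"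
  shows "a k t = b k t"
proof -
  define c where "c = a + Y_scale (-1) b"
  have c: "c \<in> Y_sp \<sigma> n" unfolding c_def by (intro Y_sp_add Y_sp_scale assms)
  have "yfun c x t = 0" for x
    unfolding c_def yfun_add[OF assms(1) Y_sp_scale(1)[OF assms(2)] assms(3,4)] yfun_scale using assms(5)[of x] by simp
  then have "c k t = 0"
    unfolding yfun_def by (intro fourier_unique[of "\<lambda>k. c k t" k] Y_abs_summable(1)[OF c assms(3,4)])
  then show ?thesis by (simp add: c_def Y_scale_def)
qed

text \<open>\<open>Xd\<close> and \<open>Pd\<close> are the x- and \<psi>-derivatives on
  coefficients; \<open>dx_yfun\<close> and \<open>dpsi_yfun\<close> link them with the pointwise
  derivatives.\<close>

definition Xd :: "(int \<Rightarrow> real \<Rightarrow> complex) \<Rightarrow> int \<Rightarrow> real \<Rightarrow> complex" where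
  "Xd b k t = \<i> * of_int k * b k t"

definition Pd :: "(int \<Rightarrow> real \<Rightarrow> complex) \<Rightarrow> int \<Rightarrow> real \<Rightarrow> complex" where
  "Pd b k = D1 (b k)"

lemma Xd_Y:
  assumes "b \<in> Y_sp \<sigma> (Suc n)"
  shows "Xd b \<in> Y_sp \<sigma> n" "Y_norm \<sigma> n (Xd b) \<le> card (PQ n) * Y_norm \<sigma> (Suc n) b"
proof -
  note H = Y_sp_mode[OF assms]
  have e: "Xd b k = (\<lambda>t. (\<i> * of_int k) * b k t)" for k by (simp add: Xd_def fun_eq_iff)
  have m: "Xd b k \<in> sob_H n" for k unfolding e by (rule sob_H_scale(1)[OF sob_H_restrict(1)[OF H]])
  have "nu n k (Xd b k) = \<bar>real_of_int k\<bar> * nu n k (b k)" for k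
    unfolding e nu_scale[OF sob_H_restrict(1)[OF H]] by (simp add: norm_mult)
  then have n: "nu n k (Xd b k) \<le> card (PQ n) * nu (Suc n) k (b k)" for k
    using sob_H_restrict(4)[OF H] by simp
  show "Xd b \<in> Y_sp \<sigma> n" "Y_norm \<sigma> n (Xd b) \<le> card (PQ n) * Y_norm \<sigma> (Suc n) b"
    using Y_mode_operator[OF assms m n] by simp_all
qed

lemma Pd_Y:
  assumes "b \<in> Y_sp \<sigma> (Suc n)" "0 < n"
  shows "Pd b \<in> Y_sp \<sigma> n" "Y_norm \<sigma> n (Pd b) \<le> card (PQ n) * Y_norm \<sigma> (Suc n) b"
proof -
  note H = D1_sob_H[OF Y_sp_mode[OF assms(1)] assms(2)]
  show "Pd b \<in> Y_sp \<sigma> n" "Y_norm \<sigma> n (Pd b) \<le> card (PQ n) * Y_norm \<sigma> (Suc n) b"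
    using Y_mode_operator[OF assms(1), of "Pd b" n "card (PQ n)"] H by (simp_all add: Pd_def)
qed

lemma restrict_Y:
  assumes "b \<in> Y_sp \<sigma> (Suc n)"
  shows "b \<in> Y_sp \<sigma> n" "Y_norm \<sigma> n b \<le> card (PQ n) * Y_norm \<sigma> (Suc n) b"
  using Y_mode_operator[OF assms, of b n "card (PQ n)"] sob_H_restrict(1,3)[OF Y_sp_mode[OF assms]] by simp_all

lemma dx_yfun:
  assumes b: "b \<in> Y_sp \<sigma> (Suc n)" and n: "2 \<le> n" "0 \<le> \<sigma>"
  shows "dx (yfun b) = yfun (Xd b)"
proof (intro ext)
  fix x t
  note X = Xd_Y(1)[OF b]
  have "((\<lambda>x. \<Sum>\<^sub>\<infinity>k. b k t * cis (real_of_int k * x)) has_vector_derivative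
     (\<Sum>\<^sub>\<infinity>k. Xd b k t * cis (real_of_int k * x))) (at x within {x - 1..x + 1})"
  proof (rule infsum_has_vector_derivative[OF _ _ _ maj_summable(1)[OF X]])
    show "((\<lambda>x. b k t * cis (real_of_int k * x)) has_vector_derivative Xd b k t * cis (real_of_int k * s)) (at s within {x - 1..x + 1})" for k s
      using has_vector_derivative_mult_right[OF cis_has_vector_derivative[of "real_of_int k" s "{x - 1..x + 1}"], of "b k t"]
      by (simp add: Xd_def mult_ac)
    show "cmod (Xd b k t * cis (real_of_int k * s)) \<le> maj \<sigma> n (Xd b) k" for k s
      using le_maj[OF X n] by (simp add: norm_mult)
    show "(\<lambda>k. b k t * cis (real_of_int k * s)) summable_on UNIV" for s
      using Y_abs_summable(3)[OF b] n by simp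
  qed (auto intro!: continuous_intros)
  then have "((\<lambda>x. yfun b x t) has_vector_derivative yfun (Xd b) x t) (at x)"
    by (simp add: yfun_def at_within_Icc_at)
  then show "dx (yfun b) x t = yfun (Xd b) x t" unfolding dx_def by (rule vector_derivative_at)
qed

text \<open>Interior t is required because the cut-off outside [0,1] in general destroys the
  two-sided derivative at the end points.\<close>

lemma dpsi_yfun:
  assumes b: "b \<in> Y_sp \<sigma> (Suc n)" and n: "2 \<le> n" "0 \<le> \<sigma>" and t: "t \<in> {0<..<1}"
  shows "((\<lambda>s. yfun b x s) has_vector_derivative yfun (Pd b) x t) (at t)" "dpsi (yfun b) x t = yfun (Pd b) x t"
proof -
  have n0: "0 < n" using n by simp
  note P = Pd_Y(1)[OF b n0]
  have "((\<lambda>s. \<Sum>\<^sub>\<infinity>k. b k s * cis (real_of_int k * x)) has_vector_derivative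
     (\<Sum>\<^sub>\<infinity>k. Pd b k t * cis (real_of_int k * x))) (at t within {0..1})"
  proof (rule infsum_has_vector_derivative[OF _ _ _ maj_summable(1)[OF P]])
    show "((\<lambda>s. b k s * cis (real_of_int k * x)) has_vector_derivative Pd b k s * cis (real_of_int k * x)) (at s within {0..1})" if "s \<in> {0..1}" for k s
      unfolding Pd_def using n by (intro has_vector_derivative_mult_left D1_hvd[OF Y_sp_mode[OF b] _ that]) auto
    show "continuous_on {0..1} (\<lambda>s. Pd b k s * cis (real_of_int k * x))" for k
      by (intro continuous_intros sob_H_continuous[OF Y_sp_mode[OF P] n0])
    show "cmod (Pd b k s * cis (real_of_int k * x)) \<le> maj \<sigma> n (Pd b) k" for k s
      using le_maj[OF P n] by (simp add: norm_mult)
    show "(\<lambda>k. b k s * cis (real_of_int k * x)) summable_on UNIV" for s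
      using Y_abs_summable(3)[OF b] n by simp
  qed (use t in auto)
  then show d: "((\<lambda>s. yfun b x s) has_vector_derivative yfun (Pd b) x t) (at t)"
    using t by (simp add: yfun_def at_within_Icc_at)
  show "dpsi (yfun b) x t = yfun (Pd b) x t" unfolding dpsi_def by (rule vector_derivative_at[OF d])
qed

lemma dpsi_dpsi_yfun:
  assumes b: "b \<in> Y_sp \<sigma> (Suc (Suc n))" and n: "2 \<le> n" "0 \<le> \<sigma>" and t: "t \<in> {0<..<1}"
  shows "dpsi (dpsi (yfun b)) x t = yfun (Pd (Pd b)) x t"
proof -
  have P: "Pd b \<in> Y_sp \<sigma> (Suc n)" by (rule Pd_Y(1)[OF b]) simp
  have "((\<lambda>s. dpsi (yfun b) x s) has_vector_derivative yfun (Pd (Pd b)) x t) (at t)"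
  \<comment> \<open>The first derivative is identified only on the open interval, which suffices
    because it is a neighbourhood of t.\<close>
  proof (rule has_vector_derivative_transform_within_open[OF dpsi_yfun(1)[OF P n t], where S = "{0<..<1}"])
    show "yfun (Pd b) x s = dpsi (yfun b) x s" if "s \<in> {0<..<1}" for s
      using dpsi_yfun(2)[OF b _ n(2) that] n by simp
  qed (use t in auto)
  then show ?thesis unfolding dpsi_def[of "dpsi (yfun b)"] by (rule vector_derivative_at)
qed

subsection \<open>The data space\<close>

definition xm :: "real \<Rightarrow> real \<Rightarrow> (int \<Rightarrow> complex) \<Rightarrow> int \<Rightarrow> real" where
  "xm \<sigma> s f k = sqrt (X_weight \<sigma> s k) * cmod (f k)"

lemma X_weight_nonneg: "0 \<le> X_weight \<sigma> s k" by (simp add: X_weight_def)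

lemma xm_nonneg [simp]: "0 \<le> xm \<sigma> s f k" by (simp add: xm_def X_weight_nonneg)

lemma xm_sq: "(xm \<sigma> s f k)^2 = X_weight \<sigma> s k * (cmod (f k))^2"
  by (simp add: xm_def power_mult_distrib X_weight_nonneg)

lemma X_sp_iff: "f \<in> X_sp \<sigma> s \<longleftrightarrow> l2 (xm \<sigma> s f)"
  by (simp add: X_sp_def l2_def xm_sq)

lemma X_norm_l2n: "X_norm \<sigma> s f = l2n (xm \<sigma> s f)"
  by (simp add: X_norm_def l2n_def xm_sq)

lemma cnorm_X: "cnorm (X_sp \<sigma> s) (\<lambda>c f k. c * f k) (X_norm \<sigma> s)"
proof
  fix f g :: "int \<Rightarrow> complex" and c
  assume f: "f \<in> X_sp \<sigma> s"
  have xs: "xm \<sigma> s (\<lambda>k. c * f k) = (\<lambda>k. cmod c * xm \<sigma> s f k)" by (auto simp: xm_def norm_mult)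
  show "(\<lambda>k. c * f k) \<in> X_sp \<sigma> s" "X_norm \<sigma> s (\<lambda>k. c * f k) = cmod c * X_norm \<sigma> s f"
    using l2_scale[of "xm \<sigma> s f" "cmod c"] f by (auto simp: X_sp_iff X_norm_l2n xs)
  assume g: "g \<in> X_sp \<sigma> s"
  have le: "xm \<sigma> s (f + g) k \<le> xm \<sigma> s f k + xm \<sigma> s g k" for k
    unfolding xm_def distrib_left[symmetric] by (intro mult_left_mono) (auto simp: norm_triangle_ineq X_weight_nonneg)
  note l = l2_add[OF f[unfolded X_sp_iff] g[unfolded X_sp_iff]]
  show "f + g \<in> X_sp \<sigma> s" unfolding X_sp_iff by (rule l2_mono(1)[OF l(1) xm_nonneg le])
  show "X_norm \<sigma> s (f + g) \<le> X_norm \<sigma> s f + X_norm \<sigma> s g"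
    using l2_mono(2)[OF l(1) xm_nonneg le] l(2) by (simp add: X_norm_l2n)
qed (auto simp: X_sp_iff X_norm_l2n xm_def l2_def fun_eq_iff distrib_left)

lemma X_sp_single: "(\<lambda>k. if k = 0 then c else 0) \<in> X_sp \<sigma> s"
proof -
  have "(\<lambda>k::int. X_weight \<sigma> s k * (cmod (if k = 0 then c else 0))^2) summable_on UNIV
     \<longleftrightarrow> (\<lambda>k::int. X_weight \<sigma> s k * (cmod (if k = 0 then c else 0))^2) summable_on {0}"
    by (rule summable_on_cong_neutral) auto
  then show ?thesis by (simp add: X_sp_def)
qed

text \<open>For s >= 1 the weight is at least ((1 + |k|) / 2)^2, so the coefficients are dominated
  by an l^2 family times \<open>wt\<close>.\<close>

lemma X_abs_summable:
  assumes f: "f \<in> X_sp \<sigma> s" and s: "1 \<le> s" and \<sigma>: "0 \<le> \<sigma>"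
  shows "(\<lambda>k. cmod (f k)) summable_on UNIV"
proof (rule summable_on_comparison_test)
  show "(\<lambda>k. 2 * (xm \<sigma> s f k * wt k)) summable_on UNIV"
    using f l2_wt by (intro summable_on_cmult_right l2_Cauchy_Schwarz(1)) (auto simp: X_sp_iff)
  fix k :: int
  let ?K = "\<bar>real_of_int k\<bar>"
  have "((1 + ?K) / 2)^2 \<le> 1 + ?K^2"
    using sum_power2_ge_zero[of "1 - ?K" "?K"] by (simp add: power2_eq_square field_simps)
  also have "\<dots> = (1 + (real_of_int k)^2) powr 1" by simp
  also have "\<dots> \<le> (1 + (real_of_int k)^2) powr s" using s by (intro powr_mono) auto
  also have "\<dots> = (1 + (real_of_int k)^2) powr s * 1" by simp
  also have "\<dots> \<le> X_weight \<sigma> s k"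
    unfolding X_weight_def using \<sigma> by (intro mult_left_mono) auto
  finally have "(1 + ?K) / 2 \<le> sqrt (X_weight \<sigma> s k)" by (rule real_le_rsqrt)
  then have "(1 + ?K) / 2 * cmod (f k) \<le> xm \<sigma> s f k" unfolding xm_def by (intro mult_right_mono) auto
  then show "cmod (f k) \<le> 2 * (xm \<sigma> s f k * wt k)" by (simp add: wt_def field_simps)
qed simp

text \<open>At frequency 0 only the terms with q = 0 survive, since 0^0 = 1.\<close>

lemma H_norm_nu: "H_norm n f = nu n 0 f"
proof -
  have "(\<Sum>(p, q)\<in>PQ n. (\<bar>real_of_int 0\<bar> ^ q * dn n f p)^2) = (\<Sum>p\<le>n. \<Sum>q\<le>n - p. (\<bar>real_of_int 0\<bar> ^ q * dn n f p)^2)"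
    unfolding PQ_def by (subst sum.Sigma[symmetric]) auto
  also have "\<dots> = (\<Sum>p\<le>n. \<Sum>q\<le>n - p. if q = 0 then L2sq (sob_D n f p) else 0)"
    by (intro sum.cong refl) (auto simp: dn_def nL_sq power_0_left)
  also have "\<dots> = (\<Sum>p\<le>n. L2sq (sob_D n f p))" by simp
  finally show ?thesis by (simp add: H_norm_def nu_def L2_set_def split_def)
qed

lemma cnorm_H: "cnorm (sob_H n) (\<lambda>c f t. c * f t) (H_norm n)"
proof
  show "(0::real \<Rightarrow> complex) \<in> sob_H n" using sob_H_zero(1) by (simp add: zero_fun_def)
  fix f g :: "real \<Rightarrow> complex"
  assume f: "f \<in> sob_H n"
  show "(\<lambda>t. c * f t) \<in> sob_H n" "H_norm n (\<lambda>t. c * f t) = cmod c * H_norm n f" for c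
    by (simp_all add: sob_H_scale(1)[OF f] nu_scale[OF f] H_norm_nu)
  assume g: "g \<in> sob_H n"
  have e: "f + g = (\<lambda>t. f t + g t)" by (simp add: fun_eq_iff)
  show "f + g \<in> sob_H n" "H_norm n (f + g) \<le> H_norm n f + H_norm n g"
    unfolding e by (simp_all add: sob_H_add(1)[OF f g] nu_triangle[OF f g] H_norm_nu)
qed (auto simp: H_norm_nu fun_eq_iff distrib_left)

lemma D_add_eq: "D_add u v = u + v" and D_diff_eq: "D_diff u v = u - v"
  by (auto simp: D_add_def D_diff_def plus_prod_def minus_prod_def fun_eq_iff split: prod.split)

lemma cnorm_D: "cnorm (D_sp \<sigma> (n + 2)) D_scale (D_norm \<sigma> (n + 2))"
proof -
  have "cnorm (X_sp \<sigma> (real (n + 2) - 1/2) \<times> X_sp \<sigma> (real (n + 2) - 1/2) \<times> sob_H n)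
     (prodsc (\<lambda>c f k. c * f k) (prodsc (\<lambda>c f k. c * f k) (\<lambda>c f t. c * f t)))
     (prodnm (X_norm \<sigma> (real (n + 2) - 1/2)) (prodnm (X_norm \<sigma> (real (n + 2) - 1/2)) (H_norm n)))"
    by (intro cnorm_prod cnorm_X cnorm_H)
  moreover have "D_scale = prodsc (\<lambda>c f k. c * f k) (prodsc (\<lambda>c f k. c * f k) (\<lambda>c f t. c * f t))"
    by (auto simp: fun_eq_iff D_scale_def prodsc_def)
  moreover have "D_norm \<sigma> (n + 2) = prodnm (X_norm \<sigma> (real (n + 2) - 1/2)) (prodnm (X_norm \<sigma> (real (n + 2) - 1/2)) (H_norm n))"
    by (auto simp: fun_eq_iff D_norm_def prodnm_def)
  ultimately show ?thesis by (simp add: D_sp_def)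
qed

lemma Y_scale_add: "Y_scale c (a + b) = Y_scale c a + Y_scale c b"
  and Y_scale_minus1: "Y_scale (-1) a = - a"
  and Y_scale_commute: "Y_scale c (Y_scale d a) = Y_scale d (Y_scale c a)"
  by (auto simp: Y_scale_def fun_eq_iff distrib_left)

lemma cnorm_Y: "cnorm (Y_sp \<sigma> n) Y_scale (Y_norm \<sigma> n)"
  by unfold_locales (auto simp: Y_sp_zero Y_sp_add Y_sp_scale Y_scale_add Y_scale_minus1)

lemma banach_Y: "0 < n \<Longrightarrow> 0 \<le> \<sigma> \<Longrightarrow> banach_carrier (Y_sp \<sigma> n) Y_scale (Y_norm \<sigma> n)"
  using cnorm_Y Y_norm_eq_0 Y_complete
  unfolding banach_carrier_def banach_carrier_axioms_def by blast

lemma product_Y: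
  assumes "2 \<le> n" "0 \<le> \<sigma>"
  shows "bilinear_product (Y_sp \<sigma> n) Y_scale (Y_norm \<sigma> n) conv (Cconv n)"
proof -
  interpret cnorm "Y_sp \<sigma> n" Y_scale "Y_norm \<sigma> n" by (rule cnorm_Y)
  show ?thesis
    by unfold_locales
      (use assms in \<open>auto simp: conv_bound conv_add_left conv_add_right conv_scale_left conv_scale_right Cconv_nonneg\<close>)
qed

subsection \<open>Bounded linear operators\<close>

lemma blin_comp:
  assumes "blin C s n C' s' n' L" "blin C' s' n' C'' s'' n'' M"
  shows "blin C s n C'' s'' n'' (\<lambda>x. M (L x))"
proof -
  obtain K where K: "K \<ge> 0" "\<forall>x\<in>C. n' (L x) \<le> K * n x" using assms(1) unfolding blin_def by blast
  obtain J where J: "J \<ge> 0" "\<forall>x\<in>C'. n'' (M x) \<le> J * n' x" using assms(2) unfolding blin_def by blast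
  have "n'' (M (L x)) \<le> (J * K) * n x" if x: "x \<in> C" for x
  proof -
    have "L x \<in> C'" using assms(1) x unfolding blin_def by blast
    then have "n'' (M (L x)) \<le> J * n' (L x)" using J by blast
    also have "\<dots> \<le> J * (K * n x)" using K x J(1) by (intro mult_left_mono) auto
    finally show ?thesis by (simp add: mult.assoc)
  qed
  then have "\<exists>K\<ge>0. \<forall>x\<in>C. n'' (M (L x)) \<le> K * n x" using J(1) K(1) by (intro exI[of _ "J * K"]) auto
  then show ?thesis using assms unfolding blin_def by auto
qed

lemma blin_fst:
  assumes "cnorm C' s' n'" shows "blin (C \<times> C') (prodsc s s') (prodnm n n') C s n fst"
  unfolding blin_def
  using cnorm.nm_ge0[OF assms] by (auto simp: prodsc_def prodnm_def intro!: exI[of _ 1])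

lemma blin_snd:
  assumes "cnorm C s n" shows "blin (C \<times> C') (prodsc s s') (prodnm n n') C' s' n' snd"
  unfolding blin_def
  using cnorm.nm_ge0[OF assms] by (auto simp: prodsc_def prodnm_def intro!: exI[of _ 1])

lemma blin_add:
  assumes C': "cnorm C' s' n'" and L: "blin C s n C' s' n' L" and M: "blin C s n C' s' n' M"
  shows "blin C s n C' s' n' (\<lambda>x. L x + M x)"
proof -
  interpret C': cnorm C' s' n' by fact
  obtain K where K: "K \<ge> 0" "\<forall>x\<in>C. n' (L x) \<le> K * n x" using L unfolding blin_def by blast
  obtain J where J: "J \<ge> 0" "\<forall>x\<in>C. n' (M x) \<le> J * n x" using M unfolding blin_def by blast
  have "n' (L x + M x) \<le> (K + J) * n x" if x: "x \<in> C" for x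
  proof -
    have "n' (L x + M x) \<le> n' (L x) + n' (M x)" using L M x unfolding blin_def by (intro C'.nm_add) blast+
    then show ?thesis using K J x unfolding distrib_right by fastforce
  qed
  then have "\<exists>K\<ge>0. \<forall>x\<in>C. n' (L x + M x) \<le> K * n x" using J(1) K(1) by (intro exI[of _ "K + J"]) auto
  then show ?thesis using L M unfolding blin_def by (auto simp: C'.sc_add C'.add)
qed

lemma blin_Y_scale: "blin (Y_sp \<sigma> n) Y_scale (Y_norm \<sigma> n) (Y_sp \<sigma> n) Y_scale (Y_norm \<sigma> n) (Y_scale c)"
  unfolding blin_def
  by (auto simp: Y_sp_scale Y_scale_add Y_scale_commute intro!: exI[of _ "cmod c"])

lemma blin_Y_mode:
  assumes T: "\<And>k f. f \<in> sob_H n \<Longrightarrow> T k f \<in> sob_H n' \<and> nu n' k (T k f) \<le> C * nu n k f" and C: "0 \<le> C"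
    and add: "\<And>k f g. f \<in> sob_H n \<Longrightarrow> g \<in> sob_H n \<Longrightarrow> T k (\<lambda>t. f t + g t) = (\<lambda>t. T k f t + T k g t)"
    and scale: "\<And>k f c. f \<in> sob_H n \<Longrightarrow> T k (\<lambda>t. c * f t) = (\<lambda>t. c * T k f t)"
    and L: "\<And>b k. L b k = T k (b k)"
  shows "blin (Y_sp \<sigma> n) Y_scale (Y_norm \<sigma> n) (Y_sp \<sigma> n') Y_scale (Y_norm \<sigma> n') L"
  unfolding blin_def
proof (intro conjI ballI allI)
  fix b assume b: "b \<in> Y_sp \<sigma> n"
  note H = Y_sp_mode[OF b]
  show "L b \<in> Y_sp \<sigma> n'" using Y_mode_operator(1)[OF b, of "L b" n' C] T[OF H] C by (simp add: L)
  show "L (Y_scale c b) = Y_scale c (L b)" for c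
    unfolding Y_scale_def L scale[OF H] by (simp add: L fun_eq_iff scale[OF H])
  fix a assume a: "a \<in> Y_sp \<sigma> n"
  show "L (b + a) = L b + L a"
  proof (intro ext)
    fix k t
    have e: "(b + a) k = (\<lambda>t. b k t + a k t)" by (simp add: fun_eq_iff)
    show "L (b + a) k t = (L b + L a) k t"
      unfolding plus_fun_apply L e add[OF H Y_sp_mode[OF a]] ..
  qed
next
  show "\<exists>K\<ge>0. \<forall>b\<in>Y_sp \<sigma> n. Y_norm \<sigma> n' (L b) \<le> K * Y_norm \<sigma> n b"
  proof (intro exI[of _ C] conjI C ballI)
    fix b assume b: "b \<in> Y_sp \<sigma> n"
    show "Y_norm \<sigma> n' (L b) \<le> C * Y_norm \<sigma> n b"
      using Y_mode_operator(2)[OF b, of "L b" n' C] T[OF Y_sp_mode[OF b]] C by (simp add: L)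
  qed
qed

lemma blin_Xd: "blin (Y_sp \<sigma> (Suc n)) Y_scale (Y_norm \<sigma> (Suc n)) (Y_sp \<sigma> n) Y_scale (Y_norm \<sigma> n) Xd"
proof (rule blin_Y_mode[where T = "\<lambda>k f t. (\<i> * of_int k) * f t" and C = "card (PQ n)"])
  fix k f assume f: "f \<in> sob_H (Suc n)"
  show "(\<lambda>t. (\<i> * of_int k) * f t) \<in> sob_H n \<and> nu n k (\<lambda>t. (\<i> * of_int k) * f t) \<le> card (PQ n) * nu (Suc n) k f"
    using sob_H_scale(1)[OF sob_H_restrict(1)[OF f]] sob_H_restrict(4)[OF f, of k]
    unfolding nu_scale[OF sob_H_restrict(1)[OF f]] by (simp add: norm_mult)
qed (auto simp: Xd_def fun_eq_iff algebra_simps)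

lemma blin_Pd:
  assumes "0 < n"
  shows "blin (Y_sp \<sigma> (Suc n)) Y_scale (Y_norm \<sigma> (Suc n)) (Y_sp \<sigma> n) Y_scale (Y_norm \<sigma> n) Pd"
proof (rule blin_Y_mode[where T = "\<lambda>k. D1" and C = "card (PQ n)"])
  show "Pd b k = D1 (b k)" for b k by (simp add: Pd_def fun_eq_iff)
qed (use assms in \<open>auto simp: D1_sob_H D1_add[of _ "Suc n"] D1_scale[of _ "Suc n"]\<close>)

lemma blin_restrict: "blin (Y_sp \<sigma> (Suc n)) Y_scale (Y_norm \<sigma> (Suc n)) (Y_sp \<sigma> n) Y_scale (Y_norm \<sigma> n) (\<lambda>b. b)"
  by (rule blin_Y_mode[where T = "\<lambda>k f. f" and C = "card (PQ n)"]) (auto simp: sob_H_restrict(1,3))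

text \<open>Solution operator of the Poisson equation with zero boundary values.\<close>

definition Gop :: "nat \<Rightarrow> (int \<Rightarrow> real \<Rightarrow> complex) \<Rightarrow> int \<Rightarrow> real \<Rightarrow> complex" where
  "Gop n b k = dirichlet n k (b k)"

text \<open>Linearity comes from uniqueness: combinations of solutions solve the combined
  problem.\<close>

lemma blin_Gop:
  assumes "0 < n"
  shows "blin (Y_sp \<sigma> n) Y_scale (Y_norm \<sigma> n) (Y_sp \<sigma> (n + 2)) Y_scale (Y_norm \<sigma> (n + 2)) (Gop n)"
proof (rule blin_Y_mode[where T = "dirichlet n" and C = "CG n", OF _ CG_nonneg])
  fix k f assume f: "f \<in> sob_H n"
  note d = dirichlet[OF f assms, of k]
  show "dirichlet n k f \<in> sob_H (n + 2) \<and> nu (n + 2) k (dirichlet n k f) \<le> CG n * nu n k f"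
    using d dirichlet_bound[OF f assms d] by (simp add: is_dirichlet_def)
  show "dirichlet n k (\<lambda>t. c * f t) = (\<lambda>t. c * dirichlet n k f t)" for c
    by (intro dirichlet_eq is_dirichlet_scale d assms)
  fix g assume g: "g \<in> sob_H n"
  show "dirichlet n k (\<lambda>t. f t + g t) = (\<lambda>t. dirichlet n k f t + dirichlet n k g t)"
    by (intro dirichlet_eq is_dirichlet_add d dirichlet g assms)
qed (simp add: Gop_def fun_eq_iff)

text \<open>A function of \<psi> alone, placed in Fourier mode 0.\<close>

definition emb :: "(real \<Rightarrow> complex) \<Rightarrow> int \<Rightarrow> real \<Rightarrow> complex" where
  "emb F k t = (if k = 0 then F t else 0)"

lemma emb_Y:
  assumes "F \<in> sob_H n" shows "emb F \<in> Y_sp \<sigma> n" "Y_norm \<sigma> n (emb F) \<le> H_norm n F"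
proof -
  have e: "emb F k = (if k = 0 then F else (\<lambda>t. 0))" for k by (auto simp: emb_def)
  have m: "mu \<sigma> n (emb F) = (\<lambda>k. if k = 0 then H_norm n F else 0)" by (auto simp: mu_def e H_norm_nu fun_eq_iff)
  have *: "L2_set (mu \<sigma> n (emb F)) K \<le> H_norm n F" if "finite K" for K
    unfolding m L2_set_def using that
    by (simp add: H_norm_nu if_distrib[of "\<lambda>x. x^2"] cong: if_cong)
  show "emb F \<in> Y_sp \<sigma> n" "Y_norm \<sigma> n (emb F) \<le> H_norm n F"
    using l2_I[OF *] assms sob_H_zero(1) by (auto simp: Y_sp_iff Y_norm_l2n e)
qed

lemma yfun_emb: "yfun (emb F) x t = F t"
proof -
  have "yfun (emb F) x t = (\<Sum>\<^sub>\<infinity>k\<in>{0}. emb F k t * cis (real_of_int k * x))"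
    unfolding yfun_def by (rule infsum_cong_neutral) (auto simp: emb_def)
  then show ?thesis by (simp add: emb_def)
qed

definition Hop :: "(int \<Rightarrow> complex) \<Rightarrow> (int \<Rightarrow> complex) \<Rightarrow> int \<Rightarrow> real \<Rightarrow> complex" where
  "Hop f g k = harm k (f k) (g k)"

lemma harm_add: "harm k (f + f') (g + g') t = harm k f g t + harm k f' g' t"
  and harm_scale: "harm k (c * f) (c * g) t = c * harm k f g t"
  by (simp_all add: harm_def algebra_simps add_divide_distrib)

text \<open>The square root of \<open>X_weight\<close> is the exponential weight times the factor in
  \<open>harm_sob\<close>, so the X-norms appear mode by mode.\<close>

lemma Hop_Y:
  assumes n: "0 < n" and f: "f \<in> X_sp \<sigma> (real (n + 2) - 1/2)" and g: "g \<in> X_sp \<sigma> (real (n + 2) - 1/2)"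
  shows "Hop f g \<in> Y_sp \<sigma> (n + 2)"
    "Y_norm \<sigma> (n + 2) (Hop f g) \<le> 2 * CG n * (X_norm \<sigma> (real (n + 2) - 1/2) f + X_norm \<sigma> (real (n + 2) - 1/2) g)"
proof -
  let ?s = "real (n + 2) - 1/2"
  have C: "0 \<le> 2 * CG n" using CG_nonneg by simp
  have le: "mu \<sigma> (n + 2) (Hop f g) k \<le> 2 * CG n * (xm \<sigma> ?s f k + xm \<sigma> ?s g k)" for k
  proof -
    have "mu \<sigma> (n + 2) (Hop f g) k \<le> exp (\<sigma> * \<bar>real_of_int k\<bar>) * (2 * CG n * sqrt ((1 + (real_of_int k)^2) powr ?s) * (cmod (f k) + cmod (g k)))"
      unfolding mu_def Hop_def by (intro mult_left_mono harm_sob(2)[OF n]) auto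
    also have "\<dots> = 2 * CG n * (sqrt (X_weight \<sigma> ?s k) * (cmod (f k) + cmod (g k)))"
    proof -
      have "sqrt (exp (2 * \<sigma> * \<bar>real_of_int k\<bar>)) = exp (\<sigma> * \<bar>real_of_int k\<bar>)"
        by (rule real_sqrt_unique) (simp_all add: power2_eq_square flip: exp_add)
      then show ?thesis by (simp add: X_weight_def real_sqrt_mult)
    qed
    finally show ?thesis by (simp add: xm_def distrib_left)
  qed
  have l: "l2 (\<lambda>k. 2 * CG n * (xm \<sigma> ?s f k + xm \<sigma> ?s g k))"
    using f g by (intro l2_scale(1) l2_add(1) C) (auto simp: X_sp_iff)
  have "l2n (\<lambda>k. 2 * CG n * (xm \<sigma> ?s f k + xm \<sigma> ?s g k)) = 2 * CG n * l2n (\<lambda>k. xm \<sigma> ?s f k + xm \<sigma> ?s g k)"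
    using f g by (intro l2_scale(2) l2_add(1) C) (auto simp: X_sp_iff)
  also have "\<dots> \<le> 2 * CG n * (X_norm \<sigma> ?s f + X_norm \<sigma> ?s g)"
    using f g unfolding X_norm_l2n by (intro mult_left_mono l2_add(2) C) (auto simp: X_sp_iff)
  finally have "l2n (\<lambda>k. 2 * CG n * (xm \<sigma> ?s f k + xm \<sigma> ?s g k)) \<le> \<dots>" .
  then show "Y_norm \<sigma> (n + 2) (Hop f g) \<le> 2 * CG n * (X_norm \<sigma> ?s f + X_norm \<sigma> ?s g)"
    using l2_mono(2)[OF l mu_nonneg le] unfolding Y_norm_l2n by linarith
  show "Hop f g \<in> Y_sp \<sigma> (n + 2)"
    unfolding Y_sp_iff using l2_mono(1)[OF l mu_nonneg le] harm_sob(1)[OF n] by (auto simp: Hop_def)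
qed

lemma blin_Hop:
  assumes n: "0 < n"
  shows "blin (D_sp \<sigma> (n + 2)) D_scale (D_norm \<sigma> (n + 2)) (Y_sp \<sigma> (n + 2)) Y_scale (Y_norm \<sigma> (n + 2)) (\<lambda>u. Hop (fst u) (fst (snd u)))"
  unfolding blin_def
proof (intro conjI ballI allI)
  show "\<exists>K\<ge>0. \<forall>u\<in>D_sp \<sigma> (n + 2). Y_norm \<sigma> (n + 2) (Hop (fst u) (fst (snd u))) \<le> K * D_norm \<sigma> (n + 2) u"
  proof (intro exI[of _ "2 * CG n"] conjI ballI)
    fix u assume "u \<in> D_sp \<sigma> (n + 2)"
    then obtain f g F where u: "u = (f, g, F)" "f \<in> X_sp \<sigma> (real (n + 2) - 1/2)" "g \<in> X_sp \<sigma> (real (n + 2) - 1/2)"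
      by (auto simp: D_sp_def)
    have "Y_norm \<sigma> (n + 2) (Hop f g) \<le> 2 * CG n * (X_norm \<sigma> (real (n + 2) - 1/2) f + X_norm \<sigma> (real (n + 2) - 1/2) g)"
      by (rule Hop_Y(2)[OF n u(2,3)])
    also have "\<dots> \<le> 2 * CG n * D_norm \<sigma> (n + 2) u"
      using CG_nonneg[of n] by (intro mult_left_mono) (auto simp: D_norm_def u(1) H_norm_nu)
    finally show "Y_norm \<sigma> (n + 2) (Hop (fst u) (fst (snd u))) \<le> 2 * CG n * D_norm \<sigma> (n + 2) u" by (simp add: u(1))
  qed (simp add: CG_nonneg)
  show "Hop (fst u) (fst (snd u)) \<in> Y_sp \<sigma> (n + 2)" if "u \<in> D_sp \<sigma> (n + 2)" for u
    using that by (intro Hop_Y(1)[OF n]) (auto simp: D_sp_def)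
qed (auto simp: Hop_def harm_add harm_scale D_scale_def Y_scale_def fun_eq_iff split: prod.split)

lemma blin_emb: "blin (D_sp \<sigma> (n + 2)) D_scale (D_norm \<sigma> (n + 2)) (Y_sp \<sigma> n) Y_scale (Y_norm \<sigma> n) (\<lambda>u. emb (snd (snd u)))"
  unfolding blin_def
proof (intro conjI ballI allI)
  show "\<exists>K\<ge>0. \<forall>u\<in>D_sp \<sigma> (n + 2). Y_norm \<sigma> n (emb (snd (snd u))) \<le> K * D_norm \<sigma> (n + 2) u"
  proof (intro exI[of _ 1] conjI ballI)
    fix u assume "u \<in> D_sp \<sigma> (n + 2)"
    then have "Y_norm \<sigma> n (emb (snd (snd u))) \<le> H_norm n (snd (snd u))"
      by (intro emb_Y(2)) (auto simp: D_sp_def)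
    also have "\<dots> \<le> 1 * D_norm \<sigma> (n + 2) u" by (cases u) (auto simp: D_norm_def X_norm_l2n)
    finally show "Y_norm \<sigma> n (emb (snd (snd u))) \<le> 1 * D_norm \<sigma> (n + 2) u" .
  qed simp
  show "emb (snd (snd u)) \<in> Y_sp \<sigma> n" if "u \<in> D_sp \<sigma> (n + 2)" for u
    using that by (intro emb_Y(1)) (auto simp: D_sp_def)
qed (auto simp: emb_def D_scale_def Y_scale_def fun_eq_iff split: prod.split)

subsection \<open>The boundary value problem as a fixed point equation\<close>

text \<open>Hides the derivative, so that the closure rules can be chained over the terms of
  \<open>Quad\<close>.\<close>

definition ex_good ::
  "'z::ab_group_add set \<Rightarrow> (complex \<Rightarrow> 'z \<Rightarrow> 'z) \<Rightarrow> ('z \<Rightarrow> real) \<Rightarrow> 'a::ab_group_add set \<Rightarrow> (complex \<Rightarrow> 'a \<Rightarrow> 'a) \<Rightarrow> ('a \<Rightarrow> real)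
     \<Rightarrow> nat \<Rightarrow> ('z \<Rightarrow> 'a) \<Rightarrow> bool" where
  "ex_good Z sZ nZ A sA nA e M \<longleftrightarrow> (\<exists>M'. good Z sZ nZ A sA nA e M M')"

text \<open>Expand (1 + q)^3 F + (1 + q)^2 r - 2 p (1 + q) s + (1 + p^2) v = 0, keep r + v on the
  left and move everything else to the right; this is what remains there besides - F.\<close>

definition Quad :: "(int \<Rightarrow> real \<Rightarrow> complex) \<Rightarrow> (int \<Rightarrow> real \<Rightarrow> complex) \<Rightarrow> int \<Rightarrow> real \<Rightarrow> complex" where
  "Quad F w = (let p = Xd w; q = Pd w; r = Xd (Xd w); s = Pd (Xd w); v = Pd (Pd w) in
     conv (Y_scale (-3) F) q + conv (Y_scale (-3) F) (conv q q) + conv (Y_scale (-1) F) (conv q (conv q q))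
     + conv (Y_scale (-2) q) r + conv (Y_scale (-1) q) (conv q r)
     + conv (Y_scale 2 p) s + conv (Y_scale 2 p) (conv q s) + conv (Y_scale (-1) p) (conv p v))"

context
  fixes n :: nat and \<sigma> :: real
  assumes n2: "2 \<le> n" and \<sigma>0: "0 \<le> \<sigma>"
begin

lemma derivs_Y:
  assumes w: "w \<in> Y_sp \<sigma> (n + 2)"
  shows "Xd w \<in> Y_sp \<sigma> (Suc n)" "Pd w \<in> Y_sp \<sigma> (Suc n)" "Xd w \<in> Y_sp \<sigma> n" "Pd w \<in> Y_sp \<sigma> n"
    "Xd (Xd w) \<in> Y_sp \<sigma> n" "Pd (Xd w) \<in> Y_sp \<sigma> n" "Pd (Pd w) \<in> Y_sp \<sigma> n"
proof -
  have w': "w \<in> Y_sp \<sigma> (Suc (Suc n))" using w by simp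
  show 1: "Xd w \<in> Y_sp \<sigma> (Suc n)" by (rule Xd_Y(1)[OF w'])
  show 2: "Pd w \<in> Y_sp \<sigma> (Suc n)" by (rule Pd_Y(1)[OF w']) simp
  show "Xd w \<in> Y_sp \<sigma> n" "Pd w \<in> Y_sp \<sigma> n" by (rule restrict_Y(1)[OF 1], rule restrict_Y(1)[OF 2])
  show "Xd (Xd w) \<in> Y_sp \<sigma> n" by (rule Xd_Y(1)[OF 1])
  show "Pd (Xd w) \<in> Y_sp \<sigma> n" "Pd (Pd w) \<in> Y_sp \<sigma> n"
    using Pd_Y(1)[OF 1] Pd_Y(1)[OF 2] n2 by auto
qed

lemma conv_in: "a \<in> Y_sp \<sigma> n \<Longrightarrow> b \<in> Y_sp \<sigma> n \<Longrightarrow> conv a b \<in> Y_sp \<sigma> n"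
  by (rule conv_bound(1)[OF _ _ n2 \<sigma>0])

lemma Quad_Y:
  assumes "F \<in> Y_sp \<sigma> n" "w \<in> Y_sp \<sigma> (n + 2)" shows "Quad F w \<in> Y_sp \<sigma> n"
  unfolding Quad_def Let_def
  by (intro Y_sp_add(1) conv_in Y_sp_scale(1) derivs_Y[OF assms(2)] assms(1))

lemma yfun_Quad:
  fixes x t :: real
  assumes F: "F \<in> Y_sp \<sigma> n" and w: "w \<in> Y_sp \<sigma> (n + 2)"
  defines "p \<equiv> yfun (Xd w) x t" and "q \<equiv> yfun (Pd w) x t" and "r \<equiv> yfun (Xd (Xd w)) x t"
    and "s \<equiv> yfun (Pd (Xd w)) x t" and "v \<equiv> yfun (Pd (Pd w)) x t" and "f \<equiv> yfun F x t"
  shows "yfun (Quad F w) x t = - 3 * f * q - 3 * f * (q * q) - f * (q * (q * q)) - 2 * q * r - q * (q * r)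
      + 2 * p * s + 2 * p * (q * s) - p * (p * v)"
proof -
  note D = derivs_Y(3-)[OF w]
  have A: "yfun (a + b) x t = yfun a x t + yfun b x t" if "a \<in> Y_sp \<sigma> n" "b \<in> Y_sp \<sigma> n" for a b
    by (rule yfun_add[OF that n2 \<sigma>0])
  have C: "yfun (conv a b) x t = yfun a x t * yfun b x t" if "a \<in> Y_sp \<sigma> n" "b \<in> Y_sp \<sigma> n" for a b
    by (rule yfun_conv[OF that n2 \<sigma>0])
  show ?thesis
    unfolding Quad_def Let_def p_def q_def r_def s_def v_def f_def
    by (simp add: A C D F Y_sp_add Y_sp_scale conv_in yfun_scale)
qed

abbreviation (input) "YA \<equiv> Y_sp \<sigma> n"
abbreviation (input) "nA \<equiv> Y_norm \<sigma> n"
abbreviation (input) "YY \<equiv> Y_sp \<sigma> (n + 2)"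
abbreviation (input) "nY \<equiv> Y_norm \<sigma> (n + 2)"
abbreviation (input) "DD \<equiv> D_sp \<sigma> (n + 2)"
abbreviation (input) "nD \<equiv> D_norm \<sigma> (n + 2)"
abbreviation (input) "ZZ \<equiv> DD \<times> YY"
abbreviation (input) "sZ \<equiv> prodsc D_scale Y_scale"
abbreviation (input) "nZ \<equiv> prodnm nD nY"
abbreviation (input) "smooth_ord e M \<equiv> ex_good ZZ sZ nZ YA Y_scale nA e M"

lemma cnorm_Z: "cnorm ZZ sZ nZ"
  by (intro cnorm_prod cnorm_D cnorm_Y)

lemma smooth_ord_blin: "blin ZZ sZ nZ YA Y_scale nA L \<Longrightarrow> smooth_ord 0 L"
  using good_blin[OF cnorm_Z cnorm_Y] unfolding ex_good_def by blast

lemma smooth_ord_weaken: "smooth_ord 1 M \<Longrightarrow> smooth_ord 0 M"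
  using good_weaken[OF cnorm_Z] unfolding ex_good_def by blast

lemma smooth_ord_add: "smooth_ord e M \<Longrightarrow> smooth_ord e N \<Longrightarrow> smooth_ord e (\<lambda>z. M z + N z)"
  using good_add[OF cnorm_Z cnorm_Y] unfolding ex_good_def by blast

lemma smooth_ord_mult: "smooth_ord 0 M \<Longrightarrow> smooth_ord 0 N \<Longrightarrow> smooth_ord 1 (\<lambda>z. conv (M z) (N z))"
  using bilinear_product.good_mult[OF product_Y[OF n2 \<sigma>0] cnorm_Z] unfolding ex_good_def by blast

text \<open>Every term is an iterated product of bounded linear maps. Weakening an inner product to
  order 0 lets it serve as a factor of an outer one.\<close>

lemma smooth_ord_Quad: "smooth_ord 1 (\<lambda>z. Quad (emb (snd (snd (fst z)))) (snd z))"
proof -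
  have n0: "0 < n" using n2 by simp
  note w = blin_snd[OF cnorm_D[of \<sigma> n], of "YY" Y_scale nY, unfolded add_2_eq_Suc']
  have F: "blin ZZ sZ nZ YA Y_scale nA (\<lambda>z. emb (snd (snd (fst z))))"
    by (rule blin_comp[OF blin_fst[OF cnorm_Y] blin_emb])
  have p1: "blin ZZ sZ nZ (Y_sp \<sigma> (Suc n)) Y_scale (Y_norm \<sigma> (Suc n)) (\<lambda>z. Xd (snd z))"
    unfolding add_2_eq_Suc' by (rule blin_comp[OF w blin_Xd])
  have q1: "blin ZZ sZ nZ (Y_sp \<sigma> (Suc n)) Y_scale (Y_norm \<sigma> (Suc n)) (\<lambda>z. Pd (snd z))"
    unfolding add_2_eq_Suc' by (rule blin_comp[OF w blin_Pd]) simp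
  note p = blin_comp[OF p1 blin_restrict] and q = blin_comp[OF q1 blin_restrict]
  note r = blin_comp[OF p1 blin_Xd] and s = blin_comp[OF p1 blin_Pd[OF n0]] and v = blin_comp[OF q1 blin_Pd[OF n0]]
  note sc = blin_comp[OF _ blin_Y_scale]
  show ?thesis
    unfolding Quad_def Let_def
    by (intro smooth_ord_add smooth_ord_mult smooth_ord_weaken[OF smooth_ord_mult] smooth_ord_blin p q r s v F sc[OF p] sc[OF q] sc[OF F])
qed

lemma D1_D1_add:
  assumes "f \<in> sob_H (n + 2)" "g \<in> sob_H (n + 2)"
  shows "D1 (D1 (\<lambda>t. f t + g t)) = (\<lambda>t. D1 (D1 f) t + D1 (D1 g) t)"
  using assms n2 D1_add[of f "Suc (Suc n)" g] D1_add[OF D1_sob_H(1)[of f "Suc n"] D1_sob_H(1)[of g "Suc n"]] by simp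

text \<open>For the converse, the harmonic extension is subtracted from w; the difference has zero
  boundary values and equals the Dirichlet solution by uniqueness.\<close>

lemma fixed_point_iff:
  assumes w: "w \<in> YY" and R: "R \<in> YA"
  shows "w = Hop f g + Gop n R \<longleftrightarrow> (\<forall>k. w k 0 = f k \<and> w k 1 = g k \<and>
     (\<forall>t\<in>{0..1}. Pd (Pd w) k t = of_real ((real_of_int k)^2) * w k t + R k t))"
proof -
  have n0: "0 < n" using n2 by simp
  note RH = Y_sp_mode[OF R] and wH = Y_sp_mode[OF w] and hH = harm_sob(1)[OF n0]
  note hD = harm_sob(3)[OF n0]
  have "w = Hop f g + Gop n R \<longleftrightarrow> (\<forall>k. w k = (\<lambda>t. harm k (f k) (g k) t + dirichlet n k (R k) t))"
    by (auto simp: fun_eq_iff Hop_def Gop_def)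
  also have "\<dots> \<longleftrightarrow> (\<forall>k. w k 0 = f k \<and> w k 1 = g k \<and>
     (\<forall>t\<in>{0..1}. Pd (Pd w) k t = of_real ((real_of_int k)^2) * w k t + R k t))"
  proof (intro iff_allI iffI)
    fix k
    have d: "is_dirichlet n k (R k) (dirichlet n k (R k))" by (rule dirichlet[OF RH n0])
    assume e: "w k = (\<lambda>t. harm k (f k) (g k) t + dirichlet n k (R k) t)"
    have "D1 (D1 (w k)) t = of_real ((real_of_int k)^2) * w k t + R k t" if "t \<in> {0..1}" for t
      using D1_D1_add[OF hH, of "dirichlet n k (R k)" k "f k" "g k"] d that hD[OF that, of k "f k" "g k"]
      by (simp add: e is_dirichlet_def distrib_left)
    then show "w k 0 = f k \<and> w k 1 = g k \<and> (\<forall>t\<in>{0..1}. Pd (Pd w) k t = of_real ((real_of_int k)^2) * w k t + R k t)"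
      using d by (auto simp: Pd_def e is_dirichlet_def)
  next
    fix k
    assume a: "w k 0 = f k \<and> w k 1 = g k \<and> (\<forall>t\<in>{0..1}. Pd (Pd w) k t = of_real ((real_of_int k)^2) * w k t + R k t)"
    define y where "y = (\<lambda>t. w k t + harm k (- f k) (- g k) t)"
    have yH: "y \<in> sob_H (n + 2)" unfolding y_def by (intro sob_H_add(1) wH hH)
    have "D1 (D1 y) t = of_real ((real_of_int k)^2) * y t + R k t" if "t \<in> {0..1}" for t
      using D1_D1_add[OF wH hH, of k k "- f k" "- g k"] a that hD[OF that, of k "- f k" "- g k"]
      unfolding y_def Pd_def by (simp add: distrib_left)
    then have "is_dirichlet n k (R k) y" using yH a by (simp add: is_dirichlet_def y_def)
    then have "dirichlet n k (R k) = y" by (rule dirichlet_eq[OF _ n0])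
    then show "w k = (\<lambda>t. harm k (f k) (g k) t + dirichlet n k (R k) t)"
      using harm_scale[of k "-1" "f k" "g k"] by (simp add: y_def fun_eq_iff)
  qed
  finally show ?thesis .
qed

text \<open>The boundary value problem gives information at interior t only; density extends it to
  the end points, where \<open>is_dirichlet\<close> also demands the equation.\<close>

lemma closed_interval_eqI:
  fixes f g :: "real \<Rightarrow> complex"
  assumes "continuous_on {0..1} f" "continuous_on {0..1} g" "\<And>t. t \<in> {0<..<1} \<Longrightarrow> f t = g t" "t \<in> {0..1}"
  shows "f t = g t"
proof -
  have "f t - g t = 0"
    by (rule continuous_constant_on_closure[where S = "{0<..<1}" and f = "\<lambda>t. f t - g t"])
      (use assms in \<open>auto intro!: continuous_intros\<close>)
  then show ?thesis by simp
qed

text \<open>Applying \<open>Xd\<close> twice multiplies mode k by - k^2. Fourier uniqueness at each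
  interior t turns the equation into its modes.\<close>

lemma laplace_iff:
  assumes w: "w \<in> YY" and R: "R \<in> YA"
  shows "(\<forall>k. \<forall>t\<in>{0..1}. Pd (Pd w) k t = of_real ((real_of_int k)^2) * w k t + R k t)
    \<longleftrightarrow> (\<forall>x. \<forall>t\<in>{0<..<1}. yfun (Xd (Xd w)) x t + yfun (Pd (Pd w)) x t = yfun R x t)"
proof -
  have n0: "0 < n" using n2 by simp
  note D = derivs_Y[OF w]
  let ?L = "Xd (Xd w) + Pd (Pd w)"
  have LY: "?L \<in> YA" by (intro Y_sp_add D)
  have Xw: "Xd (Xd w) k t = - of_real ((real_of_int k)^2) * w k t" for k t
  proof -
    have "\<i> * K * (\<i> * K * z) = (\<i> * \<i>) * (K * K * z)" for K z by (simp only: mult_ac)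
    then show ?thesis by (simp add: Xd_def power2_eq_square)
  qed
  have mode: "Pd (Pd w) k t = of_real ((real_of_int k)^2) * w k t + R k t \<longleftrightarrow> ?L k t = R k t" for k t
    unfolding plus_fun_apply Xw by (auto simp: algebra_simps)
  have sum: "yfun (Xd (Xd w)) x t + yfun (Pd (Pd w)) x t = yfun ?L x t" for x t
    by (rule yfun_add[OF D(5,7) n2 \<sigma>0, symmetric])
  show ?thesis
    unfolding mode sum
  proof (intro iffI allI ballI)
    fix x t :: real assume a: "\<forall>k. \<forall>t\<in>{0..1}. ?L k t = R k t" and t: "t \<in> {0<..<1}"
    have "?L k t = R k t" for k using a t by auto
    then show "yfun ?L x t = yfun R x t" by (simp only: yfun_def)
  next
    fix k and t :: real assume a: "\<forall>x. \<forall>t\<in>{0<..<1}. yfun ?L x t = yfun R x t" and t: "t \<in> {0..1}"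
    show "?L k t = R k t"
    proof (rule closed_interval_eqI[OF _ _ _ t])
      show "continuous_on {0..1} (?L k)" "continuous_on {0..1} (R k)"
        by (rule sob_H_continuous[OF Y_sp_mode[OF LY] n0], rule sob_H_continuous[OF Y_sp_mode[OF R] n0])
      show "?L k s = R k s" if "s \<in> {0<..<1}" for s
        by (rule yfun_unique[OF LY R n2 \<sigma>0]) (use a that in blast)
    qed
  qed
qed

lemma boundary_iff:
  assumes b: "b \<in> YY" and f: "f \<in> X_sp \<sigma> (real (n + 2) - 1/2)"
  shows "(\<forall>x. yfun b x t = xfun f x) \<longleftrightarrow> (\<forall>k. b k t = f k)"
proof
  assume a: "\<forall>x. yfun b x t = xfun f x"
  show "\<forall>k. b k t = f k"
  proof
    fix k
    have n2': "2 \<le> n + 2" by simp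
    have fs: "(\<lambda>k. cmod (f k)) summable_on UNIV" by (rule X_abs_summable[OF f]) (use n2 \<sigma>0 in auto)
    have fs': "(\<lambda>k. f k * cis (real_of_int k * x)) summable_on UNIV" for x
    proof -
      have "(\<lambda>k. cmod (f k * cis (real_of_int k * x))) = (\<lambda>k. cmod (f k))" by (intro ext) (simp add: norm_mult)
      then have "(\<lambda>k. cmod (f k * cis (real_of_int k * x))) summable_on UNIV" using fs by (simp only:)
      then show ?thesis by (rule Infinite_Sum.abs_summable_summable)
    qed
    have "b k t + (-1) * f k = 0"
    proof (rule fourier_unique)
      show "(\<lambda>k. cmod (b k t + (-1) * f k)) summable_on UNIV"
        by (rule Infinite_Sum.abs_summable_on_comparison_test'[OF summable_on_add[OF Y_abs_summable(1)[OF b n2' \<sigma>0, of t] fs]])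
          (simp add: norm_triangle_ineq4)
      fix x
      have "(\<Sum>\<^sub>\<infinity>k. (b k t + (-1) * f k) * cis (real_of_int k * x)) = (\<Sum>\<^sub>\<infinity>k. b k t * cis (real_of_int k * x) + (-1) * (f k * cis (real_of_int k * x)))"
        by (intro infsum_cong) (simp add: algebra_simps)
      also have "\<dots> = yfun b x t + (-1) * xfun f x"
        unfolding yfun_def xfun_def infsum_cmult_right'[symmetric]
        by (rule infsum_add[OF Y_abs_summable(3)[OF b n2' \<sigma>0] summable_on_cmult_right[OF fs']])
      finally show "(\<Sum>\<^sub>\<infinity>k. (b k t + (-1) * f k) * cis (real_of_int k * x)) = 0" using a by simp
    qed
    then show "b k t = f k" by simp
  qed
qed (simp add: yfun_def xfun_def)

text \<open>The unperturbed solution is the harmonic extension of its own boundary values, which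
  settles its membership in Y.\<close>

lemma a0_eq_Hop: "a0 = Hop 0 (\<lambda>k. if k = 0 then 1 else 0)"
  by (auto simp: a0_def Hop_def harm_def fun_eq_iff si_def)

lemma a0_Y: "a0 \<in> YY"
  unfolding a0_eq_Hop using n2 by (intro Hop_Y(1) X_sp_single cnorm.zero[OF cnorm_X]) simp

lemma Xd_a0: "Xd a0 = 0"
  by (auto simp: Xd_def a0_def fun_eq_iff)

lemma Pd_a0: "Pd a0 = emb (\<lambda>t. if t \<in> {0..1} then 1 else 0)"
proof (intro ext)
  fix k t
  show "Pd a0 k t = emb (\<lambda>t. if t \<in> {0..1} then 1 else 0) k t"
  proof (cases "t \<in> {0..1}")
    case True
    have "(a0 k has_vector_derivative (if k = 0 then 1 else 0)) (at t within {0..1})"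
    proof (rule has_vector_derivative_transform[OF True])
      show "a0 k s = (if k = 0 then of_real s else 0)" if "s \<in> {0..1}" for s using that by (auto simp: a0_def)
      show "((\<lambda>s. if k = 0 then complex_of_real s else 0) has_vector_derivative (if k = 0 then 1 else 0)) (at t within {0..1})"
      proof (cases "k = 0")
        case True
        have "((\<lambda>s. of_real s :: complex) has_vector_derivative of_real 1) (at t within {0..1})"
          by (intro has_vector_derivative_of_real) simp
        then show ?thesis using True by simp
      qed simp
    qed
    then show ?thesis using True D1_eq[OF _ True] by (simp add: Pd_def emb_def)
  qed (auto simp: Pd_def emb_def)
qed

lemma Pd_Pd_a0: "Pd (Pd a0) = 0"
proof (intro ext)
  fix k t
  show "Pd (Pd a0) k t = 0 k t"
  proof (cases "t \<in> {0..1}")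
    case True
    have "(Pd a0 k has_vector_derivative 0) (at t within {0..1})"
      by (rule has_vector_derivative_transform[OF True _ has_vector_derivative_const[of "if k = 0 then 1 else 0"]])
        (auto simp: Pd_a0 emb_def)
    then show ?thesis using D1_eq[OF _ True] by (simp add: Pd_def)
  qed (auto simp: Pd_def)
qed

text \<open>The base function contributes only the 1 in 1 + q: its x-derivative and its second
  \<psi>-derivative vanish.\<close>

lemma Phi_yfun:
  fixes x t :: real
  assumes w: "w \<in> YY" and t: "t \<in> {0<..<1}"
  defines "p \<equiv> yfun (Xd w) x t" and "q \<equiv> yfun (Pd w) x t" and "r \<equiv> yfun (Xd (Xd w)) x t"
    and "s \<equiv> yfun (Pd (Xd w)) x t" and "v \<equiv> yfun (Pd (Pd w)) x t"
  shows "Phi (yfun (a0 + w)) x t = - (1 / (1 + q)) * r + (2 * p / (1 + q)^2) * s - ((1 + p^2) / (1 + q)^3) * v"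
proof -
  note D = derivs_Y[OF w]
  have b: "a0 + w \<in> Y_sp \<sigma> (Suc (Suc n))" using Y_sp_add(1)[OF a0_Y w] by simp
  have n1: "2 \<le> Suc n" using n2 by simp
  have X: "Xd (a0 + w) = Xd w"
  proof -
    have "Xd (a0 + w) = Xd a0 + Xd w" by (simp add: Xd_def fun_eq_iff distrib_left)
    then show ?thesis by (simp add: Xd_a0)
  qed
  have Padd: "Pd (a + c) = Pd a + Pd c" if "a \<in> Y_sp \<sigma> (Suc j)" "c \<in> Y_sp \<sigma> (Suc j)" "0 < j" for a c j
    using blin_Pd[OF that(3), of \<sigma>] that(1,2) unfolding blin_def by blast
  have P: "Pd (a0 + w) = Pd a0 + Pd w" using a0_Y w by (intro Padd[of _ "Suc n"]) auto
  have PP: "Pd (Pd (a0 + w)) = Pd (Pd w)"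
    unfolding P using Padd[OF derivs_Y(2)[OF a0_Y] D(2)] n2 by (simp add: Pd_Pd_a0)
  have P1: "yfun (Pd (a0 + w)) x t = 1 + q"
    unfolding P q_def yfun_add[OF derivs_Y(4)[OF a0_Y] D(4) n2 \<sigma>0] using t by (simp add: Pd_a0 yfun_emb)
  have 1: "dx (yfun (a0 + w)) = yfun (Xd w)" using dx_yfun[OF b n1 \<sigma>0] X by simp
  have 2: "dx (yfun (Xd w)) = yfun (Xd (Xd w))" by (rule dx_yfun[OF D(1) n2 \<sigma>0])
  have 3: "dpsi (yfun (a0 + w)) x t = 1 + q" using dpsi_yfun(2)[OF b n1 \<sigma>0 t] P1 by simp
  have 4: "dpsi (yfun (Xd w)) x t = s" unfolding s_def by (rule dpsi_yfun(2)[OF D(1) n2 \<sigma>0 t])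
  have 5: "dpsi (dpsi (yfun (a0 + w))) x t = v" unfolding v_def dpsi_dpsi_yfun[OF b n2 \<sigma>0 t] PP ..
  show ?thesis unfolding Phi_def 1 2 3 4 5 by (simp add: p_def r_def)
qed

text \<open>Multiplication by \<open>(1 + q)\<^sup>3\<close> turns the quasilinear equation into Poisson's equation with a polynomial right hand side.\<close>

lemma Phi_algebra:
  fixes p q r s v F :: complex
  assumes "1 + q \<noteq> 0"
  shows "- (1 / (1 + q)) * r + (2 * p / (1 + q)^2) * s - ((1 + p^2) / (1 + q)^3) * v = F \<longleftrightarrow>
    r + v = - F + (- 3 * F * q - 3 * F * (q * q) - F * (q * (q * q)) - 2 * q * r - q * (q * r)
      + 2 * p * s + 2 * p * (q * s) - p * (p * v))"
proof -
  define d where "d = 1 + q"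
  have d: "d \<noteq> 0" using assms by (auto simp: d_def)
  define X where "X = - (d^2 * r) + 2 * p * d * s - (1 + p^2) * v"
  have "- (1 / d) * r + (2 * p / d^2) * s - ((1 + p^2) / d^3) * v = X / d^3"
    using d by (simp add: X_def field_simps power2_eq_square power3_eq_cube)
  then have e1: "- (1 / d) * r + (2 * p / d^2) * s - ((1 + p^2) / d^3) * v = F \<longleftrightarrow> X - F * d^3 = 0"
    using d by (simp add: divide_eq_eq)
  let ?T = "- F + (- 3 * F * q - 3 * F * (q * q) - F * (q * (q * q)) - 2 * q * r - q * (q * r)
      + 2 * p * s + 2 * p * (q * s) - p * (p * v))"
  have e2: "X - F * d^3 = - (r + v - ?T)"
    unfolding X_def d_def by (simp add: algebra_simps power2_eq_square power3_eq_cube)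
  show ?thesis
    using e1 unfolding e2 neg_equal_0_iff_equal right_minus_eq unfolding d_def .
qed

text \<open>The equivalence holds for every w with |q| < 1, so uniqueness of the fixed point becomes
  uniqueness for the original problem.\<close>

lemma solves_bvp_iff:
  assumes f: "f \<in> X_sp \<sigma> (real (n + 2) - 1/2)" and g: "g \<in> X_sp \<sigma> (real (n + 2) - 1/2)" and F: "F \<in> sob_H n"
    and w: "w \<in> YY" and small: "\<And>x t. cmod (yfun (Pd w) x t) < 1"
  shows "solves_bvp (a0 + w) (f, g, F) \<longleftrightarrow>
    w = Hop f (g - (\<lambda>k. if k = 0 then 1 else 0)) + Gop n (Y_scale (-1) (emb F) + Quad (emb F) w)"
proof -
  let ?R = "Y_scale (-1) (emb F) + Quad (emb F) w"
  have EY: "emb F \<in> YA" by (rule emb_Y(1)[OF F])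
  have RY: "?R \<in> YA" by (intro Y_sp_add(1) Y_sp_scale(1) EY Quad_Y w)
  have bY: "a0 + w \<in> YY" by (intro Y_sp_add(1) a0_Y w)
  have nz: "1 + yfun (Pd w) x t \<noteq> 0" for x t
  proof
    assume "1 + yfun (Pd w) x t = 0"
    then have "yfun (Pd w) x t = -1" by (simp add: add_eq_0_iff)
    then show False using small[of x t] by simp
  qed
  have eq: "Phi (yfun (a0 + w)) x t = F t \<longleftrightarrow> yfun (Xd (Xd w)) x t + yfun (Pd (Pd w)) x t = yfun ?R x t"
    if "t \<in> {0<..<1}" for x t
    unfolding Phi_yfun[OF w that] Phi_algebra[OF nz]
      yfun_add[OF Y_sp_scale(1)[OF EY] Quad_Y[OF EY w] n2 \<sigma>0] yfun_scale yfun_Quad[OF EY w] yfun_emb by simp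
  have "solves_bvp (a0 + w) (f, g, F) \<longleftrightarrow>
     (\<forall>x. \<forall>t\<in>{0<..<1}. yfun (Xd (Xd w)) x t + yfun (Pd (Pd w)) x t = yfun ?R x t) \<and>
     (\<forall>k. (a0 + w) k 0 = f k) \<and> (\<forall>k. (a0 + w) k 1 = g k)"
    unfolding solves_bvp_def boundary_iff[OF bY f, symmetric] boundary_iff[OF bY g, symmetric] using eq by auto
  also have "\<dots> \<longleftrightarrow> (\<forall>k. w k 0 = f k \<and> w k 1 = (g - (\<lambda>k. if k = 0 then 1 else 0)) k \<and>
     (\<forall>t\<in>{0..1}. Pd (Pd w) k t = of_real ((real_of_int k)^2) * w k t + ?R k t))"
    unfolding laplace_iff[OF w RY, symmetric] by (auto simp: a0_def algebra_simps)
  also have "\<dots> \<longleftrightarrow> w = Hop f (g - (\<lambda>k. if k = 0 then 1 else 0)) + Gop n ?R"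
    by (rule fixed_point_iff[OF w RY, symmetric])
  finally show ?thesis .
qed

definition "Csmall = 4 * l2n wt * (card (PQ (Suc n)))"

lemma yfun_Pd_bound:
  assumes "w \<in> YY" shows "cmod (yfun (Pd w) x t) \<le> Csmall * nY w"
proof -
  have "Pd w \<in> Y_sp \<sigma> (Suc n)" "Y_norm \<sigma> (Suc n) (Pd w) \<le> card (PQ (Suc n)) * nY w"
    using Pd_Y[of w \<sigma> "Suc n"] assms by auto
  then have "cmod (yfun (Pd w) x t) \<le> 4 * l2n wt * Y_norm \<sigma> (Suc n) (Pd w)"
    using n2 \<sigma>0 by (intro yfun_bound) auto
  also have "\<dots> \<le> 4 * l2n wt * (card (PQ (Suc n)) * nY w)"
    using \<open>Y_norm \<sigma> (Suc n) (Pd w) \<le> card (PQ (Suc n)) * nY w\<close> by (intro mult_left_mono) auto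
  finally show ?thesis by (simp add: Csmall_def mult.assoc)
qed

lemma data0_D: "data0 \<in> DD"
  using cnorm.zero[OF cnorm_X] cnorm.zero[OF cnorm_H, of n] X_sp_single[of 1 \<sigma> "real (n + 2) - 1/2"]
  by (auto simp: data0_def D_sp_def zero_fun_def)

text \<open>\<open>S\<close> takes the deviation of the data from \<open>data0\<close>, which moves
  the base point to the origin as the fixed point theorem requires.\<close>

lemma local_solution:
  obtains \<rho> \<delta> S where "0 < \<rho> \<and> 0 < \<delta>"
    "\<And>u. u \<in> DD \<Longrightarrow> nD (u - data0) < \<delta> \<Longrightarrow> S (u - data0) \<in> YY \<and> nY (S (u - data0)) \<le> \<rho> \<and> solves_bvp (a0 + S (u - data0)) u"
    "\<And>u w. u \<in> DD \<Longrightarrow> nD (u - data0) < \<delta> \<Longrightarrow> w \<in> YY \<Longrightarrow> nY w \<le> \<rho> \<Longrightarrow> solves_bvp (a0 + w) u \<Longrightarrow> w = S (u - data0)"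
    "\<And>u. u \<in> DD \<Longrightarrow> nD u < \<delta> \<Longrightarrow> \<exists>S'. blin DD D_scale nD YY Y_scale nY S' \<and>
       (\<exists>K\<ge>0. \<forall>h\<in>DD. nD (u + h) < \<delta> \<longrightarrow> nY (S (u + h) - S u - S' h) \<le> K * (nD h)^2)"
proof -
  have n0: "0 < n" using n2 by simp
  interpret D: cnorm DD D_scale nD by (rule cnorm_D)
  obtain Q' where Q': "good ZZ sZ nZ YA Y_scale nA 1 (\<lambda>z. Quad (emb (snd (snd (fst z)))) (snd z)) Q'"
    using smooth_ord_Quad unfolding ex_good_def by blast
  define L where "L = (\<lambda>u::data. Hop (fst u) (fst (snd u)) + Gop n (Y_scale (-1) (emb (snd (snd u)))))"
  define M where "M = (\<lambda>z::data \<times> (int \<Rightarrow> real \<Rightarrow> complex). Gop n (Quad (emb (snd (snd (fst z)))) (snd z)))"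
  have M: "good ZZ sZ nZ YY Y_scale nY 1 M (\<lambda>z h. Gop n (Q' z h))"
    unfolding M_def by (rule good_post[OF cnorm_Z cnorm_Y cnorm_Y Q' blin_Gop[OF n0]])
  have L: "blin DD D_scale nD YY Y_scale nY L"
    unfolding L_def
    by (rule blin_add[OF cnorm_Y blin_Hop[OF n0] blin_comp[OF blin_comp[OF blin_emb blin_Y_scale] blin_Gop[OF n0]]])
  have banach: "banach_carrier YY Y_scale nY" by (rule banach_Y[OF _ \<sigma>0]) simp
  have C0: "0 \<le> Csmall" by (simp add: Csmall_def)
  \<comment> \<open>A ball of this radius forces |q| < 1 by \<open>yfun_Pd_bound\<close>; the added
    1 also avoids a zero denominator.\<close>
  then have \<rho>0: "0 < 1 / (Csmall + 1)" by simp
  obtain \<rho> \<delta> S where S: "0 < \<rho>" "\<rho> \<le> 1 / (Csmall + 1)" "0 < \<delta>"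
    "\<And>u. u \<in> DD \<Longrightarrow> nD u < \<delta> \<Longrightarrow> S u \<in> YY \<and> nY (S u) \<le> \<rho> \<and> S u = L u + M (u, S u)"
    "\<And>u w. u \<in> DD \<Longrightarrow> nD u < \<delta> \<Longrightarrow> w \<in> YY \<Longrightarrow> nY w \<le> \<rho> \<Longrightarrow> w = L u + M (u, w) \<Longrightarrow> w = S u"
    "\<And>u. u \<in> DD \<Longrightarrow> nD u < \<delta> \<Longrightarrow> \<exists>S'. blin DD D_scale nD YY Y_scale nY S' \<and>
       (\<exists>K\<ge>0. \<forall>h\<in>DD. nD (u + h) < \<delta> \<longrightarrow> nY (S (u + h) - S u - S' h) \<le> K * (nD h)^2)"
    by (rule quadratic_fixed_point[OF cnorm_D banach L M \<rho>0]) (rule that)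
  have bvp: "solves_bvp (a0 + w) u \<longleftrightarrow> w = L (u - data0) + M (u - data0, w)"
    if u: "u \<in> DD" and w: "w \<in> YY" "nY w \<le> \<rho>" for u w
  proof -
    obtain f g F where fgF: "u = (f, g, F)" "f \<in> X_sp \<sigma> (real (n + 2) - 1/2)" "g \<in> X_sp \<sigma> (real (n + 2) - 1/2)" "F \<in> sob_H n"
      using u by (auto simp: D_sp_def)
    have small: "cmod (yfun (Pd w) x t) < 1" for x t
    proof -
      have "cmod (yfun (Pd w) x t) \<le> Csmall * nY w" by (rule yfun_Pd_bound[OF w(1)])
      also have "\<dots> \<le> Csmall * (1 / (Csmall + 1))" using w(2) S(2) C0 by (intro mult_left_mono) auto
      also have "\<dots> < 1" using C0 by (simp add: field_simps)
      finally show ?thesis .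
    qed
    have EY: "emb F \<in> YA" by (rule emb_Y(1)[OF fgF(4)])
    have diff: "u - data0 = (f, g - (\<lambda>k. if k = 0 then 1 else 0), F)"
      by (auto simp: fgF(1) data0_def fun_eq_iff)
    have "Gop n (Y_scale (-1) (emb F) + Quad (emb F) w) = Gop n (Y_scale (-1) (emb F)) + Gop n (Quad (emb F) w)"
      using blin_Gop[OF n0, of \<sigma>] Y_sp_scale(1)[OF EY] Quad_Y[OF EY w(1)] unfolding blin_def by blast
    then show ?thesis
      unfolding diff using solves_bvp_iff[OF fgF(2-4) w(1) small] by (simp add: L_def M_def fgF(1) add.assoc)
  qed
  show ?thesis
  proof (rule that[of \<rho> \<delta> S])
    fix u assume u: "u \<in> DD" "nD (u - data0) < \<delta>"
    have v: "u - data0 \<in> DD" by (intro D.diff u data0_D)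
    show "S (u - data0) \<in> YY \<and> nY (S (u - data0)) \<le> \<rho> \<and> solves_bvp (a0 + S (u - data0)) u"
      using S(4)[OF v u(2)] bvp[OF u(1)] by blast
    show "w = S (u - data0)" if "w \<in> YY" "nY w \<le> \<rho>" "solves_bvp (a0 + w) u" for w
      using S(5)[OF v u(2) that(1,2)] bvp[OF u(1) that(1,2)] that(3) by blast
  qed (use S in blast)+
qed

end

theorem mainTheorem4:
  fixes m :: nat and \<sigma> :: real
  assumes "m \<ge> 4" and "\<sigma> > 0"
  shows "\<exists>U V.
     U \<subseteq> D_sp \<sigma> m \<and> data0 \<in> U \<and>
     (\<forall>u\<in>U. \<exists>\<epsilon>>0. \<forall>v\<in>D_sp \<sigma> m. D_norm \<sigma> m (D_diff v u) < \<epsilon> \<longrightarrow> v \<in> U) \<and>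
     V \<subseteq> Y_sp \<sigma> m \<and>
     (\<exists>\<epsilon>>0. \<forall>b\<in>Y_sp \<sigma> m. Y_norm \<sigma> m (Y_diff b a0) < \<epsilon> \<longrightarrow> b \<in> V) \<and>
     (\<forall>u\<in>U. \<exists>!b. b \<in> V \<and> solves_bvp b u) \<and>
     analytic_DY \<sigma> m U (\<lambda>u. THE b. b \<in> V \<and> solves_bvp b u)"
proof -
  obtain n where m: "m = n + 2" and n2: "2 \<le> n"
    by (rule that[of "m - 2"]) (use assms(1) in auto)
  have \<sigma>0: "0 \<le> \<sigma>" using assms(2) by simp
  let ?D = "D_sp \<sigma> m" and ?nD = "D_norm \<sigma> m" and ?Y = "Y_sp \<sigma> m" and ?nY = "Y_norm \<sigma> m"
  interpret D: cnorm ?D D_scale ?nD unfolding m by (rule cnorm_D)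
  interpret Y: cnorm ?Y Y_scale ?nY by (rule cnorm_Y)
  obtain \<rho> \<delta> S where pos: "0 < \<rho> \<and> 0 < \<delta>"
    and S: "\<And>u. u \<in> ?D \<Longrightarrow> ?nD (u - data0) < \<delta> \<Longrightarrow> S (u - data0) \<in> ?Y \<and> ?nY (S (u - data0)) \<le> \<rho> \<and> solves_bvp (a0 + S (u - data0)) u"
    and uniq: "\<And>u w. u \<in> ?D \<Longrightarrow> ?nD (u - data0) < \<delta> \<Longrightarrow> w \<in> ?Y \<Longrightarrow> ?nY w \<le> \<rho> \<Longrightarrow> solves_bvp (a0 + w) u \<Longrightarrow> w = S (u - data0)"
    and deriv: "\<And>u. u \<in> ?D \<Longrightarrow> ?nD u < \<delta> \<Longrightarrow> \<exists>S'. blin ?D D_scale ?nD ?Y Y_scale ?nY S' \<and>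
       (\<exists>K\<ge>0. \<forall>h\<in>?D. ?nD (u + h) < \<delta> \<longrightarrow> ?nY (S (u + h) - S u - S' h) \<le> K * (?nD h)^2)"
    by (rule local_solution[OF n2 \<sigma>0, folded m]) (rule that)
  have data0: "data0 \<in> ?D" unfolding m by (rule data0_D[OF n2 \<sigma>0])
  have a0Y: "a0 \<in> ?Y" unfolding m by (rule a0_Y[OF n2 \<sigma>0])
  have diffY: "Y_diff a b = a - b" for a b by (auto simp: Y_diff_def fun_eq_iff)
  define U where "U = {u \<in> ?D. ?nD (u - data0) < \<delta>}"
  \<comment> \<open>A closed ball: existence provides norm at most \<rho>, and uniqueness holds up
    to that radius inclusive.\<close>
  define V where "V = {b \<in> ?Y. ?nY (b - a0) \<le> \<rho>}"
  have sol: "b \<in> V \<and> solves_bvp b u \<longleftrightarrow> b = a0 + S (u - data0)" if u: "u \<in> U" for b u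
  proof
    have uD: "u \<in> ?D" "?nD (u - data0) < \<delta>" using u by (auto simp: U_def)
    show "b = a0 + S (u - data0)" if "b \<in> V \<and> solves_bvp b u"
      using uniq[OF uD, of "b - a0"] that Y.diff[OF _ a0Y, of b] by (auto simp: V_def diff_eq_eq add.commute)
    show "b \<in> V \<and> solves_bvp b u" if "b = a0 + S (u - data0)"
      using S[OF uD] that Y.add[OF a0Y] by (auto simp: V_def)
  qed
  then have the_sol: "(THE b. b \<in> V \<and> solves_bvp b u) = a0 + S (u - data0)" if "u \<in> U" for u
    using that by simp
  show ?thesis
  proof (intro exI[of _ U] exI[of _ V] conjI ballI)
    show "U \<subseteq> ?D" "V \<subseteq> ?Y" by (auto simp: U_def V_def)
    show "data0 \<in> U" using data0 pos by (simp add: U_def D.nm_zero)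
    show "\<exists>\<epsilon>>0. \<forall>b\<in>?Y. ?nY (Y_diff b a0) < \<epsilon> \<longrightarrow> b \<in> V"
      by (intro exI[of _ \<rho>]) (use pos in \<open>auto simp: V_def diffY\<close>)
    show "\<exists>!b. b \<in> V \<and> solves_bvp b u" if "u \<in> U" for u unfolding sol[OF that] by blast
    show "\<exists>\<epsilon>>0. \<forall>v\<in>?D. ?nD (D_diff v u) < \<epsilon> \<longrightarrow> v \<in> U" if "u \<in> U" for u
    proof (intro exI[of _ "\<delta> - ?nD (u - data0)"] conjI ballI impI)
      show "0 < \<delta> - ?nD (u - data0)" using that by (simp add: U_def)
      fix v assume v: "v \<in> ?D" "?nD (D_diff v u) < \<delta> - ?nD (u - data0)"
      have uD: "u \<in> ?D" using that by (simp add: U_def)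
      have "?nD (v - data0) \<le> ?nD (v - u) + ?nD (u - data0)"
        using D.nm_add[OF D.diff[OF v(1) uD] D.diff[OF uD data0]] by simp
      then show "v \<in> U" using v by (simp add: U_def D_diff_eq)
    qed
    show "analytic_DY \<sigma> m U (\<lambda>u. THE b. b \<in> V \<and> solves_bvp b u)"
      unfolding analytic_DY_def
    proof (intro conjI ballI)
      show "(THE b. b \<in> V \<and> solves_bvp b u) \<in> ?Y" if "u \<in> U" for u
        using sol[OF that] the_sol[OF that] by (auto simp: V_def)
      fix u assume u: "u \<in> U"
      have v: "u - data0 \<in> ?D" "?nD (u - data0) < \<delta>" using u D.diff[OF _ data0] by (auto simp: U_def)
      obtain S' K where S': "blin ?D D_scale ?nD ?Y Y_scale ?nY S'" and K: "K \<ge> 0"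
        and est: "\<And>h. h \<in> ?D \<Longrightarrow> ?nD (u - data0 + h) < \<delta> \<Longrightarrow> ?nY (S (u - data0 + h) - S (u - data0) - S' h) \<le> K * (?nD h)^2"
        using deriv[OF v] by blast
      have add_eq: "Y_add a b = a + b" for a b by (auto simp: Y_add_def fun_eq_iff)
      show "\<exists>L. bounded_clinear_DY \<sigma> m L \<and> (\<forall>\<epsilon>>0. \<exists>d>0. \<forall>h\<in>?D. ?nD h < d \<longrightarrow> D_add u h \<in> U \<longrightarrow>
            ?nY (Y_diff (Y_diff (THE b. b \<in> V \<and> solves_bvp b (D_add u h)) (THE b. b \<in> V \<and> solves_bvp b u)) (L h)) \<le> \<epsilon> * ?nD h)"
      proof (intro exI[of _ S'] conjI allI impI)
        show "bounded_clinear_DY \<sigma> m S'"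
          using S' unfolding bounded_clinear_DY_def blin_def by (auto simp: D_add_eq add_eq)
        fix \<epsilon> :: real assume \<epsilon>: "\<epsilon> > 0"
        show "\<exists>d>0. \<forall>h\<in>?D. ?nD h < d \<longrightarrow> D_add u h \<in> U \<longrightarrow>
            ?nY (Y_diff (Y_diff (THE b. b \<in> V \<and> solves_bvp b (D_add u h)) (THE b. b \<in> V \<and> solves_bvp b u)) (S' h)) \<le> \<epsilon> * ?nD h"
        \<comment> \<open>Within this radius the quadratic remainder K |h|^2 is at most \<epsilon>
          |h|.\<close>
        proof (intro exI[of _ "\<epsilon> / (K + 1)"] conjI ballI impI)
          show "0 < \<epsilon> / (K + 1)" using \<epsilon> K by simp
          fix h assume h: "h \<in> ?D" "?nD h < \<epsilon> / (K + 1)" "D_add u h \<in> U"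
          have uh: "u + h - data0 = u - data0 + h" by simp
          have "?nD (u - data0 + h) < \<delta>" using h(3) unfolding U_def D_add_eq uh[symmetric] by simp
          then have "?nY (S (u - data0 + h) - S (u - data0) - S' h) \<le> K * (?nD h)^2" by (rule est[OF h(1)])
          also have "\<dots> \<le> \<epsilon> * ?nD h"
          proof -
            have "K * ?nD h \<le> (K + 1) * ?nD h" using D.nm_ge0[OF h(1)] by (intro mult_right_mono) auto
            also have "\<dots> \<le> \<epsilon>" using h(2) K by (simp add: field_simps)
            finally have "K * ?nD h * ?nD h \<le> \<epsilon> * ?nD h" using D.nm_ge0[OF h(1)] by (intro mult_right_mono)
            then show ?thesis by (simp add: power2_eq_square mult.assoc)
          qed
          finally show "?nY (Y_diff (Y_diff (THE b. b \<in> V \<and> solves_bvp b (D_add u h)) (THE b. b \<in> V \<and> solves_bvp b u)) (S' h)) \<le> \<epsilon> * ?nD h"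
            unfolding D_add_eq diffY the_sol[OF u] the_sol[OF h(3)[unfolded D_add_eq]] uh by simp
        qed
      qed
    qed
  qed
qed

end
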